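(* Let $\mathcal X,\mathcal Y,\mathcal Z$ be finite sets and $P_{XYZ}\in\mathcal P(\mathcal X\times\mathcal Y\times\mathcal Z)$. Consider the sequence of hypothesis testing problems with null hypothesis $(X^n,Y^n,Z^n)\sim P_{XYZ}^{\times n}$ and alternative hypothesis "$X^n\leftrightarrow Y^n\leftrightarrow Z^n$ is Markov and $(X^n,Y^n)\sim P_{XY}^{\times n}$", i.e. $\mathcal Q_n=\{P_{XY}^{\times n}\times Q_{Z^n|Y^n}:Q_{Z^n|Y^n}\in\mathcal P(\mathcal Z^n|\mathcal Y^n)\}$. For $s>0$ let $$I_s(X\!:\!Z|Y)=\min_{Q_{Z|Y}\in\mathcal P(\mathcal Z|\mathcal Y)}D_s(P_{XYZ}\|P_{XY}\times Q_{Z|Y}).$$ Then for $s\in(0,1)\cup(1,\infty)$, $$I_s(X\!:\!Z|Y)=\frac1{s-1}\log\left(\sum_{y}P_Y(y)\Bigg(\sum_{z}P_{Z|Y=y}(z)\Big(\sum_{x}P_{X|Y=y,Z=z}(x)^sP_{X|Y=y}(x)^{1-s}\Big)^{\frac1s}\Bigg)^{s}\right),$$ where the sums run over $y$ with $P_Y(y)>0$, $z$ with $P_{Z|Y=y}(z)>0$ and $x$ with $P_{X|Y=y,Z=z}(x)>0$. Let $\phi(s)=(s-1)I_s(X\!:\!Z|Y)$, $R_0=\lim_{s\searrow0}(s\phi'(s)-\phi(s))$ and $R_\infty=\lim_{s\to\infty}(s\phi'(s)-\phi(s))$. The threshold rate and the strong converse threshold rate are both equal to the conditional mutual information $I(X\!:\!Z|Y)=D(P_{XYZ}\|P_Y\times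 P_{X|Y}\times P_{Z|Y})$. Moreover, for every $R>R_0$ the error exponent is $$\mathrm e_R=\sup_{s\in(0,1)}\frac{1-s}{s}\big(I_s(X\!:\!Z|Y)-R\big),$$ and for every $0<R<R_\infty$ the strong converse exponent is $$\mathrm{sc}_R=\sup_{s>1}\frac{s-1}{s}\big(R-I_s(X\!:\!Z|Y)\big).$$
   Context: $\mathcal P(\cdot)$ is the set of probability mass functions on a finite set; $\mathcal P(\mathcal Z|\mathcal Y)$ is the set of channels (conditional distributions, stochastic matrices) from $\mathcal Y$ to $\mathcal Z$; $(P_{XY}\times Q_{Z|Y})(x,y,z)=P_{XY}(x,y)Q_{Z|Y}(z|y)$, and similarly for $P_{XY}^{\times n}\times Q_{Z^n|Y^n}$; $P^{\times n}$ is the $n$-fold i.i.d. product. Subscripts denote marginals and conditionals of $P_{XYZ}$. $\log$ and $\exp$ are inverse to each other, in any fixed base; $-\log0=+\infty$. For a finite set $\mathcal A$, $P\in\mathcal P(\mathcal A)$, $\mathcal Q_n\subseteq\mathcal P(\mathcal A^n)$ (here $\mathcal A=\mathcal X\times\mathcal Y\times\mathcal Z$, $P=P_{XYZ}$) and a test $T:\mathcal A^n\to[0,1]$ put $\alpha(T)=\sum_{a^n}P^{\times n}(a^n)(1-T(a^n))$, $\beta(T)=\sup_{Q\in\mathcal Q_n}\sum_{a^n}Q(a^n)T(a^n)$, and $\hat\alpha_n(\mu)=\min_T\{\alpha(T):\beta(T)\le\mu\}$. Threshold rate: $\sup\{R\in\mathbb R:\limsup_n\hat\alpha_n(\exp(-nR))=0\}$;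 strong converse threshold rate: $\inf\{R\in\mathbb R:\liminf_n\hat\alpha_n(\exp(-nR))=1\}$; error exponent: $\mathrm e_R=\liminf_n-\frac1n\log\hat\alpha_n(\exp(-nR))$; strong converse exponent: $\mathrm{sc}_R=\limsup_n-\frac1n\log(1-\hat\alpha_n(\exp(-nR)))$ (both for $R>0$). Rényi divergence: for $s\in(0,1)\cup(1,\infty)$, $D_s(P\|Q)=\frac1{s-1}\log\sum_{a:P(a)>0}P(a)^sQ(a)^{1-s}$ (equal to $+\infty$ if $s>1$ and $Q(a)=0<P(a)$ for some $a$, or if $s<1$ and the sum is $0$); $D_1(P\|Q)=D(P\|Q)=\sum_aP(a)(\log P(a)-\log Q(a))$. *)

theory Defs
  imports "HOL-Probability.Probability"
begin

section \<open>Logarithm and divergences\<close>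

text \<open>
  The base \<open>b\<close> of logarithms is a parameter; \<open>exp\<close> in that base is \<open>\<lambda>x. b powr x\<close>.
  \<open>elog\<close> is the logarithm on nonnegative reals with \<open>- log 0 = + \<infinity>\<close>.
\<close>

definition elog :: "real \<Rightarrow> real \<Rightarrow> ereal" where
  "elog b x = (if x = 0 then -\<infinity> else ereal (log b x))"

text \<open>If \<open>Q a = 0 < P a\<close>, the corresponding summand is \<open>+ \<infinity>\<close>; no summand is \<open>- \<infinity>\<close>.\<close>

definition rel_entropy :: "real \<Rightarrow> 'a::finite pmf \<Rightarrow> 'a pmf \<Rightarrow> ereal" where
  "rel_entropy b P Q =
     (\<Sum>a\<in>set_pmf P. ereal (pmf P a) * (elog b (pmf P a) - elog b (pmf Q a)))"

text \<open>
  For \<open>s < 1\<close> and vanishing sum the value is \<open>(1 / (s - 1)) * (-\<infinity>) = \<infinity>\<close>.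
  For \<open>s > 1\<close> the case \<open>Q a = 0 < P a\<close> has to be separated, because \<open>0 powr (1 - s) = 0\<close>.
\<close>

definition renyi_div :: "real \<Rightarrow> real \<Rightarrow> 'a::finite pmf \<Rightarrow> 'a pmf \<Rightarrow> ereal" where
  "renyi_div b s P Q =
     (if s = 1 then rel_entropy b P Q
      else if s > 1 \<and> (\<exists>a. pmf Q a = 0 \<and> pmf P a > 0) then \<infinity>
      else ereal (1 / (s - 1)) *
             elog b (\<Sum>a\<in>set_pmf P. pmf P a powr s * pmf Q a powr (1 - s)))"

section \<open>Composite hypothesis testing\<close>

text \<open>
  Elements of the \<open>n\<close>-fold product of an alphabet are lists of length \<open>n\<close>, and the i.i.d. product
  is \<open>replicate_pmf n P\<close>. A testing problem is given by \<open>P\<close> and a family \<open>QQ\<close>, where \<open>QQ n\<close> is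
  a set of distributions on lists of length \<open>n\<close>.
\<close>

definition is_test :: "nat \<Rightarrow> ('a list \<Rightarrow> real) \<Rightarrow> bool" where
  "is_test n T \<longleftrightarrow> (\<forall>as. length as = n \<longrightarrow> 0 \<le> T as \<and> T as \<le> 1)"

definition err_alpha :: "'a::finite pmf \<Rightarrow> nat \<Rightarrow> ('a list \<Rightarrow> real) \<Rightarrow> real" where
  "err_alpha P n T = (\<Sum>as | length as = n. pmf (replicate_pmf n P) as * (1 - T as))"

definition err_beta ::
  "(nat \<Rightarrow> 'a::finite list pmf set) \<Rightarrow> nat \<Rightarrow> ('a list \<Rightarrow> real) \<Rightarrow> real" where
  "err_beta QQ n T = (SUP Q\<in>QQ n. \<Sum>as | length as = n. pmf Q as * T as)"

text \<open>\<open>LEAST\<close> on the reals is the minimum (which exists here by compactness, for \<open>\<mu> \<ge> 0\<close>).\<close>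

definition alpha_hat ::
  "'a::finite pmf \<Rightarrow> (nat \<Rightarrow> 'a list pmf set) \<Rightarrow> nat \<Rightarrow> real \<Rightarrow> real" where
  "alpha_hat P QQ n \<mu> =
     (LEAST v. \<exists>T. is_test n T \<and> err_beta QQ n T \<le> \<mu> \<and> v = err_alpha P n T)"

definition threshold_rate ::
  "real \<Rightarrow> 'a::finite pmf \<Rightarrow> (nat \<Rightarrow> 'a list pmf set) \<Rightarrow> ereal" where
  "threshold_rate b P QQ =
     Sup (ereal ` {R. limsup (\<lambda>n. ereal (alpha_hat P QQ n (b powr (- real n * R)))) = 0})"

definition strong_converse_threshold_rate ::
  "real \<Rightarrow> 'a::finite pmf \<Rightarrow> (nat \<Rightarrow> 'a list pmf set) \<Rightarrow> ereal" where
  "strong_converse_threshold_rate b P QQ =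
     Inf (ereal ` {R. liminf (\<lambda>n. ereal (alpha_hat P QQ n (b powr (- real n * R)))) = 1})"

definition error_exponent ::
  "real \<Rightarrow> 'a::finite pmf \<Rightarrow> (nat \<Rightarrow> 'a list pmf set) \<Rightarrow> real \<Rightarrow> ereal" where
  "error_exponent b P QQ R =
     liminf (\<lambda>n. ereal (- 1 / real n) * elog b (alpha_hat P QQ n (b powr (- real n * R))))"

definition strong_converse_exponent ::
  "real \<Rightarrow> 'a::finite pmf \<Rightarrow> (nat \<Rightarrow> 'a list pmf set) \<Rightarrow> real \<Rightarrow> ereal" where
  "strong_converse_exponent b P QQ R =
     limsup (\<lambda>n. ereal (- 1 / real n) * elog b (1 - alpha_hat P QQ n (b powr (- real n * R))))"

section \<open>Marginals, conditionals and the Markov alternative\<close>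

definition marg_XY :: "('x \<times> 'y \<times> 'z) pmf \<Rightarrow> ('x \<times> 'y) pmf" where
  "marg_XY P = map_pmf (\<lambda>(x, y, z). (x, y)) P"

definition marg_Y :: "('x \<times> 'y \<times> 'z) pmf \<Rightarrow> 'y pmf" where
  "marg_Y P = map_pmf (\<lambda>(x, y, z). y) P"

text \<open>
  The conditionals are arbitrary distributions when the conditioning event has probability zero.
\<close>

definition cond_X_Y :: "('x \<times> 'y \<times> 'z) pmf \<Rightarrow> 'y \<Rightarrow> 'x pmf" where
  "cond_X_Y P y = map_pmf (\<lambda>(x, y, z). x) (cond_pmf P {(x, y', z). y' = y})"

definition cond_Z_Y :: "('x \<times> 'y \<times> 'z) pmf \<Rightarrow> 'y \<Rightarrow> 'z pmf" where
  "cond_Z_Y P y = map_pmf (\<lambda>(x, y, z). z) (cond_pmf P {(x, y', z). y' = y})"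

definition cond_X_YZ :: "('x \<times> 'y \<times> 'z) pmf \<Rightarrow> 'y \<Rightarrow> 'z \<Rightarrow> 'x pmf" where
  "cond_X_YZ P y z = map_pmf (\<lambda>(x, y, z). x) (cond_pmf P {(x, y', z'). y' = y \<and> z' = z})"

definition chan_prod :: "('x \<times> 'y) pmf \<Rightarrow> ('y \<Rightarrow> 'z pmf) \<Rightarrow> ('x \<times> 'y \<times> 'z) pmf" where
  "chan_prod P W = do { (x, y) \<leftarrow> P; z \<leftarrow> W y; return_pmf (x, y, z) }"

lemma pmf_chan_prod:
  "pmf (chan_prod P W) (x, y, z) = pmf P (x, y) * pmf (W y) z"
proof -
  have "chan_prod P W =
      map_pmf (\<lambda>((x, y), z). (x, y, z)) (bind_pmf P (\<lambda>u. map_pmf (Pair u) (W (snd u))))"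
    unfolding chan_prod_def map_bind_pmf map_pmf_def[symmetric] pmf.map_comp o_def
    by (simp add: case_prod_unfold)
  also have "pmf \<dots> ((\<lambda>((x, y), z). (x, y, z)) ((x, y), z)) =
      pmf (bind_pmf P (\<lambda>u. map_pmf (Pair u) (W (snd u)))) ((x, y), z)"
    by (rule pmf_map_inj') (auto simp: inj_def)
  also have "\<dots> = measure_pmf.expectation P (\<lambda>u. indicator {(x, y)} u * pmf (W y) z)"
    unfolding pmf_bind
  proof (intro Bochner_Integration.integral_cong refl)
    fix u
    show "pmf (map_pmf (Pair u) (W (snd u))) ((x, y), z) = indicator {(x, y)} u * pmf (W y) z"
    proof (cases "u = (x, y)")
      case True
      then show ?thesis
        using pmf_map_inj'[of "Pair u" "W y" z] by (simp add: inj_def)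
    next
      case False
      then show ?thesis by (subst pmf_map_outside) auto
    qed
  qed
  also have "\<dots> = pmf P (x, y) * pmf (W y) z"
    by (simp add: pmf.rep_eq)
  finally show ?thesis by simp
qed

definition block_channels :: "nat \<Rightarrow> ('y list \<Rightarrow> 'z list pmf) set" where
  "block_channels n = {W. \<forall>ys. length ys = n \<longrightarrow> set_pmf (W ys) \<subseteq> {zs. length zs = n}}"

definition block_chan_prod ::
  "nat \<Rightarrow> ('x \<times> 'y) pmf \<Rightarrow> ('y list \<Rightarrow> 'z list pmf) \<Rightarrow> ('x \<times> 'y \<times> 'z) list pmf" where
  "block_chan_prod n P W =
     do { xys \<leftarrow> replicate_pmf n P;
          zs \<leftarrow> W (map snd xys);
          return_pmf (map2 (\<lambda>(x, y) z. (x, y, z)) xys zs) }"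

definition markov_alt :: "('x \<times> 'y \<times> 'z) pmf \<Rightarrow> nat \<Rightarrow> ('x \<times> 'y \<times> 'z) list pmf set" where
  "markov_alt P n = block_chan_prod n (marg_XY P) ` block_channels n"

section \<open>Conditional Renyi information\<close>

text \<open>
  The minimum exists and is finite for all \<open>s > 0\<close>; the choice \<open>W = cond_Z_Y P\<close> gives a finite
  divergence.
\<close>

definition renyi_cmi :: "real \<Rightarrow> real \<Rightarrow> ('x::finite \<times> 'y::finite \<times> 'z::finite) pmf \<Rightarrow> ereal" where
  "renyi_cmi b s P = (LEAST v. \<exists>W. v = renyi_div b s P (chan_prod (marg_XY P) W))"

definition cmi :: "real \<Rightarrow> ('x::finite \<times> 'y::finite \<times> 'z::finite) pmf \<Rightarrow> ereal" where
  "cmi b P = rel_entropy b P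
     (do { y \<leftarrow> marg_Y P; x \<leftarrow> cond_X_Y P y; z \<leftarrow> cond_Z_Y P y; return_pmf (x, y, z) })"

definition renyi_phi :: "real \<Rightarrow> ('x::finite \<times> 'y::finite \<times> 'z::finite) pmf \<Rightarrow> real \<Rightarrow> real" where
  "renyi_phi b P s = (s - 1) * real_of_ereal (renyi_cmi b s P)"

text \<open>
  \<open>renyi_phi b P\<close> is convex and smooth on \<open>s > 0\<close>, including \<open>s = 1\<close>, so the derivative and both
  (monotone) limits exist.
\<close>

definition R_zero :: "real \<Rightarrow> ('x::finite \<times> 'y::finite \<times> 'z::finite) pmf \<Rightarrow> ereal" where
  "R_zero b P =
     Lim (at_right 0) (\<lambda>s. ereal (s * deriv (renyi_phi b P) s - renyi_phi b P s))"

definition R_infty :: "real \<Rightarrow> ('x::finite \<times> 'y::finite \<times> 'z::finite) pmf \<Rightarrow> ereal" where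
  "R_infty b P =
     Lim at_top (\<lambda>s. ereal (s * deriv (renyi_phi b P) s - renyi_phi b P s))"

end

theory Submission
  imports Defs
begin

text \<open>
  For a channel-free description of \<open>I\<^sub>s\<close> put
  \<open>G s = \<Sum>y. (\<Sum>z. (\<Sum>x. P (x,y,z) powr s * P\<^sub>X\<^sub>Y (x,y) powr (1 - s)) powr (1 / s)) powr s\<close>; Hoelder's
  inequality over \<open>z\<close> gives \<open>ln (G s) = (s - 1) * I\<^sub>s\<close> in natural units, with an explicit optimal channel.

  Direct parts. Against all channels the second-kind error is a sum over \<open>y\<close> of maxima over \<open>z\<close>, so for
  each \<open>(y,z)\<close> one can use a Neyman--Pearson test between \<open>P\<^bsub>X|yz\<^esub>\<close> and \<open>P\<^bsub>X|y\<^esub>\<close> and distribute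
  the error budget optimally over \<open>y\<close>. This yields \<open>\<alpha> \<le> G s powr (1 / s) * \<mu> powr (- (1 - s) / s)\<close>
  without any loss, and \<open>G\<close> is multiplicative over blocks. Hoelder's inequality with the optimal
  memoryless channel gives the strong converse bound for \<open>s > 1\<close>. The slope of \<open>ln G\<close> at \<open>1\<close> is the
  conditional mutual information, whence the threshold rates.

  Optimality. The tilted distribution \<open>V\<close> between \<open>P\<close> and its optimal alternative \<open>Q\<close> at \<open>s\<close> has
  \<open>V\<^bsub>Z|Y\<^esub>\<close> equal to the optimal channel. Hence \<open>s * \<phi>' s - \<phi> s\<close> is both \<open>D(V\<parallel>Q)\<close> and the threshold rate
  of \<open>V\<close> against the Markov alternative, and applying the two direct bounds to \<open>V\<close> shows that tests
  reject or accept \<open>V\<close> with probability tending to \<open>1\<close> on either side of this rate. Hoelder's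
  inequality, with orders tending to \<open>1\<close>, transfers this to \<open>P\<close> at the exponential cost \<open>D(V\<parallel>P)\<close>, so no law of
  large numbers is needed.
\<close>

subsection \<open>Hoelder inequalities for finite sums\<close>

text \<open>Young's inequality is applied to the normalised summands \<open>a i / A\<close> and
  \<open>c i / C\<close>; after summation the weights \<open>t\<close> and \<open>1 - t\<close> add
  up to 1. If one total vanishes over a finite \<open>S\<close>, then so does every product.\<close>

lemma Hoelder_sum_weighted:
  fixes a c :: "'i \<Rightarrow> real"
  assumes "0 < t" "t < 1" "\<And>i. i \<in> S \<Longrightarrow> 0 \<le> a i" "\<And>i. i \<in> S \<Longrightarrow> 0 \<le> c i"
  shows "(\<Sum>i\<in>S. a i powr t * c i powr (1 - t)) \<le> (\<Sum>i\<in>S. a i) powr t * (\<Sum>i\<in>S. c i) powr (1 - t)"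
proof (cases "finite S \<and> (\<Sum>i\<in>S. a i) > 0 \<and> (\<Sum>i\<in>S. c i) > 0")
  case True
  define A where "A = (\<Sum>i\<in>S. a i)"
  define C where "C = (\<Sum>i\<in>S. c i)"
  have A: "A > 0" and C: "C > 0" using True by (auto simp: A_def C_def)
  have *: "a i powr t * c i powr (1 - t) \<le> A powr t * C powr (1 - t) * (t * (a i / A) + (1 - t) * (c i / C))"
    if "i \<in> S" for i
  proof (cases "a i = 0 \<or> c i = 0")
    case True
    then show ?thesis using A C assms(1,2) assms(3,4)[OF that] by auto
  next
    case False
    then have pos: "a i > 0" "c i > 0" using assms(3,4)[OF that] by auto
    have "(a i / A) powr t * (c i / C) powr (1 - t) \<le> t * (a i / A) + (1 - t) * (c i / C)"
      using A C pos assms(1,2) by (intro Youngs_inequality_0) auto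
    then show ?thesis
      using A C pos by (simp add: powr_divide field_simps)
  qed
  have "(\<Sum>i\<in>S. a i powr t * c i powr (1 - t)) \<le>
      (\<Sum>i\<in>S. A powr t * C powr (1 - t) * (t * (a i / A) + (1 - t) * (c i / C)))"
    using * by (rule sum_mono)
  also have "\<dots> = A powr t * C powr (1 - t) * (t * (A / A) + (1 - t) * (C / C))"
    unfolding sum_distrib_left[symmetric] sum.distrib sum_divide_distrib[symmetric] A_def C_def by simp
  also have "\<dots> = A powr t * C powr (1 - t)" using A C by simp
  finally show ?thesis unfolding A_def C_def .
next
  case False
  have "(\<Sum>i\<in>S. a i powr t * c i powr (1 - t)) = 0"
  proof (cases "finite S")
    case fin: True
    have "(\<Sum>i\<in>S. a i) \<ge> 0" "(\<Sum>i\<in>S. c i) \<ge> 0" using assms(3,4) by (auto intro: sum_nonneg)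
    with False fin consider "(\<Sum>i\<in>S. a i) = 0" | "(\<Sum>i\<in>S. c i) = 0" by linarith
    then have "(\<forall>i\<in>S. a i = 0) \<or> (\<forall>i\<in>S. c i = 0)"
      using fin assms(3,4) by cases (simp_all add: sum_nonneg_eq_0_iff)
    then show ?thesis using assms(1,2) by (auto intro!: sum.neutral)
  qed auto
  then show ?thesis by simp
qed

text \<open>Hoelder with exponents \<open>s\<close> and \<open>s / (s - 1)\<close>. The pointwise
  factorisation loses only in \<open>T i\<close>, which lies in [0,1] and grows when its exponent
  drops from 1 to \<open>1 - 1 / s\<close>. The lemma serves both for tests and, with
  \<open>T = 1\<close>, for the optimisation over channels.\<close>

lemma Hoelder_sum_change_of_measure:
  fixes p q T :: "'i \<Rightarrow> real"
  assumes s: "1 < s" and nn: "\<And>i. i \<in> S \<Longrightarrow> 0 \<le> p i" "\<And>i. i \<in> S \<Longrightarrow> 0 \<le> q i"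
    and T: "\<And>i. i \<in> S \<Longrightarrow> 0 \<le> T i" "\<And>i. i \<in> S \<Longrightarrow> T i \<le> 1"
    and ac: "\<And>i. i \<in> S \<Longrightarrow> q i = 0 \<Longrightarrow> p i = 0"
  shows "(\<Sum>i\<in>S. p i * T i) \<le>
    (\<Sum>i\<in>S. p i powr s * q i powr (1 - s)) powr (1 / s) * (\<Sum>i\<in>S. q i * T i) powr (1 - 1 / s)"
proof -
  have "p i * T i \<le> (p i powr s * q i powr (1 - s)) powr (1 / s) * (q i * T i) powr (1 - 1 / s)"
    if i: "i \<in> S" for i
  proof (cases "p i = 0 \<or> T i = 0")
    case False
    then have pos: "p i > 0" "q i > 0" "T i > 0" using nn[OF i] ac[OF i] T[OF i] by (auto simp: order_less_le)
    have "(p i powr s * q i powr (1 - s)) powr (1 / s) * (q i * T i) powr (1 - 1 / s)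
       = p i * (q i powr ((1 - s) / s) * q i powr (1 - 1 / s)) * T i powr (1 - 1 / s)"
      using pos s by (simp add: powr_mult powr_powr)
    also have "q i powr ((1 - s) / s) * q i powr (1 - 1 / s) = 1"
      using pos s by (simp add: powr_add[symmetric] field_simps)
    also have "p i * 1 * T i powr (1 - 1 / s) \<ge> p i * T i powr 1"
      using pos s T(2)[OF i] powr_mono'[of "1 - 1 / s" 1 "T i"] by (simp add: field_simps)
    finally show ?thesis using pos by simp
  qed auto
  then have "(\<Sum>i\<in>S. p i * T i) \<le>
      (\<Sum>i\<in>S. (p i powr s * q i powr (1 - s)) powr (1 / s) * (q i * T i) powr (1 - 1 / s))"
    by (rule sum_mono)
  also have "\<dots> \<le> (\<Sum>i\<in>S. p i powr s * q i powr (1 - s)) powr (1 / s) * (\<Sum>i\<in>S. q i * T i) powr (1 - 1 / s)"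
    using s nn T by (intro Hoelder_sum_weighted) (auto simp: field_simps)
  finally show ?thesis .
qed

subsection \<open>The optimised power sum\<close>

text \<open>\<open>v\<close> is the joint weight of (x,y,z) and \<open>u\<close> the weight of (x,y)
  in the alternative. Explicit summation sets let the same formula serve single letters and lists of
  length \<open>n\<close>.\<close>

definition mix_g :: "'x set \<Rightarrow> ('x \<Rightarrow> 'y \<Rightarrow> 'z \<Rightarrow> real) \<Rightarrow> ('x \<Rightarrow> 'y \<Rightarrow> real) \<Rightarrow> real \<Rightarrow> 'y \<Rightarrow> 'z \<Rightarrow> real" where
  "mix_g X v u s y z = (\<Sum>x\<in>X. v x y z powr s * u x y powr (1 - s))"

definition mix_A ::
  "'x set \<Rightarrow> 'z set \<Rightarrow> ('x \<Rightarrow> 'y \<Rightarrow> 'z \<Rightarrow> real) \<Rightarrow> ('x \<Rightarrow> 'y \<Rightarrow> real) \<Rightarrow> real \<Rightarrow> 'y \<Rightarrow> real" where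
  "mix_A X Z v u s y = (\<Sum>z\<in>Z. mix_g X v u s y z powr (1 / s))"

definition mix_G ::
  "'x set \<Rightarrow> 'y set \<Rightarrow> 'z set \<Rightarrow> ('x \<Rightarrow> 'y \<Rightarrow> 'z \<Rightarrow> real) \<Rightarrow> ('x \<Rightarrow> 'y \<Rightarrow> real) \<Rightarrow> real \<Rightarrow> real" where
  "mix_G X Y Z v u s = (\<Sum>y\<in>Y. mix_A X Z v u s y powr s)"

lemma mix_g_nonneg: "0 \<le> mix_g X v u s y z"
  by (simp add: mix_g_def sum_nonneg)

lemma mix_A_nonneg: "0 \<le> mix_A X Z v u s y"
  by (simp add: mix_A_def sum_nonneg)

text \<open>Hoelder's inequality is used once in each layer: over \<open>x\<close>, then
  \<open>z\<close>, then \<open>y\<close>. Convexity of \<open>ln (mix_G ...)\<close> in the order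
  is what later makes the rate \<open>s * L' s - L s\<close> monotone.\<close>

lemma mix_G_log_convex:
  assumes s: "0 < s" "0 < t" and l: "0 < l" "l < 1"
  shows "mix_G X Y Z v u (l * s + (1 - l) * t) \<le>
    mix_G X Y Z v u s powr l * mix_G X Y Z v u t powr (1 - l)"
proof -
  define r where "r = l * s + (1 - l) * t"
  have r: "r > 0" unfolding r_def using assms by (simp add: add_pos_pos)
  \<comment> \<open>The middle layer carries the exponents \<open>1 / s\<close>,
    \<open>1 / t\<close> and \<open>1 / r\<close>, so its weight has to satisfy
    \<open>l / r = \<theta> / s\<close> and \<open>(1 - l) / r = (1 - \<theta>) / t\<close>. Raising
    to the power \<open>r\<close> then restores the weight \<open>l\<close>.\<close>
  define \<theta> where "\<theta> = l * s / r"
  have ls: "l * s > 0" and lt: "(1 - l) * t > 0" using s l by auto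
  then have \<theta>: "0 < \<theta>" "\<theta> < 1" using r by (auto simp: \<theta>_def r_def field_simps)
  have \<theta>': "1 - \<theta> = (1 - l) * t / r" using r by (simp add: \<theta>_def r_def field_simps)
  have g: "mix_g X v u r y z \<le> mix_g X v u s y z powr l * mix_g X v u t y z powr (1 - l)" for y z
  proof -
    have "mix_g X v u r y z =
      (\<Sum>x\<in>X. (v x y z powr s * u x y powr (1 - s)) powr l *
         (v x y z powr t * u x y powr (1 - t)) powr (1 - l))"
      unfolding mix_g_def
    proof (intro sum.cong refl)
      fix x
      have "(v x y z powr s * u x y powr (1 - s)) powr l *
         (v x y z powr t * u x y powr (1 - t)) powr (1 - l) =
         (v x y z powr (s * l) * v x y z powr (t * (1 - l))) *
         (u x y powr ((1 - s) * l) * u x y powr ((1 - t) * (1 - l)))"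
        by (simp add: powr_mult powr_powr mult_ac)
      also have "\<dots> = v x y z powr (s * l + t * (1 - l)) * u x y powr ((1 - s) * l + (1 - t) * (1 - l))"
        by (simp add: powr_add)
      also have "s * l + t * (1 - l) = r" by (simp add: r_def)
      also have "(1 - s) * l + (1 - t) * (1 - l) = 1 - r" by (simp add: r_def algebra_simps)
      finally show "v x y z powr r * u x y powr (1 - r) =
          (v x y z powr s * u x y powr (1 - s)) powr l *
          (v x y z powr t * u x y powr (1 - t)) powr (1 - l)" ..
    qed
    also have "\<dots> \<le> mix_g X v u s y z powr l * mix_g X v u t y z powr (1 - l)"
      unfolding mix_g_def using l by (intro Hoelder_sum_weighted) auto
    finally show ?thesis .
  qed
  have A: "mix_A X Z v u r y powr r \<le> (mix_A X Z v u s y powr s) powr l * (mix_A X Z v u t y powr t) powr (1 - l)" for y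
  proof -
    have "mix_A X Z v u r y \<le> (\<Sum>z\<in>Z. (mix_g X v u s y z powr l * mix_g X v u t y z powr (1 - l)) powr (1 / r))"
      unfolding mix_A_def using r g mix_g_nonneg by (intro sum_mono powr_mono2) auto
    also have "\<dots> = (\<Sum>z\<in>Z. (mix_g X v u s y z powr (1 / s)) powr \<theta> * (mix_g X v u t y z powr (1 / t)) powr (1 - \<theta>))"
      using r s unfolding \<theta>' by (simp add: \<theta>_def powr_mult powr_powr)
    also have "\<dots> \<le> mix_A X Z v u s y powr \<theta> * mix_A X Z v u t y powr (1 - \<theta>)"
      unfolding mix_A_def using \<theta> by (intro Hoelder_sum_weighted) auto
    finally have "mix_A X Z v u r y powr r \<le> (mix_A X Z v u s y powr \<theta> * mix_A X Z v u t y powr (1 - \<theta>)) powr r"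
      using r mix_A_nonneg by (intro powr_mono2) auto
    also have "\<dots> = (mix_A X Z v u s y powr s) powr l * (mix_A X Z v u t y powr t) powr (1 - l)"
      using r unfolding \<theta>' by (simp add: \<theta>_def powr_mult powr_powr mult_ac)
    finally show ?thesis .
  qed
  have "mix_G X Y Z v u r \<le> (\<Sum>y\<in>Y. (mix_A X Z v u s y powr s) powr l * (mix_A X Z v u t y powr t) powr (1 - l))"
    unfolding mix_G_def using A by (rule sum_mono)
  also have "\<dots> \<le> mix_G X Y Z v u s powr l * mix_G X Y Z v u t powr (1 - l)"
    unfolding mix_G_def using l by (intro Hoelder_sum_weighted) auto
  finally show ?thesis unfolding r_def .
qed

text \<open>Neyman--Pearson test: with \<open>t = (g / c) powr (1 / s)\<close> and \<open>T = 1\<close> where \<open>v \<ge> t * u\<close>, the bounds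
  \<open>u * T \<le> t powr (- s) * v powr s * u powr (1 - s)\<close> and
  \<open>v * (1 - T) \<le> t powr (1 - s) * v powr s * u powr (1 - s)\<close> hold pointwise.\<close>

lemma threshold_test:
  fixes v u :: "'x \<Rightarrow> real"
  assumes fin: "finite X" and nn: "\<And>x. 0 \<le> v x" "\<And>x. 0 \<le> u x"
    and ac: "\<And>x. u x = 0 \<Longrightarrow> v x = 0" and s: "0 < s" "s < 1" and c: "0 \<le> c"
    and g_def: "g = (\<Sum>x\<in>X. v x powr s * u x powr (1 - s))" and cg: "g > 0 \<Longrightarrow> c > 0"
  obtains T :: "'x \<Rightarrow> real" where "\<And>x. 0 \<le> T x" "\<And>x. T x \<le> 1"
    "(\<Sum>x\<in>X. u x * T x) \<le> c"
    "(\<Sum>x\<in>X. v x * (1 - T x)) \<le> g powr (1 / s) * c powr (- ((1 - s) / s))"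
proof (cases "g > 0")
  case True
  then have c: "c > 0" by (rule cg)
  define t where "t = (g / c) powr (1 / s)"
  have t: "t > 0" using True c by (simp add: t_def)
  define T where "T x = (if v x \<ge> t * u x \<and> v x > 0 then 1 else 0 :: real)" for x
  have 1: "u x * T x \<le> t powr (- s) * (v x powr s * u x powr (1 - s))" for x
  proof (cases "T x = 0 \<or> u x = 0")
    case False
    then have ux: "u x > 0" "v x \<ge> t * u x" "T x = 1" using nn(2)[of x] by (auto simp: T_def split: if_splits)
    have "u x = t powr (- s) * ((t * u x) powr s * u x powr (1 - s))"
      using ux t by (simp add: powr_mult powr_add[symmetric] flip: mult.assoc)
    also have "\<dots> \<le> t powr (- s) * (v x powr s * u x powr (1 - s))"
      using ux t s by (intro mult_left_mono mult_right_mono powr_mono2) auto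
    finally show ?thesis using ux by simp
  qed auto
  have 2: "v x * (1 - T x) \<le> t powr (1 - s) * (v x powr s * u x powr (1 - s))" for x
  proof (cases "T x = 1 \<or> v x = 0")
    case False
    then have vx: "v x > 0" "v x \<le> t * u x" "T x = 0" using nn(1)[of x] by (auto simp: T_def split: if_splits)
    have "v x = v x powr s * v x powr (1 - s)"
      using vx by (simp add: powr_add[symmetric])
    also have "\<dots> \<le> v x powr s * (t * u x) powr (1 - s)"
      using vx t s by (intro mult_left_mono mult_right_mono powr_mono2) auto
    also have "\<dots> = t powr (1 - s) * (v x powr s * u x powr (1 - s))"
      using t nn(2)[of x] by (simp add: powr_mult)
    finally show ?thesis using vx by simp
  qed auto
  show ?thesis
  proof (rule that[of T])
    have "(\<Sum>x\<in>X. u x * T x) \<le> t powr (- s) * g"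
      unfolding g_def sum_distrib_left using 1 by (rule sum_mono)
    also have "\<dots> = c" using True c s by (simp add: t_def powr_powr powr_minus)
    finally show "(\<Sum>x\<in>X. u x * T x) \<le> c" .
    have "(\<Sum>x\<in>X. v x * (1 - T x)) \<le> t powr (1 - s) * g"
      unfolding g_def sum_distrib_left using 2 by (rule sum_mono)
    also have "\<dots> = g powr ((1 - s) / s) * g powr 1 * c powr (- ((1 - s) / s))"
      using True c s by (simp add: t_def powr_powr powr_divide powr_minus field_simps)
    also have "g powr ((1 - s) / s) * g powr 1 = g powr (1 / s)"
      unfolding powr_add[symmetric] using s by (simp add: field_simps)
    finally show "(\<Sum>x\<in>X. v x * (1 - T x)) \<le> g powr (1 / s) * c powr (- ((1 - s) / s))" .
  qed (auto simp: T_def)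
next
  case False
  \<comment> \<open>\<open>g = 0\<close> together with \<open>ac\<close> forces \<open>v\<close> to
    vanish on \<open>X\<close>, so the test that always rejects commits neither error.\<close>
  have "g \<ge> 0" unfolding g_def by (intro sum_nonneg) auto
  with False have "g = 0" by simp
  then have "v x powr s * u x powr (1 - s) = 0" if "x \<in> X" for x
    unfolding g_def using that fin by (subst (asm) sum_nonneg_eq_0_iff) auto
  then have "v x = 0" if "x \<in> X" for x using that ac by fastforce
  then show ?thesis using c \<open>g = 0\<close> by (intro that[of "\<lambda>_. 0"]) auto
qed

text \<open>The budget \<open>\<mu>\<close> for the second-kind error is shared among the \<open>y\<close> in proportion to
  \<open>mix_A powr s\<close>, the Lagrange optimum of \<open>\<Sum>y. mix_A y * c y powr (- (1 - s) / s)\<close>.\<close>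

lemma composite_threshold_test:
  fixes v :: "'x \<Rightarrow> 'y \<Rightarrow> 'z \<Rightarrow> real" and u :: "'x \<Rightarrow> 'y \<Rightarrow> real"
  assumes fin: "finite X" "finite Y" "finite Z"
    and nn: "\<And>x y z. 0 \<le> v x y z" "\<And>x y. 0 \<le> u x y"
    and ac: "\<And>x y z. u x y = 0 \<Longrightarrow> v x y z = 0"
    and s: "0 < s" "s < 1" and \<mu>: "0 < \<mu>" and G: "mix_G X Y Z v u s > 0"
  obtains T :: "'x \<Rightarrow> 'y \<Rightarrow> 'z \<Rightarrow> real" and c :: "'y \<Rightarrow> real"
  where "\<And>x y z. 0 \<le> T x y z" "\<And>x y z. T x y z \<le> 1" "\<And>y. 0 \<le> c y" "(\<Sum>y\<in>Y. c y) \<le> \<mu>"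
    "\<And>y z. y \<in> Y \<Longrightarrow> z \<in> Z \<Longrightarrow> (\<Sum>x\<in>X. u x y * T x y z) \<le> c y"
    "(\<Sum>y\<in>Y. \<Sum>z\<in>Z. \<Sum>x\<in>X. v x y z * (1 - T x y z)) \<le>
       mix_G X Y Z v u s powr (1 / s) * \<mu> powr (- ((1 - s) / s))"
proof -
  define A where "A = mix_A X Z v u s"
  define g where "g = mix_g X v u s"
  define GG where "GG = mix_G X Y Z v u s"
  define c where "c y = \<mu> * A y powr s / GG" for y
  have GG: "GG > 0" using G by (simp add: GG_def)
  have A: "0 \<le> A y" for y by (simp add: A_def mix_A_nonneg)
  have c: "0 \<le> c y" for y using GG \<mu> by (simp add: c_def)
  have Apos: "A y > 0" if "g y z > 0" "z \<in> Z" for y z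
    unfolding A_def mix_A_def using that fin by (intro sum_pos2[of _ z]) (auto simp: g_def)
  define ok where "ok y z T \<longleftrightarrow> (\<forall>x. 0 \<le> T x \<and> T x \<le> 1) \<and> (\<Sum>x\<in>X. u x y * T x) \<le> c y \<and>
     (\<Sum>x\<in>X. v x y z * (1 - T x)) \<le> g y z powr (1 / s) * c y powr (- ((1 - s) / s))" for y z T
  have "\<exists>T. ok y z T"
    if "z \<in> Z" for y z
  proof -
    \<comment> \<open>A positive \<open>g y z\<close> makes \<open>A y\<close>, and with it the
      share \<open>c y\<close> of the budget, positive; \<open>threshold_test\<close> requires
      this.\<close>
    have cpos: "g y z > 0 \<Longrightarrow> c y > 0" using Apos[of y z, OF _ that] GG \<mu> by (simp add: c_def)
    show ?thesis
    proof (rule threshold_test[of X "\<lambda>x. v x y z" "\<lambda>x. u x y" s "c y" "g y z"])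
      fix T :: "'x \<Rightarrow> real"
      assume "\<And>x. 0 \<le> T x" "\<And>x. T x \<le> 1" "(\<Sum>x\<in>X. u x y * T x) \<le> c y"
        "(\<Sum>x\<in>X. v x y z * (1 - T x)) \<le> g y z powr (1 / s) * c y powr (- ((1 - s) / s))"
      then show ?thesis unfolding ok_def by blast
    qed (use fin nn ac s c cpos in \<open>auto simp: g_def mix_g_def\<close>)
  qed
  then have ex: "\<exists>T. ok y z T" if "z \<in> Z" for y z using that by blast
  define T0 where "T0 y z = (SOME T. ok y z T)" for y z
  have "ok y z (T0 y z)" if "z \<in> Z" for y z
    unfolding T0_def by (rule someI_ex[of "ok y z", OF ex[OF that]])
  then have T: "\<And>y z x. z \<in> Z \<Longrightarrow> 0 \<le> T0 y z x \<and> T0 y z x \<le> 1"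
     "\<And>y z. z \<in> Z \<Longrightarrow> (\<Sum>x\<in>X. u x y * T0 y z x) \<le> c y"
     "\<And>y z. z \<in> Z \<Longrightarrow> (\<Sum>x\<in>X. v x y z * (1 - T0 y z x)) \<le> g y z powr (1 / s) * c y powr (- ((1 - s) / s))"
    by (auto simp: ok_def)
  define T' where "T' x y z = (if z \<in> Z then T0 y z x else 0)" for x y z
  have "(\<Sum>y\<in>Y. \<Sum>z\<in>Z. \<Sum>x\<in>X. v x y z * (1 - T' x y z)) \<le>
      (\<Sum>y\<in>Y. \<Sum>z\<in>Z. g y z powr (1 / s) * c y powr (- ((1 - s) / s)))"
    using T(3) by (intro sum_mono) (simp add: T'_def)
  also have "\<dots> = (\<Sum>y\<in>Y. A y * c y powr (- ((1 - s) / s)))"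
    by (simp add: A_def mix_A_def g_def sum_distrib_right)
  \<comment> \<open>With this budget each \<open>y\<close> contributes \<open>A y powr s\<close>
    times a common constant, so the sum over \<open>y\<close> collapses to
    \<open>GG\<close>.\<close>
  also have "\<dots> = (\<Sum>y\<in>Y. A y powr s * ((GG / \<mu>) powr ((1 - s) / s)))"
  proof (rule sum.cong[OF refl])
    fix y
    show "A y * c y powr (- ((1 - s) / s)) = A y powr s * ((GG / \<mu>) powr ((1 - s) / s))"
    proof (cases "A y = 0")
      case False
      then have Ay: "A y > 0" using A[of y] by simp
      have "c y powr (- ((1 - s) / s)) = A y powr (- (1 - s)) * (GG / \<mu>) powr ((1 - s) / s)"
      proof -
        have "c y = A y powr s * (GG / \<mu>) powr (- 1)"
          using GG \<mu> by (simp add: c_def powr_minus)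
        then have "c y powr (- ((1 - s) / s)) = A y powr (s * (- ((1 - s) / s))) * (GG / \<mu>) powr (- 1 * (- ((1 - s) / s)))"
          by (simp only: powr_mult powr_powr)
        also have "s * (- ((1 - s) / s)) = - (1 - s)" using s by simp
        also have "- 1 * (- ((1 - s) / s)) = (1 - s) / s" by (simp add: minus_divide_left)
        finally show ?thesis .
      qed
      also have "A y * \<dots> = A y powr 1 * A y powr (- (1 - s)) * (GG / \<mu>) powr ((1 - s) / s)"
        using Ay by simp
      also have "A y powr 1 * A y powr (- (1 - s)) = A y powr s"
        unfolding powr_add[symmetric] by simp
      finally show ?thesis .
    qed (use s in auto)
  qed
  also have "\<dots> = GG powr 1 * ((GG / \<mu>) powr ((1 - s) / s))"
    using GG by (simp add: GG_def mix_G_def A_def sum_distrib_right)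
  also have "\<dots> = (GG powr 1 * GG powr ((1 - s) / s)) * \<mu> powr (- ((1 - s) / s))"
    using GG \<mu> by (simp add: powr_divide powr_minus field_simps)
  also have "GG powr 1 * GG powr ((1 - s) / s) = GG powr (1 / s)"
    unfolding powr_add[symmetric] using s by (simp add: field_simps)
  finally have main: "(\<Sum>y\<in>Y. \<Sum>z\<in>Z. \<Sum>x\<in>X. v x y z * (1 - T' x y z)) \<le>
     GG powr (1 / s) * \<mu> powr (- ((1 - s) / s))" .
  have "(\<Sum>y\<in>Y. c y) = \<mu> * GG / GG"
    by (simp add: c_def GG_def mix_G_def A_def sum_distrib_left sum_divide_distrib)
  then have "(\<Sum>y\<in>Y. c y) \<le> \<mu>" using GG by simp
  then show ?thesis using that[of T' c] main T c by (auto simp: T'_def GG_def)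
qed

subsection \<open>Products over blocks\<close>

lemma finite_lists_length_UNIV: "finite {xs::'a::finite list. length xs = n}"
  using finite_lists_length_eq[of "UNIV::'a set" n] by simp

text \<open>Distributivity, by peeling off the head; \<open>h\<close> is generalised because the
  tail sees the factors shifted by one position.\<close>

lemma sum_lists_prod:
  fixes h :: "nat \<Rightarrow> 'a::finite \<Rightarrow> 'b::comm_semiring_1"
  shows "(\<Sum>xs | length xs = n. \<Prod>i<n. h i (xs ! i)) = (\<Prod>i<n. \<Sum>x\<in>UNIV. h i x)"
proof (induction n arbitrary: h)
  case 0
  have "{xs::'a list. length xs = 0} = {[]}" by auto
  then show ?case by simp
next
  case (Suc n)
  have bij: "bij_betw (\<lambda>(x, xs). x # xs) (UNIV \<times> {xs::'a list. length xs = n}) {xs. length xs = Suc n}"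
    by (rule bij_betw_byWitness[where f' = "\<lambda>xs. (hd xs, tl xs)"]) (auto simp: length_Suc_conv)
  have "(\<Sum>xs | length xs = Suc n. \<Prod>i<Suc n. h i (xs ! i)) =
      (\<Sum>(x, xs)\<in>UNIV \<times> {xs. length xs = n}. \<Prod>i<Suc n. h i ((x # xs) ! i))"
    by (subst sum.reindex_bij_betw[OF bij, symmetric]) (simp add: case_prod_unfold)
  also have "\<dots> = (\<Sum>x\<in>UNIV. \<Sum>xs | length xs = n. h 0 x * (\<Prod>i<n. h (Suc i) (xs ! i)))"
    by (simp add: sum.cartesian_product prod.lessThan_Suc_shift del: prod.lessThan_Suc)
  also have "\<dots> = (\<Sum>x\<in>UNIV. h 0 x) * (\<Prod>i<n. \<Sum>x\<in>UNIV. h (Suc i) x)"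
    by (simp add: sum_distrib_left[symmetric] sum_distrib_right[symmetric] Suc.IH[of "\<lambda>i. h (Suc i)"])
  also have "\<dots> = (\<Prod>i<Suc n. \<Sum>x\<in>UNIV. h i x)"
    by (simp add: prod.lessThan_Suc_shift del: prod.lessThan_Suc)
  finally show ?case .
qed

lemma sum_lists_zip:
  fixes F :: "('a::finite \<times> 'b::finite) list \<Rightarrow> 'c::comm_monoid_add"
  shows "(\<Sum>ws | length ws = n. F ws) = (\<Sum>xs | length xs = n. \<Sum>ys | length ys = n. F (zip xs ys))"
proof -
  have bij: "bij_betw (\<lambda>(xs, ys). zip xs ys)
      ({xs::'a list. length xs = n} \<times> {ys::'b list. length ys = n}) {ws. length ws = n}"
    by (rule bij_betw_byWitness[where f' = "\<lambda>ws. (map fst ws, map snd ws)"]) (auto simp: zip_map_fst_snd)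
  show ?thesis
    by (subst sum.reindex_bij_betw[OF bij, symmetric]) (simp add: sum.cartesian_product case_prod_unfold)
qed

lemma sum_lists_zip3:
  fixes F :: "('a::finite \<times> 'b::finite \<times> 'c::finite) list \<Rightarrow> 'd::comm_monoid_add"
  shows "(\<Sum>ws | length ws = n. F ws) =
    (\<Sum>ys | length ys = n. \<Sum>zs | length zs = n. \<Sum>xs | length xs = n. F (zip xs (zip ys zs)))"
proof -
  have "(\<Sum>ws | length ws = n. F ws) =
      (\<Sum>xs | length xs = n. \<Sum>ys | length ys = n. \<Sum>zs | length zs = n. F (zip xs (zip ys zs)))"
    by (simp add: sum_lists_zip sum_lists_zip[of "\<lambda>w. F (zip _ w)"])
  also have "\<dots> = (\<Sum>ys | length ys = n. \<Sum>xs | length xs = n. \<Sum>zs | length zs = n. F (zip xs (zip ys zs)))"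
    by (rule sum.swap)
  also have "\<dots> = (\<Sum>ys | length ys = n. \<Sum>zs | length zs = n. \<Sum>xs | length xs = n. F (zip xs (zip ys zs)))"
    by (intro sum.cong refl, rule sum.swap)
  finally show ?thesis .
qed

text \<open>In each of the three layers the summand is a product over positions, so
  \<open>sum_lists_prod\<close> factors the sum, and powers pass through products of nonnegative
  numbers. The multiplicativity is exact, hence the single-letter quantity governs every block
  length.\<close>

lemma mix_G_block:
  fixes v :: "'x::finite \<Rightarrow> 'y::finite \<Rightarrow> 'z::finite \<Rightarrow> real"
  assumes nn: "\<And>x y z. 0 \<le> v x y z" "\<And>x y. 0 \<le> u x y"
  shows "mix_G {xs. length xs = n} {ys. length ys = n} {zs. length zs = n}
      (\<lambda>xs ys zs. \<Prod>i<n. v (xs ! i) (ys ! i) (zs ! i)) (\<lambda>xs ys. \<Prod>i<n. u (xs ! i) (ys ! i)) s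
    = mix_G UNIV UNIV UNIV v u s ^ n"
proof -
  let ?v = "\<lambda>xs ys zs. \<Prod>i<n. v (xs ! i) (ys ! i) (zs ! i)"
  let ?u = "\<lambda>xs ys. \<Prod>i<n. u (xs ! i) (ys ! i)"
  have g: "mix_g {xs. length xs = n} ?v ?u s ys zs = (\<Prod>i<n. mix_g UNIV v u s (ys ! i) (zs ! i))" for ys zs
    unfolding mix_g_def sum_lists_prod[symmetric]
    by (simp add: prod_powr_distrib nn prod.distrib)
  have A: "mix_A {xs. length xs = n} {zs. length zs = n} ?v ?u s ys = (\<Prod>i<n. mix_A UNIV UNIV v u s (ys ! i))" for ys
    unfolding mix_A_def g sum_lists_prod[symmetric]
    by (simp add: prod_powr_distrib mix_g_nonneg)
  have "mix_G {xs. length xs = n} {ys. length ys = n} {zs. length zs = n} ?v ?u s =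
     (\<Prod>i<n. mix_G UNIV UNIV UNIV v u s)"
    unfolding mix_G_def A sum_lists_prod[symmetric]
    by (simp add: prod_powr_distrib mix_A_nonneg)
  then show ?thesis by simp
qed

subsection \<open>Continuously differentiable functions on the positive half-line\<close>

text \<open>Continuity of the derivative is recorded because the rate \<open>s * L' s - L s\<close>
  is later subjected to an intermediate value argument on intervals with endpoint 1.\<close>

definition C1_pos :: "(real \<Rightarrow> real) \<Rightarrow> bool" where
  "C1_pos f \<longleftrightarrow> (\<exists>f'. (\<forall>s>0. (f has_real_derivative f' s) (at s)) \<and> continuous_on {0<..} f')"

text \<open>A sum of powers that vanishes at one \<open>s > 0\<close> vanishes at all of them. Functions with this
  dichotomy are closed under sums and powers, so no support has to be tracked.\<close>

definition nn_C1 :: "(real \<Rightarrow> real) \<Rightarrow> bool" where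
  "nn_C1 f \<longleftrightarrow> C1_pos f \<and> ((\<forall>s>0. f s = 0) \<or> (\<forall>s>0. 0 < f s))"

lemma C1_posI:
  assumes "\<And>s. s > 0 \<Longrightarrow> (f has_real_derivative f' s) (at s)" "continuous_on {0<..} f'"
  shows "C1_pos f"
  using assms unfolding C1_pos_def by blast

lemma C1_posE:
  assumes "C1_pos f"
  obtains f' where "\<And>s. s > 0 \<Longrightarrow> (f has_real_derivative f' s) (at s)"
    "continuous_on {0<..} f'" "continuous_on {0<..} f"
proof -
  obtain f' where f': "\<forall>s>0. (f has_real_derivative f' s) (at s)" "continuous_on {0<..} f'"
    using assms unfolding C1_pos_def by blast
  moreover have "continuous_on {0<..} f"
    using f'(1) by (intro continuous_at_imp_continuous_on) (auto dest: DERIV_isCont)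
  ultimately show ?thesis using that by blast
qed

lemma C1_pos_cong:
  assumes "C1_pos f" "\<And>s. s > 0 \<Longrightarrow> f s = g s"
  shows "C1_pos g"
proof -
  obtain f' where f': "\<And>s. s > 0 \<Longrightarrow> (f has_real_derivative f' s) (at s)" "continuous_on {0<..} f'"
    by (rule C1_posE[OF assms(1)]) (rule that)
  have "(g has_real_derivative f' s) (at s)" if "s > 0" for s
    by (rule has_field_derivative_transform_within_open[OF f'(1)[OF that], of "{0<..}"])
      (use that assms(2) in auto)
  then show ?thesis using f'(2) by (rule C1_posI)
qed

lemma C1_pos_const: "C1_pos (\<lambda>s. c)"
  by (rule C1_posI[where f' = "\<lambda>_. 0"]) auto

lemma C1_pos_ident: "C1_pos (\<lambda>s. s)"
  by (rule C1_posI[where f' = "\<lambda>_. 1"]) auto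

lemma C1_pos_inverse: "C1_pos (\<lambda>s. 1 / s)"
  by (rule C1_posI[where f' = "\<lambda>s. - 1 / s\<^sup>2"])
    (auto intro!: derivative_eq_intros continuous_intros simp: power2_eq_square)

lemma C1_pos_add:
  assumes "C1_pos f" "C1_pos g"
  shows "C1_pos (\<lambda>s. f s + g s)"
proof -
  from assms(1) obtain f' where f: "\<And>s. s > 0 \<Longrightarrow> (f has_real_derivative f' s) (at s)"
    "continuous_on {0<..} f'" by (rule C1_posE) (rule that)
  from assms(2) obtain g' where g: "\<And>s. s > 0 \<Longrightarrow> (g has_real_derivative g' s) (at s)"
    "continuous_on {0<..} g'" by (rule C1_posE) (rule that)
  show ?thesis
    by (rule C1_posI[where f' = "\<lambda>s. f' s + g' s"])
      (auto intro!: DERIV_add f g continuous_intros)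
qed

lemma C1_pos_mult:
  assumes "C1_pos f" "C1_pos g"
  shows "C1_pos (\<lambda>s. f s * g s)"
proof -
  from assms(1) obtain f' where f: "\<And>s. s > 0 \<Longrightarrow> (f has_real_derivative f' s) (at s)"
    "continuous_on {0<..} f'" "continuous_on {0<..} f" by (rule C1_posE) (rule that)
  from assms(2) obtain g' where g: "\<And>s. s > 0 \<Longrightarrow> (g has_real_derivative g' s) (at s)"
    "continuous_on {0<..} g'" "continuous_on {0<..} g" by (rule C1_posE) (rule that)
  show ?thesis
    by (rule C1_posI[where f' = "\<lambda>s. f' s * g s + g' s * f s"])
      (auto intro!: DERIV_mult f g continuous_intros)
qed

lemma C1_pos_exp:
  assumes "C1_pos f"
  shows "C1_pos (\<lambda>s. exp (f s))"
proof -
  from assms(1) obtain f' where f: "\<And>s. s > 0 \<Longrightarrow> (f has_real_derivative f' s) (at s)"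
    "continuous_on {0<..} f'" "continuous_on {0<..} f" by (rule C1_posE) (rule that)
  show ?thesis
    by (rule C1_posI[where f' = "\<lambda>s. exp (f s) * f' s"])
      (auto intro!: derivative_eq_intros f continuous_intros)
qed

lemma C1_pos_ln:
  assumes "C1_pos f" "\<And>s. s > 0 \<Longrightarrow> f s > 0"
  shows "C1_pos (\<lambda>s. ln (f s))"
proof -
  from assms(1) obtain f' where f: "\<And>s. s > 0 \<Longrightarrow> (f has_real_derivative f' s) (at s)"
    "continuous_on {0<..} f'" "continuous_on {0<..} f" by (rule C1_posE) (rule that)
  have "\<And>s. s > 0 \<Longrightarrow> f s \<noteq> 0" using assms(2) by fastforce
  then show ?thesis
    by (intro C1_posI[where f' = "\<lambda>s. f' s / f s"])
      (auto intro!: derivative_eq_intros f continuous_intros assms(2) simp: field_simps)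
qed

lemma nn_C1_zero: "nn_C1 (\<lambda>s. 0)"
  by (simp add: nn_C1_def C1_pos_const)

lemma nn_C1_const: "0 \<le> c \<Longrightarrow> nn_C1 (\<lambda>s. c)"
  by (auto simp: nn_C1_def C1_pos_const)

lemma nn_C1_add:
  assumes "nn_C1 f" "nn_C1 g"
  shows "nn_C1 (\<lambda>s. f s + g s)"
  unfolding nn_C1_def
proof
  show "C1_pos (\<lambda>s. f s + g s)" using assms unfolding nn_C1_def by (blast intro: C1_pos_add)
  show "(\<forall>s>0. f s + g s = 0) \<or> (\<forall>s>0. 0 < f s + g s)"
    using assms unfolding nn_C1_def by (metis add.right_neutral add.left_neutral add_pos_pos)
qed

lemma nn_C1_sum:
  assumes "finite S" "\<And>i. i \<in> S \<Longrightarrow> nn_C1 (f i)"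
  shows "nn_C1 (\<lambda>s. \<Sum>i\<in>S. f i s)"
  using assms
proof (induction rule: finite_induct)
  case (insert i S)
  then have "nn_C1 (f i)" "nn_C1 (\<lambda>s. \<Sum>i\<in>S. f i s)" by auto
  then show ?case
    using insert.hyps by (simp add: nn_C1_add)
qed (simp add: nn_C1_zero)

lemma nn_C1_mult:
  assumes "nn_C1 f" "nn_C1 g"
  shows "nn_C1 (\<lambda>s. f s * g s)"
  unfolding nn_C1_def
proof
  show "C1_pos (\<lambda>s. f s * g s)" using assms unfolding nn_C1_def by (blast intro: C1_pos_mult)
  show "(\<forall>s>0. f s * g s = 0) \<or> (\<forall>s>0. 0 < f s * g s)"
    using assms unfolding nn_C1_def by (metis mult_zero_left mult_zero_right mult_pos_pos)
qed

lemma nn_C1_powr: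
  assumes f: "nn_C1 f" and h: "C1_pos h"
  shows "nn_C1 (\<lambda>s. f s powr h s)"
proof (cases "\<forall>s>0. f s = 0")
  case True
  then show ?thesis
    unfolding nn_C1_def using C1_pos_cong[OF C1_pos_const[of 0], of "\<lambda>s. f s powr h s"] by auto
next
  case False
  then have pos: "\<And>s. s > 0 \<Longrightarrow> f s > 0" using f by (auto simp: nn_C1_def)
  have eq: "exp (h s * ln (f s)) = f s powr h s" "0 < f s powr h s" if "s > 0" for s
    using pos[OF that] by (simp_all add: powr_def)
  have "C1_pos f" using f by (simp add: nn_C1_def)
  then have "C1_pos (\<lambda>s. exp (h s * ln (f s)))"
    by (intro C1_pos_exp C1_pos_mult C1_pos_ln h pos)
  then have "C1_pos (\<lambda>s. f s powr h s)"
    using eq(1) by (rule C1_pos_cong)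
  then show ?thesis unfolding nn_C1_def using eq(2) by blast
qed

text \<open>If \<open>f 1 = 0\<close>, the dichotomy makes \<open>f\<close> vanish on the whole
  half-line, so \<open>f'\<close> and the derivative of the power are both 0. Otherwise this is the
  usual rule for a variable exponent, simplified by \<open>h 1 = 1\<close>.\<close>

lemma DERIV_powr_nn_C1:
  assumes f: "nn_C1 f" "(f has_real_derivative f') (at 1)"
    and h: "h 1 = 1" "(h has_real_derivative h') (at 1)"
  shows "((\<lambda>s. f s powr h s) has_real_derivative f' + h' * (f 1 * ln (f 1))) (at 1)"
proof (cases "f 1 = 0")
  case True
  then have "\<not> (\<forall>s>0. 0 < f s)" by (metis less_irrefl less_numeral_extra(1))
  then have z: "f s = 0" if "s > 0" for s using f(1) that unfolding nn_C1_def by blast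
  have "((\<lambda>_. 0) has_real_derivative f') (at 1)"
    by (rule has_field_derivative_transform_within_open[OF f(2), of "{0<..}"]) (use z in auto)
  then have "f' = 0" using DERIV_unique DERIV_const by blast
  moreover have "((\<lambda>s. f s powr h s) has_real_derivative 0) (at 1)"
    by (rule has_field_derivative_transform_within_open[of "\<lambda>_. 0" _ _ "{0<..}"]) (use z in auto)
  ultimately show ?thesis using True by simp
next
  case False
  then have "f 1 > 0" using f(1) unfolding nn_C1_def by (metis less_numeral_extra(1))
  then have "f 1 powr h 1 * (h' * ln (f 1) + f' * h 1 / f 1) = f' + h' * (f 1 * ln (f 1))"
    using h(1) by (simp add: field_simps)
  with DERIV_powr[OF f(2) \<open>f 1 > 0\<close> h(2)] show ?thesis by simp
qed

subsection \<open>Monotone limits and the Legendre transform\<close>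

text \<open>Identifying the limit with an infimum turns a bound on the limit into a concrete point
  \<open>s > 0\<close> at which \<open>f\<close> obeys that bound.\<close>

lemma tendsto_at_right_0_mono:
  fixes f :: "real \<Rightarrow> real"
  assumes mono: "\<And>s t. 0 < s \<Longrightarrow> s \<le> t \<Longrightarrow> f s \<le> f t"
  shows "((\<lambda>s. ereal (f s)) \<longlongrightarrow> (INF s\<in>{0<..}. ereal (f s))) (at_right 0)"
proof (rule order_tendstoI)
  fix a assume a: "a < (INF s\<in>{0<..}. ereal (f s))"
  have "a < ereal (f s)" if "s > 0" for s
    using a that by (meson INF_lower greaterThan_iff less_le_trans)
  then show "\<forall>\<^sub>F s in at_right 0. a < ereal (f s)"
    by (auto simp: eventually_at_right_less intro: eventually_mono[OF eventually_at_right_less])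
next
  fix a assume "(INF s\<in>{0<..}. ereal (f s)) < a"
  then obtain t where t: "t > 0" "ereal (f t) < a" by (auto simp: INF_less_iff)
  have "\<forall>\<^sub>F s in at_right 0. s \<in> {0<..<t}" using t by (intro eventually_at_right_real) auto
  then show "\<forall>\<^sub>F s in at_right 0. ereal (f s) < a"
  proof eventually_elim
    case (elim s)
    then have "ereal (f s) \<le> ereal (f t)" using mono[of s t] by simp
    then show ?case using t by order
  qed
qed

lemma tendsto_at_top_mono:
  fixes f :: "real \<Rightarrow> real"
  assumes mono: "\<And>s t. 0 < s \<Longrightarrow> s \<le> t \<Longrightarrow> f s \<le> f t"
  shows "((\<lambda>s. ereal (f s)) \<longlongrightarrow> (SUP s\<in>{0<..}. ereal (f s))) at_top"
proof (rule order_tendstoI)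
  fix a assume a: "(SUP s\<in>{0<..}. ereal (f s)) < a"
  have "ereal (f s) < a" if "s > 0" for s
    using a that by (meson SUP_upper greaterThan_iff le_less_trans)
  then show "\<forall>\<^sub>F s in at_top. ereal (f s) < a"
    by (auto intro: eventually_mono[OF eventually_gt_at_top[of 0]])
next
  fix a assume "a < (SUP s\<in>{0<..}. ereal (f s))"
  then obtain t where t: "t > 0" "a < ereal (f t)" by (auto simp: less_SUP_iff)
  have "\<forall>\<^sub>F s in at_top. s \<ge> t" by (rule eventually_ge_at_top)
  then show "\<forall>\<^sub>F s in at_top. a < ereal (f s)"
  proof eventually_elim
    case (elim s)
    then have "ereal (f t) \<le> ereal (f s)" using mono[of t s] t by simp
    then show ?case using t by order
  qed
qed

text \<open>\<open>L s - s * L' s\<close> is the value at 0 of the tangent at \<open>s\<close>. The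
  tangents at \<open>s\<close> and \<open>t\<close> together give \<open>L' s \<le> L' t\<close>;
  the tangent at \<open>t\<close>, evaluated at \<open>s\<close>, then gives the claim.\<close>

lemma legendre_mono:
  fixes L :: "real \<Rightarrow> real"
  assumes conv: "convex_on {0<..} L" and L': "\<And>s. s > 0 \<Longrightarrow> (L has_real_derivative L' s) (at s)"
    and st: "0 < s" "s \<le> t"
  shows "s * L' s - L s \<le> t * L' t - L t"
proof -
  have tangent: "L' c * (x - c) \<le> L x - L c" if "c > 0" "x > 0" for c x
    by (rule convex_on_imp_above_tangent[OF conv])
      (use that L' in \<open>auto simp: connected_Ioi interior_open intro: has_field_derivative_at_within\<close>)
  have 1: "L' t * (s - t) \<le> L s - L t" and 2: "L' s * (t - s) \<le> L t - L s"
    using tangent st by auto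
  have "L' s * (t - s) \<le> L' t * (t - s)" using 1 2 by (simp add: algebra_simps)
  then have "L' s \<le> L' t" using st
    by (cases "s = t") (auto simp: mult_le_cancel_right)
  then have "s * L' s \<le> s * L' t" using st by simp
  then show ?thesis using 1 by (simp add: algebra_simps)
qed

text \<open>The slope of \<open>f\<close> at its zero \<open>1\<close> turns into a strict sign of \<open>f s - c * (s - 1)\<close> near \<open>1\<close>.\<close>

lemma DERIV_below_line_right:
  fixes f :: "real \<Rightarrow> real"
  assumes f: "f 1 = 0" "(f has_real_derivative d) (at 1)" and "d < c"
  obtains r where "1 < r" "f r < c * (r - 1)"
proof -
  have "((\<lambda>s. f s - c * (s - 1)) has_real_derivative d - c) (at 1)"
    using f(2) by (auto intro!: derivative_eq_intros)
  from DERIV_neg_dec_right[OF this] assms(3) obtain e where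
    e: "e > 0" "\<And>h. h > 0 \<Longrightarrow> h < e \<Longrightarrow> f (1 + h) - c * h < f 1" by auto
  from e(2)[of "e / 2"] e(1) f(1) show ?thesis by (intro that[of "1 + e / 2"]) auto
qed

lemma DERIV_below_line_left:
  fixes f :: "real \<Rightarrow> real"
  assumes f: "f 1 = 0" "(f has_real_derivative d) (at 1)" and "c < d"
  obtains r where "0 < r" "r < 1" "f r < c * (r - 1)"
proof -
  have "((\<lambda>s. f s - c * (s - 1)) has_real_derivative d - c) (at 1)"
    using f(2) by (auto intro!: derivative_eq_intros)
  from DERIV_pos_inc_left[OF this] assms(3) obtain e where
    e: "e > 0" "\<And>h. h > 0 \<Longrightarrow> h < e \<Longrightarrow> f (1 - h) + c * h < f 1" by auto
  define h where "h = min (e / 2) (1 / 2)"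
  have h: "h > 0" "h < e" "h < 1" using e(1) by (auto simp: h_def)
  from e(2)[OF h(1,2)] h f(1) show ?thesis by (intro that[of "1 - h"]) auto
qed

subsection \<open>The power sum of a pair of distributions\<close>

text \<open>Relative entropy in natural units when \<open>q\<close> dominates \<open>V\<close>. The
  second argument is a real function so that U(x,y) V(z|y) can be entered as a quotient, without
  choosing a channel where the conditional is undefined.\<close>

definition kl :: "'a::finite pmf \<Rightarrow> ('a \<Rightarrow> real) \<Rightarrow> real" where
  "kl V q = (\<Sum>a\<in>UNIV. pmf V a * (ln (pmf V a) - ln (q a)))"

definition power_sum :: "'a::finite pmf \<Rightarrow> 'a pmf \<Rightarrow> real \<Rightarrow> real" where
  "power_sum V Q s = (\<Sum>a\<in>UNIV. pmf V a powr s * pmf Q a powr (1 - s))"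

lemma nn_C1_term:
  assumes "0 \<le> v" "0 \<le> u"
  shows "nn_C1 (\<lambda>s. v powr s * u powr (1 - s))"
proof -
  have "C1_pos (\<lambda>s. 1 + (-1) * s)"
    by (intro C1_pos_add C1_pos_mult C1_pos_const C1_pos_ident)
  then show ?thesis
    using assms by (intro nn_C1_mult nn_C1_powr nn_C1_const C1_pos_ident) auto
qed

lemma DERIV_term:
  fixes v u :: real
  assumes "0 \<le> v" "0 \<le> u" "u = 0 \<Longrightarrow> v = 0"
  shows "((\<lambda>s. v powr s * u powr (1 - s)) has_real_derivative
     v powr s * u powr (1 - s) * (ln v - ln u)) (at s)"
proof (cases "v = 0")
  case False
  then have "v > 0" "u > 0" using assms by (auto simp: order_less_le)
  then show ?thesis
    by (auto intro!: derivative_eq_intros simp: field_simps powr_diff)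
qed simp

lemma sum_pmf_UNIV: "(\<Sum>a\<in>UNIV. pmf (V :: 'a::finite pmf) a) = 1"
  by (rule sum_pmf_eq_1) auto

lemma ex_pmf_pos: "\<exists>a. pmf V a > 0"
  using set_pmf_not_empty[of V] by (auto simp: pmf_positive_iff)

lemma power_sum_pos:
  assumes "\<And>a. pmf Q a = 0 \<Longrightarrow> pmf V a = 0"
  shows "power_sum V Q s > 0"
proof -
  obtain a where a: "pmf V a > 0" using ex_pmf_pos[of V] by blast
  then have "pmf Q a > 0" using assms[of a] pmf_nonneg[of Q a] by linarith
  with a show ?thesis unfolding power_sum_def by (intro sum_pos2[of _ a]) auto
qed

lemma DERIV_power_sum:
  assumes "\<And>a. pmf Q a = 0 \<Longrightarrow> pmf V a = 0"
  shows "(power_sum V Q has_real_derivative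
    (\<Sum>a\<in>UNIV. pmf V a powr s * pmf Q a powr (1 - s) * (ln (pmf V a) - ln (pmf Q a)))) (at s)"
  unfolding power_sum_def[abs_def] using assms by (intro DERIV_sum DERIV_term) auto

lemma power_sum_1:
  assumes "\<And>a. pmf Q a = 0 \<Longrightarrow> pmf V a = 0"
  shows "power_sum V Q 1 = 1"
proof -
  have "power_sum V Q 1 = (\<Sum>a\<in>UNIV. pmf V a)"
    unfolding power_sum_def using assms by (intro sum.cong) auto
  then show ?thesis by (simp add: sum_pmf_UNIV)
qed

text \<open>This replaces the law of large numbers: a rate on one side of the relative entropy
  yields an order near 1 at which a Hoelder bound decays exponentially.\<close>

lemma DERIV_ln_power_sum_1:
  assumes ac: "\<And>a. pmf Q a = 0 \<Longrightarrow> pmf V a = 0"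
  shows "((\<lambda>s. ln (power_sum V Q s)) has_real_derivative kl V (pmf Q)) (at 1)"
proof -
  have "(\<Sum>a\<in>UNIV. pmf V a powr 1 * pmf Q a powr (1 - 1) * (ln (pmf V a) - ln (pmf Q a))) = kl V (pmf Q)"
    unfolding kl_def using ac by (intro sum.cong) auto
  then show ?thesis
    using DERIV_power_sum[OF ac, where s = 1] power_sum_1[OF ac]
    by (auto intro!: derivative_eq_intros)
qed

subsection \<open>The power sum minimised over channels\<close>

text \<open>The function \<open>G\<close> of the overview. \<open>U\<close> is kept separate from
  \<open>V\<close> because later \<open>V\<close> is a tilted distribution while \<open>U\<close>
  remains the marginal of the original \<open>P\<close>.\<close>

definition cond_power_sum :: "('x::finite \<times> 'y::finite \<times> 'z::finite) pmf \<Rightarrow> ('x \<times> 'y) pmf \<Rightarrow> real \<Rightarrow> real" where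
  "cond_power_sum V U = mix_G UNIV UNIV UNIV (\<lambda>x y z. pmf V (x, y, z)) (\<lambda>x y. pmf U (x, y))"

definition marg_XY_dominated :: "('x \<times> 'y \<times> 'z) pmf \<Rightarrow> ('x \<times> 'y) pmf \<Rightarrow> bool" where
  "marg_XY_dominated V U \<longleftrightarrow> (\<forall>x y z. pmf U (x, y) = 0 \<longrightarrow> pmf V (x, y, z) = 0)"

lemma nn_C1_cond_power_sum: "nn_C1 (cond_power_sum V U)"
proof -
  have g: "nn_C1 (\<lambda>s. mix_g UNIV (\<lambda>x y z. pmf V (x, y, z)) (\<lambda>x y. pmf U (x, y)) s y z)" for y z
    unfolding mix_g_def by (intro nn_C1_sum nn_C1_term) auto
  have A: "nn_C1 (\<lambda>s. mix_A UNIV UNIV (\<lambda>x y z. pmf V (x, y, z)) (\<lambda>x y. pmf U (x, y)) s y)" for y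
    unfolding mix_A_def by (intro nn_C1_sum nn_C1_powr g C1_pos_inverse) auto
  show ?thesis
    unfolding cond_power_sum_def mix_G_def[abs_def] by (intro nn_C1_sum nn_C1_powr A C1_pos_ident) auto
qed

definition marg_YZ_fun :: "('x::finite \<times> 'y \<times> 'z) pmf \<Rightarrow> 'y \<Rightarrow> 'z \<Rightarrow> real" where
  "marg_YZ_fun V y z = (\<Sum>x\<in>UNIV. pmf V (x, y, z))"

definition marg_Y_fun :: "('x::finite \<times> 'y \<times> 'z::finite) pmf \<Rightarrow> 'y \<Rightarrow> real" where
  "marg_Y_fun V y = (\<Sum>z\<in>UNIV. marg_YZ_fun V y z)"

lemma sum_UNIV_pair:
  fixes f :: "'a::finite \<times> 'b::finite \<Rightarrow> 'c::comm_monoid_add"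
  shows "(\<Sum>w\<in>UNIV. f w) = (\<Sum>a\<in>UNIV. \<Sum>b\<in>UNIV. f (a, b))"
  by (simp add: sum.cartesian_product flip: UNIV_Times_UNIV)

lemma sum_UNIV_triple:
  fixes f :: "'x::finite \<times> 'y::finite \<times> 'z::finite \<Rightarrow> 'a::comm_monoid_add"
  shows "(\<Sum>a\<in>UNIV. f a) = (\<Sum>y\<in>UNIV. \<Sum>z\<in>UNIV. \<Sum>x\<in>UNIV. f (x, y, z))"
proof -
  have "(\<Sum>a\<in>UNIV. f a) = (\<Sum>w\<in>UNIV. \<Sum>x\<in>UNIV. f (x, w))"
    by (subst sum_UNIV_pair) (rule sum.swap)
  then show ?thesis by (simp only: sum_UNIV_pair)
qed

lemma mix_at_1:
  assumes "marg_XY_dominated V U"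
  shows "mix_g UNIV (\<lambda>x y z. pmf V (x, y, z)) (\<lambda>x y. pmf U (x, y)) 1 y z = marg_YZ_fun V y z"
    and "mix_A UNIV UNIV (\<lambda>x y z. pmf V (x, y, z)) (\<lambda>x y. pmf U (x, y)) 1 y = marg_Y_fun V y"
proof -
  show g: "mix_g UNIV (\<lambda>x y z. pmf V (x, y, z)) (\<lambda>x y. pmf U (x, y)) 1 y z = marg_YZ_fun V y z" for z
    unfolding mix_g_def marg_YZ_fun_def
    using assms by (intro sum.cong) (auto simp: marg_XY_dominated_def)
  show "mix_A UNIV UNIV (\<lambda>x y z. pmf V (x, y, z)) (\<lambda>x y. pmf U (x, y)) 1 y = marg_Y_fun V y"
    unfolding mix_A_def marg_Y_fun_def g by (simp add: marg_YZ_fun_def sum_nonneg)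
qed

lemma cond_power_sum_1:
  assumes "marg_XY_dominated V U"
  shows "cond_power_sum V U 1 = 1"
proof -
  have "cond_power_sum V U 1 = (\<Sum>y\<in>UNIV. marg_Y_fun V y)"
    unfolding cond_power_sum_def mix_G_def mix_at_1[OF assms]
    by (simp add: marg_Y_fun_def marg_YZ_fun_def sum_nonneg)
  also have "\<dots> = (\<Sum>a\<in>UNIV. pmf V a)"
    by (simp add: sum_UNIV_triple marg_Y_fun_def marg_YZ_fun_def)
  finally show ?thesis by (simp add: sum_pmf_UNIV)
qed

text \<open>The value at order 1 is 1, and by the dichotomy in \<open>nn_C1\<close> positivity at
  one order spreads to all.\<close>

lemma cond_power_sum_pos:
  assumes "marg_XY_dominated V U" "s > 0"
  shows "cond_power_sum V U s > 0"
  using nn_C1_cond_power_sum[of V U] cond_power_sum_1[OF assms(1)] assms(2)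
  unfolding nn_C1_def by (metis less_numeral_extra(1) zero_neq_one)

lemma C1_pos_ln_cond_power_sum:
  assumes "marg_XY_dominated V U"
  shows "C1_pos (\<lambda>s. ln (cond_power_sum V U s))"
  using nn_C1_cond_power_sum[of V U] cond_power_sum_pos[OF assms] by (intro C1_pos_ln) (auto simp: nn_C1_def)

lemma convex_on_ln_cond_power_sum:
  assumes "marg_XY_dominated V U"
  shows "convex_on {0<..} (\<lambda>s. ln (cond_power_sum V U s))"
proof (rule convex_onI)
  fix t s r :: real assume t: "0 < t" "t < 1" and sr: "s \<in> {0<..}" "r \<in> {0<..}"
  have pos: "cond_power_sum V U s > 0" if "s > 0" for s using cond_power_sum_pos[OF assms that] .
  have "cond_power_sum V U ((1 - t) * s + (1 - (1 - t)) * r) \<le>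
      cond_power_sum V U s powr (1 - t) * cond_power_sum V U r powr (1 - (1 - t))"
    unfolding cond_power_sum_def using t sr by (intro mix_G_log_convex) auto
  then have "ln (cond_power_sum V U ((1 - t) * s + t * r)) \<le>
      ln (cond_power_sum V U s powr (1 - t) * cond_power_sum V U r powr t)"
    using t sr by (subst ln_le_cancel_iff) (auto intro!: pos mult_pos_pos add_pos_pos simp: pos[THEN less_imp_neq, symmetric])
  also have "\<dots> = (1 - t) * ln (cond_power_sum V U s) + t * ln (cond_power_sum V U r)"
    using pos[of s] pos[of r] sr by (simp add: ln_mult ln_powr)
  finally show "ln (cond_power_sum V U ((1 - t) *\<^sub>R s + t *\<^sub>R r)) \<le>
      (1 - t) * ln (cond_power_sum V U s) + t * ln (cond_power_sum V U r)" by simp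
qed (simp add: convex_real_interval)

text \<open>The layers are differentiated from the inside out. With h(t) = t ln t, the outer powers
  \<open>1 / s\<close> and \<open>s\<close> contribute - h(V(y,z)) and + h(V(y)), which supply the
  conditional V(z|y). For \<open>V = P\<close> and its own marginal the slope is the conditional
  mutual information.\<close>

lemma DERIV_ln_cond_power_sum_1:
  fixes V :: "('x::finite \<times> 'y::finite \<times> 'z::finite) pmf"
  assumes dom: "marg_XY_dominated V U"
  shows "((\<lambda>s. ln (cond_power_sum V U s)) has_real_derivative
    kl V (\<lambda>(x, y, z). pmf U (x, y) * (marg_YZ_fun V y z / marg_Y_fun V y))) (at 1)"
proof -
  let ?v = "\<lambda>x y z. pmf V (x, y, z)" and ?u = "\<lambda>x y. pmf U (x, y)"
  let ?h = "\<lambda>t. t * ln t :: real"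
  define g' where "g' y z = (\<Sum>x\<in>UNIV. ?v x y z * (ln (?v x y z) - ln (?u x y)))" for y z
  have nng: "nn_C1 (\<lambda>s. mix_g UNIV ?v ?u s y z)" for y z
    unfolding mix_g_def by (intro nn_C1_sum nn_C1_term) auto
  have nnA: "nn_C1 (\<lambda>s. mix_A UNIV UNIV ?v ?u s y)" for y
    unfolding mix_A_def by (intro nn_C1_sum nn_C1_powr nng C1_pos_inverse) auto
  have g: "((\<lambda>s. mix_g UNIV ?v ?u s y z) has_real_derivative g' y z) (at 1)" for y z
  proof -
    have "((\<lambda>s. mix_g UNIV ?v ?u s y z) has_real_derivative
       (\<Sum>x\<in>UNIV. ?v x y z powr 1 * ?u x y powr (1 - 1) * (ln (?v x y z) - ln (?u x y)))) (at 1)"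
      unfolding mix_g_def using dom by (intro DERIV_sum DERIV_term) (auto simp: marg_XY_dominated_def)
    also have "(\<Sum>x\<in>UNIV. ?v x y z powr 1 * ?u x y powr (1 - 1) * (ln (?v x y z) - ln (?u x y))) = g' y z"
      unfolding g'_def using dom by (intro sum.cong) (auto simp: marg_XY_dominated_def)
    finally show ?thesis .
  qed
  have inv: "((\<lambda>s::real. 1 / s) has_real_derivative - 1) (at 1)"
    by (auto intro!: derivative_eq_intros)
  have A: "((\<lambda>s. mix_A UNIV UNIV ?v ?u s y) has_real_derivative
      (\<Sum>z\<in>UNIV. g' y z + - 1 * ?h (marg_YZ_fun V y z))) (at 1)" for y
    unfolding mix_A_def mix_at_1(1)[OF dom, symmetric]
    by (intro DERIV_sum DERIV_powr_nn_C1 nng g inv) simp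
  have G: "(cond_power_sum V U has_real_derivative
      (\<Sum>y\<in>UNIV. (\<Sum>z\<in>UNIV. g' y z + - 1 * ?h (marg_YZ_fun V y z)) + 1 * ?h (marg_Y_fun V y))) (at 1)"
    unfolding cond_power_sum_def mix_G_def[abs_def] mix_at_1(2)[OF dom, symmetric]
    by (intro DERIV_sum DERIV_powr_nn_C1 nnA A DERIV_ident) simp
  \<comment> \<open>Expanding one marginal factor in each \<open>?h\<close> merges all contributions
    into a single sum over (x,y,z).\<close>
  have "?h (marg_Y_fun V y) = (\<Sum>z\<in>UNIV. \<Sum>x\<in>UNIV. ?v x y z * ln (marg_Y_fun V y))" for y
    by (simp add: marg_Y_fun_def marg_YZ_fun_def sum_distrib_right)
  moreover have "?h (marg_YZ_fun V y z) = (\<Sum>x\<in>UNIV. ?v x y z * ln (marg_YZ_fun V y z))" for y z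
    by (simp add: marg_YZ_fun_def sum_distrib_right)
  ultimately have "(\<Sum>y\<in>UNIV. (\<Sum>z\<in>UNIV. g' y z + - 1 * ?h (marg_YZ_fun V y z)) + 1 * ?h (marg_Y_fun V y)) =
     (\<Sum>y\<in>UNIV. \<Sum>z\<in>UNIV. \<Sum>x\<in>UNIV. ?v x y z * (ln (?v x y z) - ln (?u x y)) -
        ?v x y z * ln (marg_YZ_fun V y z) + ?v x y z * ln (marg_Y_fun V y))"
    by (simp add: g'_def sum.distrib sum_subtractf)
  also have "\<dots> = kl V (\<lambda>(x, y, z). ?u x y * (marg_YZ_fun V y z / marg_Y_fun V y))"
    unfolding kl_def sum_UNIV_triple
  proof (intro sum.cong refl)
    fix y z x
    show "?v x y z * (ln (?v x y z) - ln (?u x y)) - ?v x y z * ln (marg_YZ_fun V y z) +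
        ?v x y z * ln (marg_Y_fun V y) =
      ?v x y z * (ln (?v x y z) - ln (case (x, y, z) of (x, y, z) \<Rightarrow> ?u x y * (marg_YZ_fun V y z / marg_Y_fun V y)))"
    proof (cases "?v x y z = 0")
      case False
      then have v: "?v x y z > 0" by simp
      have "?u x y > 0" using dom False by (auto simp: marg_XY_dominated_def order_less_le)
      moreover have yz: "marg_YZ_fun V y z > 0"
        unfolding marg_YZ_fun_def using v by (intro sum_pos2[of _ x]) auto
      moreover have "marg_Y_fun V y > 0"
        unfolding marg_Y_fun_def using yz by (intro sum_pos2[of _ z]) (auto simp: marg_YZ_fun_def sum_nonneg)
      ultimately show ?thesis by (simp add: ln_mult ln_div algebra_simps)
    qed simp
  qed
  finally show ?thesis
    using G cond_power_sum_1[OF dom] by (auto intro!: derivative_eq_intros)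
qed

subsection \<open>Optimal channels\<close>

abbreviation cond_g :: "('x::finite \<times> 'y::finite \<times> 'z::finite) pmf \<Rightarrow> ('x \<times> 'y) pmf \<Rightarrow> real \<Rightarrow> 'y \<Rightarrow> 'z \<Rightarrow> real" where
  "cond_g V U \<equiv> mix_g UNIV (\<lambda>x y z. pmf V (x, y, z)) (\<lambda>x y. pmf U (x, y))"

abbreviation cond_A :: "('x::finite \<times> 'y::finite \<times> 'z::finite) pmf \<Rightarrow> ('x \<times> 'y) pmf \<Rightarrow> real \<Rightarrow> 'y \<Rightarrow> real" where
  "cond_A V U \<equiv> mix_A UNIV UNIV (\<lambda>x y z. pmf V (x, y, z)) (\<lambda>x y. pmf U (x, y))"

lemma cond_power_sum_altdef: "cond_power_sum V U s = (\<Sum>y\<in>UNIV. cond_A V U s y powr s)"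
  by (simp add: cond_power_sum_def mix_G_def)

lemma cond_A_altdef: "cond_A V U s y = (\<Sum>z\<in>UNIV. cond_g V U s y z powr (1 / s))"
  by (simp add: mix_A_def)

lemma sum_chan_prod_powr:
  "(\<Sum>x\<in>UNIV. pmf V (x, y, z) powr s * pmf (chan_prod U W) (x, y, z) powr (1 - s)) =
     pmf (W y) z powr (1 - s) * cond_g V U s y z"
  by (simp add: mix_g_def sum_distrib_left pmf_chan_prod powr_mult mult_ac)

lemma power_sum_chan_prod:
  "power_sum V (chan_prod U W) s = (\<Sum>y\<in>UNIV. \<Sum>z\<in>UNIV. pmf (W y) z powr (1 - s) * cond_g V U s y z)"
  unfolding power_sum_def sum_UNIV_triple sum_chan_prod_powr ..

lemma cond_g_powr_inverse: "s \<noteq> 0 \<Longrightarrow> (cond_g V U s y z powr (1 / s)) powr s = cond_g V U s y z"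
  by (simp add: powr_powr mix_g_nonneg)

text \<open>Hoelder over \<open>z\<close> for each fixed \<open>y\<close>; the channel disappears
  because its probabilities sum to 1. As \<open>1 / (s - 1)\<close> is negative, an upper bound here
  is a lower bound on the divergence.\<close>

lemma power_sum_chan_prod_le:
  assumes s: "0 < s" "s < 1"
  shows "power_sum V (chan_prod U W) s \<le> cond_power_sum V U s"
proof -
  have "(\<Sum>z\<in>UNIV. pmf (W y) z powr (1 - s) * cond_g V U s y z) \<le> cond_A V U s y powr s" for y
  proof -
    have "(\<Sum>z\<in>UNIV. pmf (W y) z powr (1 - s) * cond_g V U s y z) =
        (\<Sum>z\<in>UNIV. (cond_g V U s y z powr (1 / s)) powr s * pmf (W y) z powr (1 - s))"
      using s by (simp add: cond_g_powr_inverse mult.commute)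
    also have "\<dots> \<le> cond_A V U s y powr s * (\<Sum>z\<in>UNIV. pmf (W y) z) powr (1 - s)"
      unfolding cond_A_altdef using s by (intro Hoelder_sum_weighted) auto
    finally show ?thesis by (simp add: sum_pmf_UNIV)
  qed
  then show ?thesis unfolding power_sum_chan_prod cond_power_sum_altdef by (rule sum_mono)
qed

text \<open>The inequality reverses for \<open>s > 1\<close>, by
  \<open>Hoelder_sum_change_of_measure\<close> over \<open>z\<close> with the trivial test.
  Domination excludes the channels for which \<open>0 powr (1 - s) = 0\<close> would hide an
  infinite term.\<close>

lemma power_sum_chan_prod_ge:
  assumes s: "1 < s" and dom: "\<And>a. pmf (chan_prod U W) a = 0 \<Longrightarrow> pmf V a = 0"
  shows "cond_power_sum V U s \<le> power_sum V (chan_prod U W) s"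
proof -
  have "cond_A V U s y powr s \<le> (\<Sum>z\<in>UNIV. pmf (W y) z powr (1 - s) * cond_g V U s y z)" for y
  proof -
    have ac: "cond_g V U s y z = 0" if "pmf (W y) z = 0" for z
    proof -
      have "pmf V (x, y, z) = 0" for x
        by (rule dom) (simp add: pmf_chan_prod that)
      then show ?thesis by (simp add: mix_g_def)
    qed
    have "cond_A V U s y = (\<Sum>z\<in>UNIV. cond_g V U s y z powr (1 / s) * 1)"
      by (simp add: cond_A_altdef)
    also have "\<dots> \<le> (\<Sum>z\<in>UNIV. (cond_g V U s y z powr (1 / s)) powr s * pmf (W y) z powr (1 - s)) powr (1 / s) *
        (\<Sum>z\<in>UNIV. pmf (W y) z * 1) powr (1 - 1 / s)"
      using s ac by (intro Hoelder_sum_change_of_measure) auto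
    also have "\<dots> = (\<Sum>z\<in>UNIV. pmf (W y) z powr (1 - s) * cond_g V U s y z) powr (1 / s)"
      using s by (simp add: sum_pmf_UNIV cond_g_powr_inverse mult.commute)
    finally have "cond_A V U s y powr s \<le> ((\<Sum>z\<in>UNIV. pmf (W y) z powr (1 - s) * cond_g V U s y z) powr (1 / s)) powr s"
      using s by (intro powr_mono2) (auto simp: mix_A_nonneg)
    also have "\<dots> = (\<Sum>z\<in>UNIV. pmf (W y) z powr (1 - s) * cond_g V U s y z)"
      using s by (simp add: powr_powr sum_nonneg mix_g_nonneg)
    finally show ?thesis .
  qed
  then show ?thesis unfolding power_sum_chan_prod cond_power_sum_altdef by (rule sum_mono)
qed

lemma ex_pmf_eq_fun:
  fixes f :: "'a::finite \<Rightarrow> real"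
  assumes "\<And>a. 0 \<le> f a" "(\<Sum>a\<in>UNIV. f a) = 1"
  shows "\<exists>p. \<forall>a. pmf p a = f a"
proof -
  have "(\<integral>\<^sup>+a. ennreal (f a) \<partial>count_space UNIV) = 1"
    using assms by (simp add: nn_integral_count_space_finite sum_ennreal)
  then show ?thesis using pmf_embed_pmf[of f] assms(1) by blast
qed

text \<open>The equality case of Hoelder over \<open>z\<close>. Where \<open>cond_A\<close> vanishes
  there is nothing to normalise, and any distribution is allowed.\<close>

definition opt_chan ::
  "('x::finite \<times> 'y::finite \<times> 'z::finite) pmf \<Rightarrow> ('x \<times> 'y) pmf \<Rightarrow> real \<Rightarrow> 'y \<Rightarrow> 'z pmf" where
  "opt_chan V U s y = (SOME p. cond_A V U s y > 0 \<longrightarrow> (\<forall>z. pmf p z = cond_g V U s y z powr (1 / s) / cond_A V U s y))"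

lemma pmf_opt_chan:
  assumes "cond_A V U s y > 0"
  shows "pmf (opt_chan V U s y) z = cond_g V U s y z powr (1 / s) / cond_A V U s y"
proof -
  have "\<exists>p. \<forall>z. pmf p z = cond_g V U s y z powr (1 / s) / cond_A V U s y"
    using assms by (intro ex_pmf_eq_fun) (auto simp: sum_divide_distrib[symmetric] cond_A_altdef[symmetric])
  then have "\<exists>p. cond_A V U s y > 0 \<longrightarrow> (\<forall>z. pmf p z = cond_g V U s y z powr (1 / s) / cond_A V U s y)"
    by blast
  from someI_ex[OF this] show ?thesis using assms unfolding opt_chan_def by blast
qed

text \<open>Writing \<open>w\<close> for the channel probability, g = (w A)^s wherever g is
  positive, hence w^(1-s) g = w A^s. The right side factors into the channel and a function of
  \<open>y\<close>: this yields optimality and, later, the conditional of the tilted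
  distribution.\<close>

lemma opt_chan_powr:
  assumes s: "s > 0"
  shows "pmf (opt_chan V U s y) z powr (1 - s) * cond_g V U s y z =
    pmf (opt_chan V U s y) z * cond_A V U s y powr s"
proof (cases "cond_g V U s y z = 0")
  case True
  then show ?thesis
    using s mix_A_nonneg[of UNIV UNIV "\<lambda>x y z. pmf V (x, y, z)" "\<lambda>x y. pmf U (x, y)" s y]
    by (cases "cond_A V U s y = 0") (simp_all add: pmf_opt_chan)
next
  case False
  then have g: "cond_g V U s y z > 0" using mix_g_nonneg[of UNIV] by (simp add: order_less_le)
  then have A: "cond_A V U s y > 0" unfolding cond_A_altdef by (intro sum_pos2[of _ z]) auto
  define w where "w = pmf (opt_chan V U s y) z"
  have w: "w = cond_g V U s y z powr (1 / s) / cond_A V U s y" unfolding w_def by (rule pmf_opt_chan[OF A])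
  then have wpos: "w > 0" using g A by simp
  have "cond_g V U s y z = (w * cond_A V U s y) powr s"
    using w A s by (simp add: cond_g_powr_inverse)
  then have "w powr (1 - s) * cond_g V U s y z = w powr (1 - s) * w powr s * cond_A V U s y powr s"
    using A wpos by (simp add: powr_mult)
  also have "w powr (1 - s) * w powr s = w" using wpos by (simp add: powr_add[symmetric])
  finally show ?thesis by (simp add: w_def)
qed

lemma power_sum_opt_chan:
  assumes "s > 0"
  shows "power_sum V (chan_prod U (opt_chan V U s)) s = cond_power_sum V U s"
  unfolding power_sum_chan_prod cond_power_sum_altdef opt_chan_powr[OF assms]
  by (simp add: sum_distrib_right[symmetric] sum_pmf_UNIV)

lemma opt_chan_dominates:
  assumes dom: "marg_XY_dominated V U" and s: "s > 0" and "pmf (chan_prod U (opt_chan V U s)) a = 0"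
  shows "pmf V a = 0"
proof (rule ccontr)
  obtain x y z where a: "a = (x, y, z)" by (cases a)
  assume "pmf V a \<noteq> 0"
  then have V: "pmf V (x, y, z) > 0" using a by simp
  then have U: "pmf U (x, y) > 0" using dom by (auto simp: marg_XY_dominated_def order_less_le)
  have g: "cond_g V U s y z > 0" unfolding mix_g_def
    using V U by (intro sum_pos2[of _ x]) auto
  then have A: "cond_A V U s y > 0" unfolding cond_A_altdef by (intro sum_pos2[of _ z]) auto
  have "pmf (opt_chan V U s y) z > 0" using g A by (simp add: pmf_opt_chan)
  then show False using assms(3) U by (simp add: a pmf_chan_prod)
qed

subsection \<open>Conditional Renyi information as a power sum\<close>

lemma marg_XY_dominated_self: "marg_XY_dominated P (marg_XY P)"
  unfolding marg_XY_dominated_def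
proof (intro allI impI)
  fix x y z
  assume "pmf (marg_XY P) (x, y) = 0"
  then have "(x, y) \<notin> set_pmf (marg_XY P)" by (simp add: set_pmf_iff)
  then have "(x, y, z) \<notin> set_pmf P" unfolding marg_XY_def by force
  then show "pmf P (x, y, z) = 0" by (simp add: set_pmf_iff)
qed

lemma renyi_div_power_sum:
  assumes s: "0 < s" "s \<noteq> 1" and dom: "\<And>a. pmf Q a = 0 \<Longrightarrow> pmf P a = 0"
  shows "renyi_div b s P Q = ereal (1 / (s - 1) * log b (power_sum P Q s))"
proof -
  have "(\<Sum>a\<in>set_pmf P. pmf P a powr s * pmf Q a powr (1 - s)) = power_sum P Q s"
    unfolding power_sum_def by (rule sum.mono_neutral_left) (auto simp: set_pmf_iff)
  moreover have "power_sum P Q s \<noteq> 0" using power_sum_pos[of Q P s, OF dom] by simp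
  moreover have "\<not> (\<exists>a. pmf Q a = 0 \<and> pmf P a > 0)" using dom by fastforce
  ultimately show ?thesis using s by (simp add: renyi_div_def elog_def)
qed

text \<open>\<open>opt_chan\<close> attains the value, and the two Hoelder bounds over channels show
  that no other channel goes below it.\<close>

lemma renyi_cmi_power_sum:
  assumes b: "b > 1" and s: "0 < s" "s \<noteq> 1"
  shows "renyi_cmi b s P = ereal (1 / (s - 1) * log b (cond_power_sum P (marg_XY P) s))"
  unfolding renyi_cmi_def
proof (rule Least_equality)
  define U where "U = marg_XY P"
  have dom: "marg_XY_dominated P U" unfolding U_def by (rule marg_XY_dominated_self)
  have "renyi_div b s P (chan_prod U (opt_chan P U s)) =
      ereal (1 / (s - 1) * log b (power_sum P (chan_prod U (opt_chan P U s)) s))"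
    by (rule renyi_div_power_sum) (use s opt_chan_dominates[OF dom] in auto)
  then show "\<exists>W. ereal (1 / (s - 1) * log b (cond_power_sum P (marg_XY P) s)) =
      renyi_div b s P (chan_prod (marg_XY P) W)"
    using s unfolding U_def[symmetric] by (intro exI[of _ "opt_chan P U s"]) (simp add: power_sum_opt_chan)
  fix v assume "\<exists>W. v = renyi_div b s P (chan_prod (marg_XY P) W)"
  then obtain W where W: "v = renyi_div b s P (chan_prod U W)" unfolding U_def by blast
  have G: "cond_power_sum P U s > 0" using dom s(1) by (rule cond_power_sum_pos)
  show "ereal (1 / (s - 1) * log b (cond_power_sum P (marg_XY P) s)) \<le> v"
  proof (cases "s < 1")
    case True
    have eq: "(\<Sum>a\<in>set_pmf P. pmf P a powr s * pmf (chan_prod U W) a powr (1 - s)) = power_sum P (chan_prod U W) s"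
      unfolding power_sum_def by (rule sum.mono_neutral_left) (auto simp: set_pmf_iff)
    show ?thesis
    proof (cases "power_sum P (chan_prod U W) s = 0")
      case True
      \<comment> \<open>A vanishing sum means infinite divergence, since the negative factor
        \<open>1 / (s - 1)\<close> multiplies \<open>-\<infinity>\<close>.\<close>
      then have "v = ereal (1 / (s - 1)) * -\<infinity>" using \<open>s < 1\<close> unfolding W renyi_div_def eq by (simp add: elog_def)
      also have "\<dots> = \<infinity>" using \<open>s < 1\<close> by simp
      finally show ?thesis by simp
    next
      case False
      have pos: "power_sum P (chan_prod U W) s > 0"
        using False by (simp add: power_sum_def sum_nonneg order_less_le)
      have "log b (power_sum P (chan_prod U W) s) \<le> log b (cond_power_sum P U s)"
        using b pos G power_sum_chan_prod_le[of s P U W] s True by simp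
      then have "1 / (s - 1) * log b (cond_power_sum P U s) \<le> 1 / (s - 1) * log b (power_sum P (chan_prod U W) s)"
        using True by (intro mult_left_mono_neg) auto
      moreover have "v = ereal (1 / (s - 1) * log b (power_sum P (chan_prod U W) s))"
        using True False unfolding W renyi_div_def eq by (simp add: elog_def)
      ultimately show ?thesis by (simp add: U_def)
    qed
  next
    case False
    then have s1: "s > 1" using s by simp
    \<comment> \<open>For \<open>s > 1\<close> a channel that fails to dominate \<open>P\<close> has
      infinite divergence, so only dominating channels compete.\<close>
    show ?thesis
    proof (cases "\<exists>a. pmf (chan_prod U W) a = 0 \<and> pmf P a > 0")
      case True
      then show ?thesis using s1 by (simp add: W renyi_div_def)
    next
      case False
      then have d: "\<And>a. pmf (chan_prod U W) a = 0 \<Longrightarrow> pmf P a = 0"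
        using pmf_nonneg[of P] by (metis less_eq_real_def)
      have "log b (cond_power_sum P U s) \<le> log b (power_sum P (chan_prod U W) s)"
        using b G power_sum_chan_prod_ge[of s U W P, OF s1 d] by simp
      then have "1 / (s - 1) * log b (cond_power_sum P U s) \<le> 1 / (s - 1) * log b (power_sum P (chan_prod U W) s)"
        using s1 by (intro mult_left_mono) auto
      then show ?thesis
        unfolding W using renyi_div_power_sum[of s "chan_prod U W" P b, OF s d] by (simp add: U_def)
    qed
  qed
qed

section \<open>Explicit marginals and conditionals, and the closed formula\<close>

lemma pmf_map_finite:
  fixes P :: "'a::finite pmf"
  shows "pmf (map_pmf f P) c = (\<Sum>a | f a = c. pmf P a)"
  by (simp add: pmf_map measure_measure_pmf_finite vimage_def)

lemma measure_fibre_Y: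
  fixes P :: "('x::finite \<times> 'y::finite \<times> 'z::finite) pmf"
  shows "measure P {(x, y', z). y' = y} = marg_Y_fun P y"
proof -
  have "{(x, y', z). y' = y} = (\<lambda>(x::'x, z::'z). (x, y, z)) ` UNIV" by auto
  then have "measure P {(x, y', z). y' = y} = (\<Sum>x\<in>UNIV. \<Sum>z\<in>UNIV. pmf P (x, y, z))"
    by (simp add: measure_measure_pmf_finite sum.reindex inj_on_def sum_UNIV_pair)
  also have "\<dots> = marg_Y_fun P y"
    unfolding marg_Y_fun_def marg_YZ_fun_def by (rule sum.swap)
  finally show ?thesis .
qed

lemma measure_fibre_YZ:
  fixes P :: "('x::finite \<times> 'y::finite \<times> 'z::finite) pmf"
  shows "measure P {(x, y', z'). y' = y \<and> z' = z} = marg_YZ_fun P y z"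
proof -
  have "{(x, y', z'). y' = y \<and> z' = z} = (\<lambda>x::'x. (x, y, z)) ` UNIV" by auto
  then show ?thesis
    by (simp add: measure_measure_pmf_finite sum.reindex inj_on_def marg_YZ_fun_def)
qed

lemma pmf_marg_Y:
  fixes P :: "('x::finite \<times> 'y::finite \<times> 'z::finite) pmf"
  shows "pmf (marg_Y P) y = marg_Y_fun P y"
proof -
  have "(\<lambda>(x::'x, y, z::'z). y) -` {y} = {(x, y', z). y' = y}" by auto
  then show ?thesis unfolding marg_Y_def pmf_map by (simp add: measure_fibre_Y)
qed

lemma pmf_marg_XY:
  fixes P :: "('x::finite \<times> 'y::finite \<times> 'z::finite) pmf"
  shows "pmf (marg_XY P) (x, y) = (\<Sum>z\<in>UNIV. pmf P (x, y, z))"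
proof -
  have "(\<lambda>(x, y, z). (x, y)) -` {(x, y)} = (\<lambda>z::'z. (x, y, z)) ` UNIV" by auto
  then show ?thesis unfolding marg_XY_def pmf_map
    by (simp add: measure_measure_pmf_finite sum.reindex inj_on_def)
qed

lemma pmf_cond_pmf_pos:
  fixes P :: "'a pmf"
  assumes "measure P S > 0"
  shows "pmf (cond_pmf P S) a = (if a \<in> S then pmf P a / measure P S else 0)"
proof -
  have "set_pmf P \<inter> S \<noteq> {}" using assms measure_pmf_zero_iff[of P S] by force
  then show ?thesis by (rule pmf_cond)
qed

lemma pmf_cond_Z_Y:
  fixes P :: "('x::finite \<times> 'y::finite \<times> 'z::finite) pmf"
  assumes "marg_Y_fun P y > 0"
  shows "pmf (cond_Z_Y P y) z = marg_YZ_fun P y z / marg_Y_fun P y"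
proof -
  have m: "measure P {(x, y', z). y' = y} = marg_Y_fun P y" by (rule measure_fibre_Y)
  have c: "pmf (cond_pmf P {(x, y', z). y' = y}) (x', y', z') = (if y' = y then pmf P (x', y', z') / marg_Y_fun P y else 0)"
    for x' y' z' by (subst pmf_cond_pmf_pos) (auto simp: m assms)
  have S: "{a :: 'x \<times> 'y \<times> 'z. (case a of (x, y, z) \<Rightarrow> z) = z} = (\<lambda>(y, x). (x, y, z)) ` UNIV" by (auto simp: image_def)
  have "pmf (cond_Z_Y P y) z = (\<Sum>y'\<in>UNIV. \<Sum>x\<in>UNIV. if y' = y then pmf P (x, y', z) / marg_Y_fun P y else 0)"
    unfolding cond_Z_Y_def pmf_map_finite S
    by (simp add: sum.reindex inj_on_def sum_UNIV_pair c)
  also have "\<dots> = (\<Sum>y'\<in>UNIV. if y' = y then marg_YZ_fun P y z / marg_Y_fun P y else 0)"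
    by (intro sum.cong refl) (auto simp: marg_YZ_fun_def sum_divide_distrib)
  finally show ?thesis by simp
qed

lemma pmf_cond_X_Y:
  fixes P :: "('x::finite \<times> 'y::finite \<times> 'z::finite) pmf"
  assumes "marg_Y_fun P y > 0"
  shows "pmf (cond_X_Y P y) x = pmf (marg_XY P) (x, y) / marg_Y_fun P y"
proof -
  have m: "measure P {(x, y', z). y' = y} = marg_Y_fun P y" by (rule measure_fibre_Y)
  have c: "pmf (cond_pmf P {(x, y', z). y' = y}) (x', y', z') = (if y' = y then pmf P (x', y', z') / marg_Y_fun P y else 0)"
    for x' y' z' by (subst pmf_cond_pmf_pos) (auto simp: m assms)
  have S: "{a :: 'x \<times> 'y \<times> 'z. (case a of (x, y, z) \<Rightarrow> x) = x} = (\<lambda>(y, z). (x, y, z)) ` UNIV" by (auto simp: image_def)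
  have "pmf (cond_X_Y P y) x = (\<Sum>y'\<in>UNIV. \<Sum>z\<in>UNIV. if y' = y then pmf P (x, y', z) / marg_Y_fun P y else 0)"
    unfolding cond_X_Y_def pmf_map_finite S
    by (simp add: sum.reindex inj_on_def sum_UNIV_pair c)
  also have "\<dots> = (\<Sum>y'\<in>UNIV. if y' = y then pmf (marg_XY P) (x, y) / marg_Y_fun P y else 0)"
    by (intro sum.cong refl) (auto simp: pmf_marg_XY sum_divide_distrib)
  finally show ?thesis by simp
qed

lemma pmf_cond_X_YZ:
  fixes P :: "('x::finite \<times> 'y::finite \<times> 'z::finite) pmf"
  assumes "marg_YZ_fun P y z > 0"
  shows "pmf (cond_X_YZ P y z) x = pmf P (x, y, z) / marg_YZ_fun P y z"
proof -
  have m: "measure P {(x, y', z'). y' = y \<and> z' = z} = marg_YZ_fun P y z" by (rule measure_fibre_YZ)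
  have c: "pmf (cond_pmf P {(x, y', z'). y' = y \<and> z' = z}) (x', w) = (if w = (y, z) then pmf P (x', y, z) / marg_YZ_fun P y z else 0)"
    for x' w by (subst pmf_cond_pmf_pos) (auto simp: m assms split: prod.splits)
  have S: "{a :: 'x \<times> 'y \<times> 'z. (case a of (x, y, z) \<Rightarrow> x) = x} = (\<lambda>w. (x, w)) ` UNIV" by (auto simp: image_def)
  have "pmf (cond_X_YZ P y z) x = (\<Sum>w\<in>UNIV. if w = (y, z) then pmf P (x, y, z) / marg_YZ_fun P y z else 0)"
    unfolding cond_X_YZ_def pmf_map_finite S
    by (simp add: sum.reindex inj_on_def c)
  then show ?thesis by simp
qed

lemma marg_YZ_fun_nonneg: "0 \<le> marg_YZ_fun P y z"
  by (simp add: marg_YZ_fun_def sum_nonneg)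

lemma marg_Y_fun_nonneg: "0 \<le> marg_Y_fun P y"
  by (simp add: marg_Y_fun_def marg_YZ_fun_nonneg sum_nonneg)

lemma marg_YZ_fun_eq_0: "marg_YZ_fun P y z = 0 \<longleftrightarrow> (\<forall>x. pmf P (x, y, z) = 0)"
  by (simp add: marg_YZ_fun_def sum_nonneg_eq_0_iff)

lemma marg_Y_fun_eq_0: "marg_Y_fun P y = 0 \<longleftrightarrow> (\<forall>z. marg_YZ_fun P y z = 0)"
  by (simp add: marg_Y_fun_def sum_nonneg_eq_0_iff marg_YZ_fun_nonneg)

text \<open>After Bayes' rule the powers of P(y,z) cancel against the weight P(z|y). What remains is
  P(y)^(-1/s), which leaves the sum over \<open>z\<close>, becomes 1/P(y) under the power
  \<open>s\<close>, and cancels the outer weight.\<close>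

lemma cond_power_sum_conditionals:
  fixes P :: "('x::finite \<times> 'y::finite \<times> 'z::finite) pmf"
  assumes s: "s > 0"
  shows "(\<Sum>y\<in>set_pmf (marg_Y P). pmf (marg_Y P) y *
      (\<Sum>z\<in>set_pmf (cond_Z_Y P y). pmf (cond_Z_Y P y) z *
        (\<Sum>x\<in>set_pmf (cond_X_YZ P y z).
           pmf (cond_X_YZ P y z) x powr s * pmf (cond_X_Y P y) x powr (1 - s))
        powr (1 / s))
      powr s) = cond_power_sum P (marg_XY P) s"
    (is "(\<Sum>y\<in>_. _ * (\<Sum>z\<in>_. ?f y z) powr s) = _")
proof -
  let ?U = "marg_XY P"
  have f: "?f y z = cond_g P ?U s y z powr (1 / s) * marg_Y_fun P y powr (- (1 / s))"
    if Y: "marg_Y_fun P y > 0" for y z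
  proof (cases "marg_YZ_fun P y z = 0")
    \<comment> \<open>Here \<open>cond_X_YZ P y z\<close> is an arbitrary distribution, but its
      weight \<open>pmf (cond_Z_Y P y) z\<close> is 0.\<close>
    case True
    then have "cond_g P ?U s y z = 0" by (simp add: mix_g_def marg_YZ_fun_eq_0)
    then show ?thesis using True Y by (simp add: pmf_cond_Z_Y)
  next
    case False
    let ?y = "marg_Y_fun P y" and ?yz = "marg_YZ_fun P y z"
    have YZ: "?yz > 0" using False marg_YZ_fun_nonneg[of P y z] by simp
    have "(\<Sum>x\<in>set_pmf (cond_X_YZ P y z). pmf (cond_X_YZ P y z) x powr s * pmf (cond_X_Y P y) x powr (1 - s)) =
       (\<Sum>x\<in>UNIV. pmf (cond_X_YZ P y z) x powr s * pmf (cond_X_Y P y) x powr (1 - s))"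
      by (rule sum.mono_neutral_left) (auto simp: set_pmf_iff)
    also have "\<dots> = (\<Sum>x\<in>UNIV. (?yz powr (- s) * ?y powr (s - 1)) * (pmf P (x, y, z) powr s * pmf ?U (x, y) powr (1 - s)))"
    proof (intro sum.cong refl)
      fix x
      have "?yz powr (- s) = 1 / (?yz powr s)" "?y powr (s - 1) = 1 / (?y powr (1 - s))"
        by (simp_all flip: powr_minus_divide)
      then show "pmf (cond_X_YZ P y z) x powr s * pmf (cond_X_Y P y) x powr (1 - s) =
        (?yz powr (- s) * ?y powr (s - 1)) * (pmf P (x, y, z) powr s * pmf ?U (x, y) powr (1 - s))"
        unfolding pmf_cond_X_YZ[OF YZ] pmf_cond_X_Y[OF Y]
        using Y YZ by (simp add: powr_divide)
    qed
    also have "\<dots> = ?yz powr (- s) * ?y powr (s - 1) * cond_g P ?U s y z"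
      by (simp add: mix_g_def sum_distrib_left)
    also have "\<dots> powr (1 / s) = (?yz powr (- 1) * ?y powr ((s - 1) / s)) * cond_g P ?U s y z powr (1 / s)"
      using s by (simp add: powr_mult powr_powr)
    finally have "?f y z = ?yz / ?y * ((?yz powr (- 1) * ?y powr ((s - 1) / s)) * cond_g P ?U s y z powr (1 / s))"
      using Y by (simp add: pmf_cond_Z_Y)
    also have "\<dots> = (?yz * ?yz powr (- 1)) * (?y powr (- 1) * ?y powr ((s - 1) / s)) * cond_g P ?U s y z powr (1 / s)"
      using Y by (simp add: powr_minus divide_inverse)
    also have "?yz * ?yz powr (- 1) = 1" using YZ by (simp add: powr_minus)
    also have "?y powr (- 1) * ?y powr ((s - 1) / s) = ?y powr (- (1 / s))"
    proof -
      have "- 1 + (s - 1) / s = - (1 / s)" using s by (simp add: field_simps)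
      then show ?thesis by (simp only: powr_add[symmetric])
    qed
    finally show ?thesis by (simp add: mult.commute)
  qed
  have "pmf (marg_Y P) y * (\<Sum>z\<in>set_pmf (cond_Z_Y P y). ?f y z) powr s = cond_A P ?U s y powr s"
    if "y \<in> set_pmf (marg_Y P)" for y
  proof -
    have Y: "marg_Y_fun P y > 0" using pmf_positive[OF that] by (simp add: pmf_marg_Y)
    have "(\<Sum>z\<in>set_pmf (cond_Z_Y P y). ?f y z) = (\<Sum>z\<in>UNIV. ?f y z)"
      by (rule sum.mono_neutral_left) (auto simp: set_pmf_iff)
    also have "\<dots> = cond_A P ?U s y * marg_Y_fun P y powr (- (1 / s))"
      unfolding f[OF Y] cond_A_altdef by (simp add: sum_distrib_right)
    finally have "(\<Sum>z\<in>set_pmf (cond_Z_Y P y). ?f y z) powr s = cond_A P ?U s y powr s * marg_Y_fun P y powr (- 1)"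
      using s by (simp add: powr_mult powr_powr)
    then show ?thesis using Y by (simp add: pmf_marg_Y powr_minus)
  qed
  then have "(\<Sum>y\<in>set_pmf (marg_Y P). pmf (marg_Y P) y * (\<Sum>z\<in>set_pmf (cond_Z_Y P y). ?f y z) powr s) =
      (\<Sum>y\<in>set_pmf (marg_Y P). cond_A P ?U s y powr s)" by (rule sum.cong[OF refl])
  also have "\<dots> = (\<Sum>y\<in>UNIV. cond_A P ?U s y powr s)"
  proof (rule sum.mono_neutral_left)
    show "\<forall>y\<in>UNIV - set_pmf (marg_Y P). cond_A P ?U s y powr s = 0"
    proof
      fix y assume "y \<in> UNIV - set_pmf (marg_Y P)"
      then have "marg_Y_fun P y = 0" by (simp add: set_pmf_iff pmf_marg_Y)
      then have "pmf P (x, y, z) = 0" for x z by (simp add: marg_Y_fun_eq_0 marg_YZ_fun_eq_0)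
      then show "cond_A P ?U s y powr s = 0" by (simp add: cond_A_altdef mix_g_def)
    qed
  qed auto
  finally show ?thesis by (simp add: cond_power_sum_altdef)
qed

section \<open>Conditional mutual information as a relative entropy\<close>

lemma sum_mult_delta:
  fixes c d :: "'a::finite \<Rightarrow> real"
  shows "(\<Sum>a\<in>UNIV. c a * (if a = k then d a else 0)) = c k * d k"
proof -
  have "(\<Sum>a\<in>UNIV. c a * (if a = k then d a else 0)) = (\<Sum>a\<in>UNIV. if a = k then c a * d a else 0)"
    by (rule sum.cong) auto
  then show ?thesis by simp
qed

lemma pmf_bind_finite:
  fixes p :: "'a::finite pmf"
  shows "pmf (bind_pmf p f) c = (\<Sum>a\<in>UNIV. pmf p a * pmf (f a) c)"
  by (simp add: pmf_bind integral_measure_pmf[of UNIV])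

lemma kl_pos_cong:
  assumes "\<And>a. pmf V a > 0 \<Longrightarrow> q a = q' a"
  shows "kl V q = kl V q'"
proof -
  have "pmf V a * (ln (pmf V a) - ln (q a)) = pmf V a * (ln (pmf V a) - ln (q' a))" for a
    using assms[of a] by (cases "pmf V a = 0") (auto simp: order_less_le)
  then show ?thesis unfolding kl_def by (rule sum.cong[OF refl])
qed

lemma pmf_pos_marginals_pos:
  fixes P :: "('x::finite \<times> 'y::finite \<times> 'z::finite) pmf"
  assumes "pmf P (x, y, z) > 0"
  shows "marg_YZ_fun P y z > 0" "marg_Y_fun P y > 0" "pmf (marg_XY P) (x, y) > 0"
proof -
  have "marg_YZ_fun P y z \<noteq> 0" using assms marg_YZ_fun_eq_0[of P y z] by fastforce
  then show "marg_YZ_fun P y z > 0" "marg_Y_fun P y > 0"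
    using marg_YZ_fun_nonneg[of P] marg_Y_fun_nonneg[of P] marg_Y_fun_eq_0[of P y] by (auto simp: order_less_le)
  show "pmf (marg_XY P) (x, y) > 0"
    using marg_XY_dominated_self[of P] assms unfolding marg_XY_dominated_def
    by (metis less_irrefl order_less_le pmf_nonneg)
qed

lemma rel_entropy_kl:
  assumes dom: "\<And>a. pmf Q a = 0 \<Longrightarrow> pmf P a = 0"
  shows "rel_entropy b P Q = ereal (kl P (pmf Q) / ln b)"
proof -
  have "rel_entropy b P Q = (\<Sum>a\<in>set_pmf P. ereal (pmf P a * (ln (pmf P a) - ln (pmf Q a)) / ln b))"
    unfolding rel_entropy_def using dom
    by (intro sum.cong refl) (auto simp: elog_def set_pmf_iff log_def simp flip: diff_divide_distrib)
  also have "\<dots> = ereal (\<Sum>a\<in>set_pmf P. pmf P a * (ln (pmf P a) - ln (pmf Q a)) / ln b)"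
    by simp
  also have "(\<Sum>a\<in>set_pmf P. pmf P a * (ln (pmf P a) - ln (pmf Q a)) / ln b) = kl P (pmf Q) / ln b"
    unfolding kl_def sum_divide_distrib by (rule sum.mono_neutral_left) (auto simp: set_pmf_iff)
  finally show ?thesis .
qed

text \<open>The product of P_Y, P_X|Y and P_Z|Y agrees with P_XY x P_Z|Y on the support of
  \<open>P\<close>, and \<open>kl\<close> looks at no other points.\<close>

lemma cmi_kl:
  fixes P :: "('x::finite \<times> 'y::finite \<times> 'z::finite) pmf"
  shows "cmi b P = ereal (kl P (pmf (chan_prod (marg_XY P) (cond_Z_Y P))) / ln b)"
proof -
  define Q where "Q = do { y \<leftarrow> marg_Y P; x \<leftarrow> cond_X_Y P y; z \<leftarrow> cond_Z_Y P y; return_pmf (x, y, z) }"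
  have Q: "pmf Q (x, y, z) = pmf (marg_Y P) y * (pmf (cond_X_Y P y) x * pmf (cond_Z_Y P y) z)" for x y z
  proof -
    have "pmf Q (x, y, z) = (\<Sum>y'\<in>UNIV. pmf (marg_Y P) y' * (\<Sum>x'\<in>UNIV. pmf (cond_X_Y P y') x' *
        (\<Sum>z'\<in>UNIV. pmf (cond_Z_Y P y') z' * (if y' = y then if x' = x then if z' = z then 1 else 0 else 0 else 0))))"
      unfolding Q_def pmf_bind_finite by (intro sum.cong refl arg_cong2[where f = times]) (auto simp: pmf_return)
    also have "\<dots> = (\<Sum>y'\<in>UNIV. pmf (marg_Y P) y' * (if y' = y then \<Sum>x'\<in>UNIV. pmf (cond_X_Y P y') x' *
        (if x' = x then \<Sum>z'\<in>UNIV. pmf (cond_Z_Y P y') z' * (if z' = z then 1 else 0) else 0) else 0))"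
      by (intro sum.cong refl arg_cong2[where f = times]) (auto intro!: sum.cong)
    finally show ?thesis unfolding sum_mult_delta by simp
  qed
  have eq: "pmf Q a = pmf (chan_prod (marg_XY P) (cond_Z_Y P)) a" "pmf Q a > 0" if "pmf P a > 0" for a
  proof -
    obtain x y z where a: "a = (x, y, z)" by (cases a)
    note pos = pmf_pos_marginals_pos[OF that[unfolded a]]
    show "pmf Q a = pmf (chan_prod (marg_XY P) (cond_Z_Y P)) a" "pmf Q a > 0"
      using pos by (simp_all add: a Q pmf_chan_prod pmf_marg_Y pmf_cond_X_Y pmf_cond_Z_Y)
  qed
  have "cmi b P = ereal (kl P (pmf Q) / ln b)"
    unfolding cmi_def Q_def[symmetric] using eq(2) by (intro rel_entropy_kl) (metis less_irrefl order_less_le pmf_nonneg)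
  also have "kl P (pmf Q) = kl P (pmf (chan_prod (marg_XY P) (cond_Z_Y P)))"
    by (rule kl_pos_cong) (rule eq(1))
  finally show ?thesis .
qed

subsection \<open>Tilted distributions\<close>

text \<open>The normalised geometric mixture of \<open>P\<close> and \<open>Q\<close> with weights
  \<open>s\<close> and \<open>1 - s\<close>, an exponential family in \<open>s\<close>.\<close>

definition tilt :: "'a::finite pmf \<Rightarrow> 'a pmf \<Rightarrow> real \<Rightarrow> 'a pmf" where
  "tilt P Q s = (SOME V. \<forall>a. pmf V a = pmf P a powr s * pmf Q a powr (1 - s) / power_sum P Q s)"

context
  fixes P Q :: "'a::finite pmf" and s :: real
  assumes dom: "\<And>a. pmf Q a = 0 \<Longrightarrow> pmf P a = 0"
begin

lemma pmf_tilt: "pmf (tilt P Q s) a = pmf P a powr s * pmf Q a powr (1 - s) / power_sum P Q s"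
proof -
  have "power_sum P Q s > 0" using dom by (rule power_sum_pos)
  then have "\<exists>V. \<forall>a. pmf V a = pmf P a powr s * pmf Q a powr (1 - s) / power_sum P Q s"
    by (intro ex_pmf_eq_fun) (auto simp: sum_divide_distrib[symmetric] power_sum_def[symmetric])
  from someI_ex[OF this] show ?thesis unfolding tilt_def by blast
qed

lemma pmf_tilt_eq_0_iff: "pmf (tilt P Q s) a = 0 \<longleftrightarrow> pmf P a = 0"
  using power_sum_pos[of Q P s, OF dom] dom[of a] by (auto simp: pmf_tilt)

lemma pmf_tilt_0: "pmf P a = 0 \<Longrightarrow> pmf (tilt P Q s) a = 0"
  by (simp add: pmf_tilt_eq_0_iff)

lemma DERIV_ln_power_sum:
  "((\<lambda>s. ln (power_sum P Q s)) has_real_derivative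
      (\<Sum>a\<in>UNIV. pmf (tilt P Q s) a * (ln (pmf P a) - ln (pmf Q a)))) (at s)"
proof -
  have "(\<Sum>a\<in>UNIV. pmf (tilt P Q s) a * (ln (pmf P a) - ln (pmf Q a))) =
     (\<Sum>a\<in>UNIV. pmf P a powr s * pmf Q a powr (1 - s) * (ln (pmf P a) - ln (pmf Q a))) / power_sum P Q s"
    by (simp add: pmf_tilt sum_divide_distrib)
  then show ?thesis
    using DERIV_power_sum[of Q P s, OF dom] power_sum_pos[of Q P s, OF dom]
    by (auto intro!: derivative_eq_intros)
qed

text \<open>On the support of \<open>P\<close>, the logarithm of the tilted probability is s ln P +
  (1 - s) ln Q - ln N, and \<open>d\<close> is the tilted mean of ln P - ln Q. Averaging gives both
  divergences.\<close>

lemma kl_tilt: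
  assumes D: "((\<lambda>s. ln (power_sum P Q s)) has_real_derivative d) (at s)"
  shows "kl (tilt P Q s) (pmf Q) = s * d - ln (power_sum P Q s)"
    and "kl (tilt P Q s) (pmf P) = (s - 1) * d - ln (power_sum P Q s)"
proof -
  have d: "d = (\<Sum>a\<in>UNIV. pmf (tilt P Q s) a * (ln (pmf P a) - ln (pmf Q a)))"
    using D DERIV_ln_power_sum DERIV_unique by blast
  define N where "N = power_sum P Q s"
  have N: "N > 0" unfolding N_def using dom by (rule power_sum_pos)
  have ln: "ln (pmf (tilt P Q s) a) = s * ln (pmf P a) + (1 - s) * ln (pmf Q a) - ln N"
    if "pmf P a \<noteq> 0" for a
  proof -
    have "pmf P a > 0" "pmf Q a > 0" using that dom[of a] by (auto simp: order_less_le)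
    then show ?thesis using N by (simp add: pmf_tilt N_def[symmetric] ln_div ln_mult ln_powr)
  qed
  have s1: "(\<Sum>a\<in>UNIV. pmf (tilt P Q s) a * ln N) = ln N"
    by (simp add: sum_distrib_right[symmetric] sum_pmf_UNIV)
  have "kl (tilt P Q s) (pmf Q) =
      (\<Sum>a\<in>UNIV. s * (pmf (tilt P Q s) a * (ln (pmf P a) - ln (pmf Q a))) - pmf (tilt P Q s) a * ln N)"
    unfolding kl_def
  proof (intro sum.cong refl)
    fix a show "pmf (tilt P Q s) a * (ln (pmf (tilt P Q s) a) - ln (pmf Q a)) =
       s * (pmf (tilt P Q s) a * (ln (pmf P a) - ln (pmf Q a))) - pmf (tilt P Q s) a * ln N"
      by (cases "pmf P a = 0") (simp_all add: pmf_tilt_0 ln algebra_simps)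
  qed
  also have "\<dots> = s * d - ln N" by (simp add: sum_subtractf s1 d sum_distrib_left)
  finally show "kl (tilt P Q s) (pmf Q) = s * d - ln (power_sum P Q s)" by (simp add: N_def)
  have "kl (tilt P Q s) (pmf P) =
      (\<Sum>a\<in>UNIV. (s - 1) * (pmf (tilt P Q s) a * (ln (pmf P a) - ln (pmf Q a))) - pmf (tilt P Q s) a * ln N)"
    unfolding kl_def
  proof (intro sum.cong refl)
    fix a show "pmf (tilt P Q s) a * (ln (pmf (tilt P Q s) a) - ln (pmf P a)) =
       (s - 1) * (pmf (tilt P Q s) a * (ln (pmf P a) - ln (pmf Q a))) - pmf (tilt P Q s) a * ln N"
      by (cases "pmf P a = 0") (simp_all add: pmf_tilt_0 ln algebra_simps)
  qed
  also have "\<dots> = (s - 1) * d - ln N" by (simp add: sum_subtractf s1 d sum_distrib_left)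
  finally show "kl (tilt P Q s) (pmf P) = (s - 1) * d - ln (power_sum P Q s)" by (simp add: N_def)
qed

end

text \<open>Both power sums agree at \<open>s\<close> and are ordered near \<open>s\<close>, so they have the same slope there.\<close>

lemma DERIV_ln_power_sum_opt_chan:
  fixes V :: "('x::finite \<times> 'y::finite \<times> 'z::finite) pmf"
  assumes dom: "marg_XY_dominated V U" and s: "0 < s" "s \<noteq> 1"
    and D: "((\<lambda>s. ln (cond_power_sum V U s)) has_real_derivative d) (at s)"
  shows "((\<lambda>t. ln (power_sum V (chan_prod U (opt_chan V U s)) t)) has_real_derivative d) (at s)"
proof -
  define Q where "Q = chan_prod U (opt_chan V U s)"
  have Qdom: "\<And>a. pmf Q a = 0 \<Longrightarrow> pmf V a = 0"
    unfolding Q_def using opt_chan_dominates[OF dom s(1)] .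
  have pos: "power_sum V Q t > 0" for t using power_sum_pos[of Q V t, OF Qdom] .
  have Gpos: "cond_power_sum V U t > 0" if "t > 0" for t using dom that by (rule cond_power_sum_pos)
  obtain e where e: "((\<lambda>t. ln (power_sum V Q t)) has_real_derivative e) (at s)"
    using DERIV_ln_power_sum[of Q V s, OF Qdom] by blast
  have diff: "((\<lambda>t. ln (cond_power_sum V U t) - ln (power_sum V Q t)) has_real_derivative d - e) (at s)"
    using D e by (rule DERIV_diff)
  have eq: "ln (cond_power_sum V U s) - ln (power_sum V Q s) = 0"
    using s by (simp add: Q_def power_sum_opt_chan)
  have "d - e = 0"
  proof (cases "s < 1")
    case True
    have "0 \<le> ln (cond_power_sum V U t) - ln (power_sum V Q t)" if "0 < t" "t < 1" for t
      using power_sum_chan_prod_le[OF that, of V U "opt_chan V U s"] pos[of t] Gpos[of t] that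
      by (simp add: Q_def)
    \<comment> \<open>The radius \<open>min s (1 - s)\<close> keeps \<open>t\<close> inside (0,1),
      where the comparison of the two power sums has one direction.\<close>
    then show ?thesis
      using s True eq by (intro DERIV_local_min[OF diff, of "min s (1 - s)"]) (auto simp: abs_real_def split: if_splits)
  next
    case False
    have "ln (cond_power_sum V U t) - ln (power_sum V Q t) \<le> 0" if "1 < t" for t
      using power_sum_chan_prod_ge[of t U "opt_chan V U s" V] Qdom pos[of t] Gpos[of t] that
      by (simp add: Q_def)
    then show ?thesis
      using s False eq by (intro DERIV_local_max[OF diff, of "s - 1"]) (auto simp: abs_real_def split: if_splits)
  qed
  then show ?thesis using e by (simp add: Q_def)
qed

text \<open>Summed over \<open>x\<close>, the tilted weight is the channel probability times a
  function of \<open>y\<close>, by \<open>opt_chan_powr\<close>. So tilting towards the optimal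
  alternative reproduces the optimal channel as its own conditional.\<close>

lemma tilt_opt_chan_conditional:
  fixes V :: "('x::finite \<times> 'y::finite \<times> 'z::finite) pmf"
  assumes dom: "marg_XY_dominated V U" and s: "0 < s"
    and T_def: "T = tilt V (chan_prod U (opt_chan V U s)) s" and pos: "pmf T (x, y, z) > 0"
  shows "marg_YZ_fun T y z / marg_Y_fun T y = pmf (opt_chan V U s y) z"
proof -
  have Qdom: "\<And>a. pmf (chan_prod U (opt_chan V U s)) a = 0 \<Longrightarrow> pmf V a = 0"
    using opt_chan_dominates[OF dom s(1)] .
  define N where "N = power_sum V (chan_prod U (opt_chan V U s)) s"
  have N: "N > 0" unfolding N_def using power_sum_pos Qdom by blast
  have pmf_T: "pmf T a = pmf V a powr s * pmf (chan_prod U (opt_chan V U s)) a powr (1 - s) / N" for a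
    unfolding T_def N_def using Qdom by (rule pmf_tilt)
  have YZ: "marg_YZ_fun T y z = pmf (opt_chan V U s y) z * (cond_A V U s y powr s / N)" for z
    unfolding marg_YZ_fun_def pmf_T
    by (simp add: sum_divide_distrib[symmetric] sum_chan_prod_powr opt_chan_powr[OF s])
  have Y: "marg_Y_fun T y = cond_A V U s y powr s / N"
    unfolding marg_Y_fun_def YZ by (simp add: sum_distrib_right[symmetric] sum_pmf_UNIV sum_divide_distrib[symmetric])
  have "marg_Y_fun T y \<noteq> 0" using pmf_pos_marginals_pos[OF pos] by simp
  then show ?thesis unfolding YZ Y by (rule nonzero_mult_div_cancel_right)
qed

subsection \<open>Product distributions and memoryless channels\<close>

lemma pmf_replicate_pmf:
  assumes "length ws = n"
  shows "pmf (replicate_pmf n P) ws = (\<Prod>i<n. pmf P (ws ! i))"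
  using assms
proof (induction n arbitrary: ws)
  case (Suc n)
  then obtain w ws' where ws: "ws = w # ws'" "length ws' = n" by (cases ws) auto
  have "replicate_pmf (Suc n) P = map_pmf (\<lambda>(x, xs). x # xs) (pair_pmf P (replicate_pmf n P))"
    by (simp add: pair_pmf_def map_bind_pmf map_pmf_def[symmetric] pmf.map_comp o_def)
  then have "pmf (replicate_pmf (Suc n) P) ws = pmf (pair_pmf P (replicate_pmf n P)) (w, ws')"
    using pmf_map_inj'[of "\<lambda>(x, xs). x # xs" "pair_pmf P (replicate_pmf n P)" "(w, ws')"]
    by (simp add: ws inj_def)
  then show ?case
    using Suc.IH[OF ws(2)] ws by (simp add: pmf_pair prod.lessThan_Suc_shift del: prod.lessThan_Suc)
qed simp

lemma pmf_replicate_pmf_zip: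
  assumes "length xs = n" "length ys = n"
  shows "pmf (replicate_pmf n U) (zip xs ys) = (\<Prod>i<n. pmf U (xs ! i, ys ! i))"
  using assms by (subst pmf_replicate_pmf) auto

lemma pmf_replicate_pmf_zip3:
  assumes "length xs = n" "length ys = n" "length zs = n"
  shows "pmf (replicate_pmf n V) (zip xs (zip ys zs)) = (\<Prod>i<n. pmf V (xs ! i, ys ! i, zs ! i))"
  using assms by (subst pmf_replicate_pmf) auto

lemma sum_replicate_pmf: "(\<Sum>ws | length ws = n. pmf (replicate_pmf n (P :: 'a::finite pmf)) ws) = 1"
  by (rule sum_pmf_eq_1) (auto simp: finite_lists_length_UNIV set_replicate_pmf)

primrec iid_chan :: "('y \<Rightarrow> 'z pmf) \<Rightarrow> 'y list \<Rightarrow> 'z list pmf" where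
  "iid_chan W [] = return_pmf []"
| "iid_chan W (y # ys) = map_pmf (\<lambda>(z, zs). z # zs) (pair_pmf (W y) (iid_chan W ys))"

lemma set_iid_chan: "set_pmf (iid_chan W ys) \<subseteq> {zs. length zs = length ys}"
  by (induction ys) auto

lemma iid_chan_block: "iid_chan W \<in> block_channels n"
  using set_iid_chan[of W] by (fastforce simp: block_channels_def)

lemma pmf_iid_chan:
  assumes "length ys = n" "length zs = n"
  shows "pmf (iid_chan W ys) zs = (\<Prod>i<n. pmf (W (ys ! i)) (zs ! i))"
  using assms
proof (induction n arbitrary: ys zs)
  case (Suc n)
  then obtain y ys' z zs' where [simp]: "ys = y # ys'" "zs = z # zs'" and l: "length ys' = n" "length zs' = n"
    by (cases ys; cases zs) auto
  have "pmf (iid_chan W ys) zs = pmf (pair_pmf (W y) (iid_chan W ys')) (z, zs')"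
    using pmf_map_inj'[of "\<lambda>(x, xs). x # xs" "pair_pmf (W y) (iid_chan W ys')" "(z, zs')"]
    by (simp add: inj_def)
  then show ?case
    using Suc.IH[OF l] l by (simp add: pmf_pair prod.lessThan_Suc_shift del: prod.lessThan_Suc)
qed simp

lemma pmf_map_inj_on_superset:
  assumes inj: "inj_on f S" and S: "set_pmf M \<subseteq> S" and x: "x \<in> S"
  shows "pmf (map_pmf f M) (f x) = pmf M x"
proof (cases "x \<in> set_pmf M")
  case True
  then show ?thesis using inj S by (intro pmf_map_inj) (auto intro: inj_on_subset)
next
  case False
  then have "f x \<notin> f ` set_pmf M" using inj S x by (auto dest: inj_onD)
  then show ?thesis using False by (simp add: pmf_map_outside set_pmf_iff)
qed

lemma pmf_bind_Pair:
  "pmf (bind_pmf P (\<lambda>u. map_pmf (Pair u) (K u))) (a, c) = pmf P a * pmf (K a) c"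
proof -
  have "pmf (bind_pmf P (\<lambda>u. map_pmf (Pair u) (K u))) (a, c) =
      measure_pmf.expectation P (\<lambda>u. indicator {a} u * pmf (K a) c)"
    unfolding pmf_bind
  proof (intro Bochner_Integration.integral_cong refl)
    fix u
    show "pmf (map_pmf (Pair u) (K u)) (a, c) = indicator {a} u * pmf (K a) c"
    proof (cases "u = a")
      case True
      then show ?thesis using pmf_map_inj'[of "Pair u" "K u" c] by (simp add: inj_def)
    next
      case False
      then show ?thesis by (subst pmf_map_outside) auto
    qed
  qed
  then show ?thesis by (simp add: pmf.rep_eq)
qed

lemma map2_zip3:
  assumes "length xs = n" "length ys = n" "length zs = n"
  shows "map2 (\<lambda>(x, y) z. (x, y, z)) (zip xs ys) zs = zip xs (zip ys zs)"
  using assms by (intro nth_equalityI) auto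

lemma pmf_block_chan_prod:
  fixes U :: "('x \<times> 'y) pmf" and W :: "'y list \<Rightarrow> 'z list pmf"
  assumes W: "W \<in> block_channels n" and l: "length xs = n" "length ys = n" "length zs = n"
  shows "pmf (block_chan_prod n U W) (zip xs (zip ys zs)) =
    pmf (replicate_pmf n U) (zip xs ys) * pmf (W ys) zs"
proof -
  define f where "f = (\<lambda>(w, zs). map2 (\<lambda>(x, y) z. (x, y, z)) w zs :: ('x \<times> 'y \<times> 'z) list)"
  define M where "M = bind_pmf (replicate_pmf n U) (\<lambda>w. map_pmf (Pair w) (W (map snd w)))"
  \<comment> \<open>\<open>map2\<close> truncates to the shorter list, so \<open>f\<close> is
    injective only on pairs of lists of length \<open>n\<close>; membership in
    \<open>block_channels\<close> keeps the support of \<open>M\<close> there.\<close>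
  let ?S = "{w :: ('x \<times> 'y) list. length w = n} \<times> {zs :: 'z list. length zs = n}"
  have "block_chan_prod n U W = map_pmf f M"
    unfolding block_chan_prod_def M_def f_def map_bind_pmf map_pmf_def[symmetric] pmf.map_comp o_def
    by simp
  moreover have "inj_on f ?S"
  proof (rule inj_on_inverseI[where g = "\<lambda>v. (map (\<lambda>(x, y, z). (x, y)) v, map (\<lambda>(x, y, z). z) v)"])
    fix p assume "p \<in> ?S"
    then show "(map (\<lambda>(x, y, z). (x, y)) (f p), map (\<lambda>(x, y, z). z) (f p)) = p"
      by (cases p) (auto simp: f_def split_beta intro!: nth_equalityI)
  qed
  moreover have "set_pmf M \<subseteq> ?S"
  proof
    fix p assume "p \<in> set_pmf M"
    then obtain w zs where p: "p = (w, zs)" "w \<in> set_pmf (replicate_pmf n U)" "zs \<in> set_pmf (W (map snd w))"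
      unfolding M_def by auto
    have "length w = n" using p(2) by (simp add: set_replicate_pmf)
    then have "set_pmf (W (map snd w)) \<subseteq> {zs. length zs = n}"
      using W by (simp add: block_channels_def)
    then have "length zs = n" using p(3) by auto
    with \<open>length w = n\<close> show "p \<in> ?S" by (simp add: p)
  qed
  moreover have "f (zip xs ys, zs) = zip xs (zip ys zs)" unfolding f_def using map2_zip3[OF l] by simp
  ultimately have "pmf (block_chan_prod n U W) (zip xs (zip ys zs)) = pmf M (zip xs ys, zs)"
    using pmf_map_inj_on_superset[of f ?S M "(zip xs ys, zs)"] l by simp
  also have "\<dots> = pmf (replicate_pmf n U) (zip xs ys) * pmf (W ys) zs"
    unfolding M_def pmf_bind_Pair using l by simp
  finally show ?thesis .
qed

text \<open>Memoryless channels place i.i.d. alternatives inside the composite one, so a feasible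
  test is also constrained against each of these simple alternatives.\<close>

lemma pmf_block_iid_chan:
  assumes "length ws = n"
  shows "pmf (block_chan_prod n U (iid_chan W)) ws = pmf (replicate_pmf n (chan_prod U W)) ws"
proof -
  define xs ys zs where "xs = map fst ws" and "ys = map fst (map snd ws)" and "zs = map snd (map snd ws)"
  have l: "length xs = n" "length ys = n" "length zs = n" using assms by (auto simp: xs_def ys_def zs_def)
  have ws: "ws = zip xs (zip ys zs)" unfolding xs_def ys_def zs_def zip_map_fst_snd ..
  show ?thesis
    unfolding ws pmf_block_chan_prod[OF iid_chan_block l] pmf_replicate_pmf_zip[OF l(1,2)]
      pmf_iid_chan[OF l(2,3)] pmf_replicate_pmf_zip3[OF l]
    by (simp add: pmf_chan_prod prod.distrib)
qed

subsection \<open>The second-kind error and the optimal test\<close>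

lemma block_channels_nonempty: "block_channels n \<noteq> {}"
  using iid_chan_block[of "\<lambda>_. return_pmf undefined"] by auto

text \<open>The real supremum is meaningful because the set is nonempty and bounded by 1; the error
  bound then becomes a family of linear constraints on \<open>T\<close>.\<close>

lemma err_beta_le_iff:
  fixes P :: "('x::finite \<times> 'y::finite \<times> 'z::finite) pmf"
  assumes T: "is_test n T"
  shows "err_beta (markov_alt P) n T \<le> \<mu> \<longleftrightarrow>
    (\<forall>W\<in>block_channels n. (\<Sum>ws | length ws = n. pmf (block_chan_prod n (marg_XY P) W) ws * T ws) \<le> \<mu>)"
proof -
  have bdd: "bdd_above ((\<lambda>Q. \<Sum>ws | length ws = n. pmf Q ws * T ws) ` markov_alt P n)"
  proof (rule bdd_aboveI2)
    fix Q :: "('x \<times> 'y \<times> 'z) list pmf"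
    have "(\<Sum>ws | length ws = n. pmf Q ws * T ws) \<le> (\<Sum>ws | length ws = n. pmf Q ws)"
      using T by (intro sum_mono mult_left_le) (auto simp: is_test_def)
    also have "\<dots> = measure Q {ws. length ws = n}"
      by (simp add: measure_measure_pmf_finite finite_lists_length_UNIV)
    also have "\<dots> \<le> 1" by simp
    finally show "(\<Sum>ws | length ws = n. pmf Q ws * T ws) \<le> 1" .
  qed
  have "markov_alt P n \<noteq> {}" using block_channels_nonempty by (auto simp: markov_alt_def)
  then show ?thesis
    unfolding err_beta_def by (subst cSUP_le_iff) (use bdd in \<open>auto simp: markov_alt_def\<close>)
qed

lemma err_alpha_altdef:
  "err_alpha P n T = 1 - (\<Sum>ws | length ws = n. pmf (replicate_pmf n P) ws * T ws)"
  by (simp add: err_alpha_def algebra_simps sum_subtractf sum_replicate_pmf)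

text \<open>The feasible tests form a closed subset of a compact product of intervals, on which the
  first-kind error is continuous; hence \<open>LEAST\<close> denotes a true minimum.\<close>

lemma alpha_hat_attained:
  fixes P :: "('x::finite \<times> 'y::finite \<times> 'z::finite) pmf"
  assumes \<mu>: "0 \<le> \<mu>"
  obtains T where "is_test n T" "err_beta (markov_alt P) n T \<le> \<mu>" "alpha_hat P (markov_alt P) n \<mu> = err_alpha P n T"
    "\<And>T'. is_test n T' \<Longrightarrow> err_beta (markov_alt P) n T' \<le> \<mu> \<Longrightarrow> alpha_hat P (markov_alt P) n \<mu> \<le> err_alpha P n T'"
proof -
  let ?Q = "\<lambda>W. block_chan_prod n (marg_XY P) W"
  \<comment> \<open>\<open>is_test\<close> constrains only lists of length \<open>n\<close>.
    Bounding the values on all lists makes \<open>K\<close> compact in the product topology.\<close>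
  define K where "K = {T :: ('x \<times> 'y \<times> 'z) list \<Rightarrow> real. \<forall>ws. T ws \<in> {0..1}}"
  define C where "C = K \<inter> (\<Inter>W\<in>block_channels n. {T. (\<Sum>ws | length ws = n. pmf (?Q W) ws * T ws) \<le> \<mu>})"
  have coord: "continuous_on UNIV (\<lambda>T :: ('x \<times> 'y \<times> 'z) list \<Rightarrow> real. T ws)" for ws
    by (rule continuous_on_product_coordinates)
  have "K = PiE UNIV (\<lambda>_. {0..1})" by (auto simp: K_def PiE_def extensional_def)
  moreover have "compactin (product_topology (\<lambda>_. euclidean) UNIV) (PiE UNIV (\<lambda>_ :: ('x \<times> 'y \<times> 'z) list. {0..1::real}))"
    by (simp add: compactin_PiE)
  ultimately have "compact K" by (simp add: euclidean_product_topology)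
  moreover have "closed {T :: ('x \<times> 'y \<times> 'z) list \<Rightarrow> real. (\<Sum>ws | length ws = n. pmf (?Q W) ws * T ws) \<le> \<mu>}" for W
    by (intro closed_Collect_le continuous_intros coord)
  ultimately have "compact C" unfolding C_def by (intro compact_Int_closed closed_INT) auto
  moreover have C0: "(\<lambda>_. 0) \<in> C" using \<mu> by (simp add: C_def K_def)
  moreover have "continuous_on C (err_alpha P n)"
    unfolding err_alpha_def[abs_def]
    by (intro continuous_intros continuous_on_subset[OF coord]) auto
  ultimately obtain T0 where T0: "T0 \<in> C" "\<And>T. T \<in> C \<Longrightarrow> err_alpha P n T0 \<le> err_alpha P n T"
    using continuous_attains_inf[of C "err_alpha P n"] by blast
  have inC: "T \<in> K \<Longrightarrow> T \<in> C \<longleftrightarrow> err_beta (markov_alt P) n T \<le> \<mu>" for T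
    by (subst err_beta_le_iff) (auto simp: C_def K_def is_test_def)
  have T0t: "is_test n T0" "err_beta (markov_alt P) n T0 \<le> \<mu>"
    using T0(1) inC[of T0] by (auto simp: C_def K_def is_test_def)
  have min: "err_alpha P n T0 \<le> err_alpha P n T" if T: "is_test n T" "err_beta (markov_alt P) n T \<le> \<mu>" for T
  proof -
    \<comment> \<open>Setting \<open>T\<close> to 0 off length \<open>n\<close> moves it into
      \<open>K\<close> and changes neither error.\<close>
    define T' where "T' ws = (if length ws = n then T ws else 0)" for ws
    have T': "is_test n T'" "T' \<in> K" using T(1) by (auto simp: T'_def is_test_def K_def)
    have "err_alpha P n T' = err_alpha P n T" by (simp add: err_alpha_def T'_def)
    moreover have "err_beta (markov_alt P) n T' = err_beta (markov_alt P) n T" by (simp add: err_beta_def T'_def)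
    ultimately show ?thesis using T0(2)[of T'] inC[OF T'(2)] T(2) by simp
  qed
  have "alpha_hat P (markov_alt P) n \<mu> = err_alpha P n T0"
    unfolding alpha_hat_def by (rule Least_equality) (use T0t min in auto)
  then show ?thesis using that T0t min by simp
qed

subsection \<open>Bounds on blocks\<close>

text \<open>\<open>composite_threshold_test\<close> applied to lists of length \<open>n\<close> as
  letters, with multiplicativity of the power sum. \<open>V\<close> may differ from
  \<open>P\<close>: the alternative depends on \<open>P\<close> only through its
  XY-marginal.\<close>

lemma composite_test_exists:
  fixes V P :: "('x::finite \<times> 'y::finite \<times> 'z::finite) pmf"
  assumes dom: "marg_XY_dominated V (marg_XY P)" and s: "0 < s" "s < 1" and \<mu>: "0 < \<mu>"
  obtains T where "is_test n T" "err_beta (markov_alt P) n T \<le> \<mu>"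
    "err_alpha V n T \<le> (cond_power_sum V (marg_XY P) s ^ n) powr (1 / s) * \<mu> powr (- ((1 - s) / s))"
proof -
  let ?U = "marg_XY P"
  let ?v = "\<lambda>xs ys zs. \<Prod>i<n. pmf V (xs ! i, ys ! i, zs ! i)" and ?u = "\<lambda>xs ys. \<Prod>i<n. pmf ?U (xs ! i, ys ! i)"
  let ?X = "{xs :: 'x list. length xs = n}" and ?Y = "{ys :: 'y list. length ys = n}" and ?Z = "{zs :: 'z list. length zs = n}"
  have G: "mix_G ?X ?Y ?Z ?v ?u s = cond_power_sum V ?U s ^ n"
    unfolding cond_power_sum_def by (rule mix_G_block) auto
  have Gpos: "mix_G ?X ?Y ?Z ?v ?u s > 0" unfolding G using cond_power_sum_pos[OF dom s(1)] by simp
  show ?thesis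
  proof (rule composite_threshold_test[of ?X ?Y ?Z ?v ?u s \<mu>])
    fix T :: "'x list \<Rightarrow> 'y list \<Rightarrow> 'z list \<Rightarrow> real" and c :: "'y list \<Rightarrow> real"
    assume T: "\<And>x y z. 0 \<le> T x y z" "\<And>x y z. T x y z \<le> 1" and c: "\<And>y. 0 \<le> c y" "(\<Sum>y\<in>?Y. c y) \<le> \<mu>"
      and beta: "\<And>y z. y \<in> ?Y \<Longrightarrow> z \<in> ?Z \<Longrightarrow> (\<Sum>x\<in>?X. ?u x y * T x y z) \<le> c y"
      and alpha: "(\<Sum>y\<in>?Y. \<Sum>z\<in>?Z. \<Sum>x\<in>?X. ?v x y z * (1 - T x y z)) \<le>
       mix_G ?X ?Y ?Z ?v ?u s powr (1 / s) * \<mu> powr (- ((1 - s) / s))"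
    define T' where "T' ws = T (map fst ws) (map fst (map snd ws)) (map snd (map snd ws))" for ws
    have T'_zip: "T' (zip xs (zip ys zs)) = T xs ys zs" if "length xs = n" "length ys = n" "length zs = n" for xs ys zs
      using that by (simp add: T'_def)
    have test: "is_test n T'" using T by (simp add: is_test_def T'_def)
    have "err_alpha V n T' = (\<Sum>y\<in>?Y. \<Sum>z\<in>?Z. \<Sum>x\<in>?X. ?v x y z * (1 - T x y z))"
      unfolding err_alpha_def sum_lists_zip3
      by (intro sum.cong refl) (simp add: T'_zip pmf_replicate_pmf_zip3)
    then have 1: "err_alpha V n T' \<le> (cond_power_sum V ?U s ^ n) powr (1 / s) * \<mu> powr (- ((1 - s) / s))"
      using alpha unfolding G by simp
    have 2: "(\<Sum>ws | length ws = n. pmf (block_chan_prod n ?U W) ws * T' ws) \<le> \<mu>" if W: "W \<in> block_channels n" for W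
    proof -
      have "(\<Sum>ws | length ws = n. pmf (block_chan_prod n ?U W) ws * T' ws) =
          (\<Sum>y\<in>?Y. \<Sum>z\<in>?Z. pmf (W y) z * (\<Sum>x\<in>?X. ?u x y * T x y z))"
        unfolding sum_lists_zip3 sum_distrib_left
        by (intro sum.cong refl) (simp add: T'_zip pmf_block_chan_prod[OF W] pmf_replicate_pmf_zip)
      \<comment> \<open>The bound \<open>c y\<close> is uniform in \<open>z\<close>, so it survives
        averaging over the output of any block channel.\<close>
      also have "\<dots> \<le> (\<Sum>y\<in>?Y. \<Sum>z\<in>?Z. pmf (W y) z * c y)"
        using beta by (intro sum_mono mult_left_mono) auto
      also have "\<dots> = (\<Sum>y\<in>?Y. c y)"
      proof (intro sum.cong refl)
        fix y assume y: "y \<in> ?Y"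
        have "(\<Sum>z\<in>?Z. pmf (W y) z) = 1"
          using W y by (intro sum_pmf_eq_1) (auto simp: finite_lists_length_UNIV block_channels_def)
        then show "(\<Sum>z\<in>?Z. pmf (W y) z * c y) = c y" by (simp add: sum_distrib_right[symmetric])
      qed
      finally show ?thesis using c(2) by simp
    qed
    show thesis by (rule that[OF test _ 1]) (use 2 err_beta_le_iff[OF test] in blast)
  next
    fix x y z assume "?u x y = 0"
    then obtain i where "i < n" "pmf ?U (x ! i, y ! i) = 0" by auto
    then show "?v x y z = 0" using dom by (auto simp: marg_XY_dominated_def)
  qed (use s \<mu> Gpos in \<open>auto simp: finite_lists_length_UNIV prod_nonneg\<close>)
qed

lemma change_of_measure_block:
  fixes V Q :: "'a::finite pmf"
  assumes r: "1 < r" and dom: "\<And>a. pmf Q a = 0 \<Longrightarrow> pmf V a = 0" and T: "is_test n T"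
  shows "(\<Sum>ws | length ws = n. pmf (replicate_pmf n V) ws * T ws) \<le>
    (power_sum V Q r ^ n) powr (1 / r) * (\<Sum>ws | length ws = n. pmf (replicate_pmf n Q) ws * T ws) powr (1 - 1 / r)"
proof -
  have ps: "(\<Sum>ws | length ws = n. pmf (replicate_pmf n V) ws powr r * pmf (replicate_pmf n Q) ws powr (1 - r)) =
     power_sum V Q r ^ n"
  proof -
    have "(\<Sum>ws | length ws = n. pmf (replicate_pmf n V) ws powr r * pmf (replicate_pmf n Q) ws powr (1 - r)) =
       (\<Sum>ws | length ws = n. \<Prod>i<n. pmf V (ws ! i) powr r * pmf Q (ws ! i) powr (1 - r))"
      by (intro sum.cong refl) (simp add: pmf_replicate_pmf prod_powr_distrib prod.distrib)
    also have "\<dots> = (\<Prod>i<n. power_sum V Q r)"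
      by (subst sum_lists_prod) (simp add: power_sum_def)
    finally show ?thesis by simp
  qed
  show ?thesis
    unfolding ps[symmetric]
  proof (rule Hoelder_sum_change_of_measure[OF r])
    fix ws assume ws: "ws \<in> {ws::'a list. length ws = n}" and "pmf (replicate_pmf n Q) ws = 0"
    then obtain i where "i < n" "pmf Q (ws ! i) = 0" by (auto simp: pmf_replicate_pmf)
    then show "pmf (replicate_pmf n V) ws = 0" using ws dom by (auto simp: pmf_replicate_pmf)
  qed (use T in \<open>auto simp: is_test_def\<close>)
qed

text \<open>The composite constraint is used only at the memoryless extension of \<open>W\<close>,
  where the change of measure between i.i.d. distributions applies.\<close>

lemma strong_converse_block:
  fixes V P :: "('x::finite \<times> 'y::finite \<times> 'z::finite) pmf"
  assumes r: "1 < r" and dom: "\<And>a. pmf (chan_prod (marg_XY P) W) a = 0 \<Longrightarrow> pmf V a = 0"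
    and T: "is_test n T" and beta: "err_beta (markov_alt P) n T \<le> \<mu>"
  shows "1 - err_alpha V n T \<le> (power_sum V (chan_prod (marg_XY P) W) r ^ n) powr (1 / r) * \<mu> powr (1 - 1 / r)"
proof -
  let ?Q = "chan_prod (marg_XY P) W"
  have "(\<Sum>ws | length ws = n. pmf (replicate_pmf n ?Q) ws * T ws) =
      (\<Sum>ws | length ws = n. pmf (block_chan_prod n (marg_XY P) (iid_chan W)) ws * T ws)"
    by (intro sum.cong refl) (simp add: pmf_block_iid_chan)
  also have "\<dots> \<le> \<mu>" using beta err_beta_le_iff[OF T] iid_chan_block by blast
  finally have b: "(\<Sum>ws | length ws = n. pmf (replicate_pmf n ?Q) ws * T ws) \<le> \<mu>" .
  have "1 - err_alpha V n T = (\<Sum>ws | length ws = n. pmf (replicate_pmf n V) ws * T ws)"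
    by (simp add: err_alpha_altdef)
  also have "\<dots> \<le> (power_sum V ?Q r ^ n) powr (1 / r) * (\<Sum>ws | length ws = n. pmf (replicate_pmf n ?Q) ws * T ws) powr (1 - 1 / r)"
    using r dom T by (rule change_of_measure_block)
  also have "\<dots> \<le> (power_sum V ?Q r ^ n) powr (1 / r) * \<mu> powr (1 - 1 / r)"
    using b r T by (intro mult_left_mono powr_mono2 sum_nonneg) (auto simp: is_test_def)
  finally show ?thesis .
qed

subsection \<open>Exponents of sequences\<close>

text \<open>The constant \<open>c\<close> costs only \<open>ln c / n\<close> in the exponent, which
  vanishes in the limit.\<close>

lemma Limsup_exponent_le:
  assumes b: "b > 1" and c: "c > 0" and x: "eventually (\<lambda>n. x n \<ge> c * exp (- real n * k)) sequentially"
  shows "limsup (\<lambda>n. ereal (- 1 / real n) * elog b (x n)) \<le> ereal (k / ln b)"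
proof -
  have lb: "ln b > 0" using b by simp
  have "eventually (\<lambda>n. ereal (- 1 / real n) * elog b (x n) \<le> ereal ((k - ln c / real n) / ln b)) sequentially"
    using x eventually_gt_at_top[of 0]
  proof eventually_elim
    case (elim n)
    have pos: "c * exp (- real n * k) > 0" using c by simp
    have "ln (x n) \<ge> ln (c * exp (- real n * k))" using elim pos by (subst ln_le_cancel_iff) auto
    then have "ln c - real n * k \<le> ln (x n)" using c by (simp add: ln_mult)
    then have "- ln (x n) / real n \<le> (real n * k - ln c) / real n" by (intro divide_right_mono) auto
    also have "\<dots> = k - ln c / real n" using elim by (simp add: diff_divide_distrib)
    finally have "- ln (x n) / real n \<le> k - ln c / real n" .
    then have "(- ln (x n) / real n) / ln b \<le> (k - ln c / real n) / ln b"
      using lb by (intro divide_right_mono) auto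
    moreover have "x n \<noteq> 0" using elim pos by linarith
    ultimately show ?case by (simp add: elog_def log_def)
  qed
  then have "limsup (\<lambda>n. ereal (- 1 / real n) * elog b (x n)) \<le> limsup (\<lambda>n. ereal ((k - ln c / real n) / ln b))"
    by (rule Limsup_mono)
  also have "(\<lambda>n. (k - ln c / real n) / ln b) \<longlonglongrightarrow> (k - 0) / ln b"
    using lb by (intro tendsto_intros lim_const_over_n) auto
  then have "limsup (\<lambda>n. ereal ((k - ln c / real n) / ln b)) = ereal ((k - 0) / ln b)"
    by (intro lim_imp_Limsup) auto
  finally show ?thesis by simp
qed

lemma Liminf_exponent_ge:
  assumes b: "b > 1" and x: "\<And>n. 0 \<le> x n" "\<And>n. x n \<le> exp (- real n * k)"
  shows "ereal (k / ln b) \<le> liminf (\<lambda>n. ereal (- 1 / real n) * elog b (x n))"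
proof (rule Liminf_bounded)
  have lb: "ln b > 0" using b by simp
  show "eventually (\<lambda>n. ereal (k / ln b) \<le> ereal (- 1 / real n) * elog b (x n)) sequentially"
    using eventually_gt_at_top[of 0]
  proof eventually_elim
    case (elim n)
    show ?case
    proof (cases "x n = 0")
      \<comment> \<open>A vanishing error has exponent \<open>+\<infinity>\<close>, since
        \<open>elog\<close> is \<open>-\<infinity>\<close> there and \<open>n\<close> is
        positive.\<close>
      case True
      then show ?thesis using elim by (simp add: elog_def)
    next
      case False
      then have "x n > 0" using x(1)[of n] by simp
      then have "ln (x n) \<le> - real n * k" using x(2)[of n] ln_le_cancel_iff[of "x n" "exp (- real n * k)"] by simp
      then have "k \<le> - ln (x n) / real n" using elim by (simp add: field_simps)
      then have "k / ln b \<le> (- ln (x n) / real n) / ln b" using lb by (intro divide_right_mono) auto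
      then show ?thesis using False by (simp add: elog_def log_def)
    qed
  qed
qed

lemma tendsto_exp_neg_mult:
  fixes k :: real
  assumes "k > 0"
  shows "(\<lambda>n. exp (- real n * k)) \<longlonglongrightarrow> 0"
proof -
  have "(\<lambda>n. exp (- k) ^ n) \<longlonglongrightarrow> 0" using assms by (intro LIMSEQ_power_zero) simp
  then show ?thesis by (simp flip: exp_of_nat_mult)
qed

lemma Sup_ereal_threshold:
  assumes "\<And>R. R < i \<Longrightarrow> R \<in> S" "\<And>R. i < R \<Longrightarrow> R \<notin> S"
  shows "Sup (ereal ` S) = ereal i"
proof (rule antisym)
  show "Sup (ereal ` S) \<le> ereal i" using assms(2) by (intro SUP_least) (force simp: not_less[symmetric])
  show "ereal i \<le> Sup (ereal ` S)"
  proof (rule dense_le)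
    fix x assume "x < ereal i"
    then obtain R where R: "x < ereal R" "ereal R < ereal i" using ereal_dense2 by blast
    then have "ereal R \<le> Sup (ereal ` S)" using assms(1)[of R] by (intro SUP_upper) simp
    then show "x \<le> Sup (ereal ` S)" using R(1) by order
  qed
qed

lemma Inf_ereal_threshold:
  assumes "\<And>R. i < R \<Longrightarrow> R \<in> S" "\<And>R. R < i \<Longrightarrow> R \<notin> S"
  shows "Inf (ereal ` S) = ereal i"
proof (rule antisym)
  show "ereal i \<le> Inf (ereal ` S)" using assms(2) by (intro INF_greatest) (force simp: not_less[symmetric])
  show "Inf (ereal ` S) \<le> ereal i"
  proof (rule dense_ge)
    fix x assume "ereal i < x"
    then obtain R where R: "ereal i < ereal R" "ereal R < x" using ereal_dense2 by blast
    then have "Inf (ereal ` S) \<le> ereal R" using assms(1)[of R] by (intro INF_lower) simp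
    then show "Inf (ereal ` S) \<le> x" using R(2) by order
  qed
qed

subsection \<open>Asymptotics for the Markov alternative\<close>

lemma powr_block:
  assumes "G > 0"
  shows "(G ^ n) powr (1 / s) * exp (- real n * r) powr t = exp (real n * (ln G / s - t * r))"
proof -
  have "G ^ n = exp (real n * ln G)" using assms by (simp add: exp_of_nat_mult)
  then show ?thesis by (simp add: powr_def exp_add[symmetric] algebra_simps add_divide_distrib)
qed

lemma composite_test_exists_exp:
  fixes V P :: "('x::finite \<times> 'y::finite \<times> 'z::finite) pmf"
  assumes dom: "marg_XY_dominated V (marg_XY P)" and s: "0 < s" "s < 1"
  obtains T where "is_test n T" "err_beta (markov_alt P) n T \<le> exp (- real n * r)"
    "err_alpha V n T \<le> exp (real n * ((ln (cond_power_sum V (marg_XY P) s) + (1 - s) * r) / s))"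
proof -
  define G where "G = cond_power_sum V (marg_XY P) s"
  have "G > 0" unfolding G_def using dom s(1) by (rule cond_power_sum_pos)
  then have "(G ^ n) powr (1 / s) * exp (- real n * r) powr (- ((1 - s) / s)) = exp (real n * ((ln G + (1 - s) * r) / s))"
    unfolding powr_block[OF \<open>G > 0\<close>] by (simp add: add_divide_distrib)
  then show ?thesis
    using composite_test_exists[OF dom s, of "exp (- real n * r)" n] that unfolding G_def by auto
qed

lemma strong_converse_exp:
  fixes V P :: "('x::finite \<times> 'y::finite \<times> 'z::finite) pmf"
  assumes s: "1 < s" and dom: "\<And>a. pmf (chan_prod (marg_XY P) W) a = 0 \<Longrightarrow> pmf V a = 0"
    and T: "is_test n T" and beta: "err_beta (markov_alt P) n T \<le> exp (- real n * r)"
  shows "1 - err_alpha V n T \<le> exp (real n * ((ln (power_sum V (chan_prod (marg_XY P) W) s) - (s - 1) * r) / s))"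
proof -
  define G where "G = power_sum V (chan_prod (marg_XY P) W) s"
  have G: "G > 0" unfolding G_def using dom by (rule power_sum_pos)
  have "1 - err_alpha V n T \<le> (G ^ n) powr (1 / s) * exp (- real n * r) powr (1 - 1 / s)"
    unfolding G_def using s dom T beta by (rule strong_converse_block)
  also have "\<dots> = exp (real n * (ln G / s - (1 - 1 / s) * r))" by (rule powr_block[OF G])
  also have "ln G / s - (1 - 1 / s) * r = (ln G - (s - 1) * r) / s" using s by (simp add: field_simps)
  finally show ?thesis by (simp add: G_def)
qed

text \<open>An event of probability at least 1/2 under \<open>V\<close> cannot be rarer under
  \<open>Q\<close> than the divergence allows: the Hoelder bound, at an order \<open>r\<close> close
  enough to 1 for \<open>k\<close>, is solved for the probability under \<open>Q\<close>.\<close>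

lemma change_of_measure_exp:
  fixes V Q :: "'a::finite pmf"
  assumes dom: "\<And>a. pmf Q a = 0 \<Longrightarrow> pmf V a = 0" and k: "kl V (pmf Q) < k"
  obtains c where "c > 0" "\<And>n T. is_test n T \<Longrightarrow> (\<Sum>ws | length ws = n. pmf (replicate_pmf n V) ws * T ws) \<ge> 1 / 2 \<Longrightarrow>
    (\<Sum>ws | length ws = n. pmf (replicate_pmf n Q) ws * T ws) \<ge> c * exp (- real n * k)"
proof -
  have "ln (power_sum V Q 1) = 0" using power_sum_1[of Q V, OF dom] by simp
  from DERIV_below_line_right[OF this DERIV_ln_power_sum_1[of Q V, OF dom] k]
  obtain r where r: "1 < r" "ln (power_sum V Q r) < k * (r - 1)" by blast
  define G where "G = power_sum V Q r"
  have G: "G > 0" unfolding G_def using dom by (rule power_sum_pos)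
  \<comment> \<open>The conjugate exponent of \<open>r\<close>: raising to the power
    \<open>p\<close> brings the probability \<open>S\<close> to the first power and leaves the
    constant \<open>(1 / 2) powr p\<close>.\<close>
  define p where "p = r / (r - 1)"
  have p: "p > 0" "(1 - 1 / r) * p = 1" "1 / r * p = 1 / (r - 1)" using r by (auto simp: p_def field_simps)
  show ?thesis
  proof (rule that[of "(1 / 2) powr p"])
    fix n and T :: "'a list \<Rightarrow> real"
    assume T: "is_test n T" and V: "(\<Sum>ws | length ws = n. pmf (replicate_pmf n V) ws * T ws) \<ge> 1 / 2"
    define S where "S = (\<Sum>ws | length ws = n. pmf (replicate_pmf n Q) ws * T ws)"
    have S: "S \<ge> 0" unfolding S_def using T by (intro sum_nonneg) (auto simp: is_test_def)
    have "(\<Sum>ws | length ws = n. pmf (replicate_pmf n V) ws * T ws) \<le> (G ^ n) powr (1 / r) * S powr (1 - 1 / r)"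
      unfolding G_def S_def using r(1) dom T by (rule change_of_measure_block)
    with V have "1 / 2 \<le> (G ^ n) powr (1 / r) * S powr (1 - 1 / r)" by linarith
    then have "(1 / 2) powr p \<le> ((G ^ n) powr (1 / r) * S powr (1 - 1 / r)) powr p"
      using p by (intro powr_mono2) auto
    also have "\<dots> = (G ^ n) powr (1 / r * p) * S powr ((1 - 1 / r) * p)"
      by (simp only: powr_mult powr_powr)
    also have "\<dots> = (G ^ n) powr (1 / (r - 1)) * S"
      unfolding p(2,3) using S by simp
    also have "(G ^ n) powr (1 / (r - 1)) = exp (real n * (ln G / (r - 1)))"
    proof -
      have "G ^ n = exp (real n * ln G)" using G by (simp add: exp_of_nat_mult)
      then show ?thesis by (simp add: powr_def)
    qed
    also have "exp (real n * (ln G / (r - 1))) * S \<le> exp (real n * k) * S"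
    proof -
      have "ln G / (r - 1) \<le> k" using r by (simp add: G_def field_simps)
      then have "real n * (ln G / (r - 1)) \<le> real n * k" by (rule mult_left_mono) simp
      then show ?thesis using S by (intro mult_right_mono) simp_all
    qed
    finally have "(1 / 2) powr p * exp (- real n * k) \<le> exp (real n * k) * S * exp (- real n * k)"
      by (intro mult_right_mono) auto
    also have "\<dots> = S" by (simp add: exp_minus field_simps)
    finally show "(1 / 2) powr p * exp (- real n * k) \<le> (\<Sum>ws | length ws = n. pmf (replicate_pmf n Q) ws * T ws)"
      by (simp add: S_def)
  qed simp
qed

text \<open>Used for \<open>P\<close> with its own conditional and for tilted distributions with the
  optimal channel; agreement on the support suffices for \<open>kl\<close>.\<close>

lemma DERIV_ln_cond_power_sum_channel:
  assumes dom: "marg_XY_dominated V U"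
    and W: "\<And>x y z. pmf V (x, y, z) > 0 \<Longrightarrow> marg_YZ_fun V y z / marg_Y_fun V y = pmf (W y) z"
  shows "((\<lambda>s. ln (cond_power_sum V U s)) has_real_derivative kl V (pmf (chan_prod U W))) (at 1)"
proof -
  have "kl V (\<lambda>(x, y, z). pmf U (x, y) * (marg_YZ_fun V y z / marg_Y_fun V y)) = kl V (pmf (chan_prod U W))"
    by (intro kl_pos_cong) (auto simp: pmf_chan_prod simp flip: W)
  then show ?thesis using DERIV_ln_cond_power_sum_1[OF dom] by simp
qed

lemma is_test_complement: "is_test n T \<Longrightarrow> is_test n (\<lambda>ws. 1 - T ws)"
  by (auto simp: is_test_def)

section \<open>The testing problem in natural units and its tilted family\<close>

locale markov_testing =
  fixes P :: "('x::finite \<times> 'y::finite \<times> 'z::finite) pmf" and L L' :: "real \<Rightarrow> real"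
  assumes L_def: "L = (\<lambda>s. ln (cond_power_sum P (marg_XY P) s))"
    and L': "\<And>s. s > 0 \<Longrightarrow> (L has_real_derivative L' s) (at s)"
    and L'_continuous: "continuous_on {0<..} L'"
begin

definition rate :: "real \<Rightarrow> real" where "rate s = s * L' s - L s"

definition tilted :: "real \<Rightarrow> ('x \<times> 'y \<times> 'z) pmf" where
  "tilted s = tilt P (chan_prod (marg_XY P) (opt_chan P (marg_XY P) s)) s"

abbreviation alpha_at :: "real \<Rightarrow> nat \<Rightarrow> real" where
  "alpha_at r n \<equiv> alpha_hat P (markov_alt P) n (exp (- real n * r))"

lemma dom: "marg_XY_dominated P (marg_XY P)"
  by (rule marg_XY_dominated_self)

lemma opt_dom: "s > 0 \<Longrightarrow> pmf (chan_prod (marg_XY P) (opt_chan P (marg_XY P) s)) a = 0 \<Longrightarrow> pmf P a = 0"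
  by (rule opt_chan_dominates[OF dom])

lemma L_1: "L 1 = 0"
  using cond_power_sum_1[OF dom] by (simp add: L_def)

lemma L'_1: "(L has_real_derivative kl P (pmf (chan_prod (marg_XY P) (cond_Z_Y P)))) (at 1)"
  unfolding L_def using dom
proof (rule DERIV_ln_cond_power_sum_channel)
  fix x y z assume "pmf P (x, y, z) > 0"
  then show "marg_YZ_fun P y z / marg_Y_fun P y = pmf (cond_Z_Y P y) z"
    using pmf_pos_marginals_pos[of P x y z] by (simp add: pmf_cond_Z_Y)
qed

lemma rate_mono: "0 < s \<Longrightarrow> s \<le> t \<Longrightarrow> rate s \<le> rate t"
  unfolding rate_def using convex_on_ln_cond_power_sum[OF dom] L'
  by (intro legendre_mono) (auto simp: L_def)

lemma rate_continuous: "continuous_on {0<..} rate"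
proof -
  have "continuous_on {0<..} L"
    using L' by (intro continuous_at_imp_continuous_on) (auto dest: DERIV_isCont)
  then show ?thesis unfolding rate_def[abs_def] using L'_continuous by (intro continuous_intros)
qed

text \<open>\<open>rate s\<close> appears in two roles: as divergence from one optimal alternative,
  which limits all tests, and as slope at 1 against all Markov alternatives, which provides good
  tests. The divergence from \<open>P\<close> is the exponential cost. Order 1 is excluded because
  there the channel inequality changes direction.\<close>

lemma tilted_properties:
  assumes s: "s > 0" "s \<noteq> 1"
  shows "kl (tilted s) (pmf (chan_prod (marg_XY P) (opt_chan P (marg_XY P) s))) = rate s"
    and "kl (tilted s) (pmf P) = (s - 1) * L' s - L s"
    and "pmf (tilted s) a = 0 \<longleftrightarrow> pmf P a = 0"
    and "((\<lambda>t. ln (cond_power_sum (tilted s) (marg_XY P) t)) has_real_derivative rate s) (at 1)"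
    and "marg_XY_dominated (tilted s) (marg_XY P)"
proof -
  let ?Q = "chan_prod (marg_XY P) (opt_chan P (marg_XY P) s)"
  have D: "((\<lambda>t. ln (power_sum P ?Q t)) has_real_derivative L' s) (at s)"
    using dom s L'[OF s(1)] unfolding L_def by (rule DERIV_ln_power_sum_opt_chan)
  have Ls: "ln (power_sum P ?Q s) = L s" using s by (simp add: power_sum_opt_chan L_def)
  show 1: "kl (tilted s) (pmf ?Q) = rate s"
    unfolding tilted_def rate_def Ls[symmetric] using opt_dom[OF s(1)] D by (rule kl_tilt)
  show "kl (tilted s) (pmf P) = (s - 1) * L' s - L s"
    unfolding tilted_def Ls[symmetric] using opt_dom[OF s(1)] D by (rule kl_tilt)
  show 0: "pmf (tilted s) a = 0 \<longleftrightarrow> pmf P a = 0" for a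
    unfolding tilted_def using opt_dom[OF s(1)] by (rule pmf_tilt_eq_0_iff)
  show tdom: "marg_XY_dominated (tilted s) (marg_XY P)"
    using dom by (simp add: marg_XY_dominated_def 0)
  show "((\<lambda>t. ln (cond_power_sum (tilted s) (marg_XY P) t)) has_real_derivative rate s) (at 1)"
    unfolding 1[symmetric] using tdom
    by (rule DERIV_ln_cond_power_sum_channel)
      (rule tilt_opt_chan_conditional[OF dom s(1) tilted_def])
qed

section \<open>Bounds on the minimal first-kind error\<close>

lemma alpha_at_bounds: "0 \<le> alpha_at r n" "alpha_at r n \<le> 1"
proof -
  obtain T where T: "is_test n T" "alpha_at r n = err_alpha P n T"
    using alpha_hat_attained[where \<mu> = "exp (- real n * r)" and P = P and n = n] by (metis exp_ge_zero)
  show "0 \<le> alpha_at r n" using T by (auto simp: err_alpha_def is_test_def intro!: sum_nonneg)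
  have "0 \<le> (\<Sum>ws | length ws = n. pmf (replicate_pmf n P) ws * T ws)"
    using T(1) by (auto simp: is_test_def intro!: sum_nonneg)
  then show "alpha_at r n \<le> 1" using T(2) by (simp add: err_alpha_altdef)
qed

lemma alpha_at_le: "is_test n T \<Longrightarrow> err_beta (markov_alt P) n T \<le> exp (- real n * r) \<Longrightarrow> alpha_at r n \<le> err_alpha P n T"
  using alpha_hat_attained[where \<mu> = "exp (- real n * r)" and P = P and n = n] by (metis exp_ge_zero)

lemma alpha_at_attained:
  obtains T where "is_test n T" "err_beta (markov_alt P) n T \<le> exp (- real n * r)" "alpha_at r n = err_alpha P n T"
  using alpha_hat_attained[where \<mu> = "exp (- real n * r)" and P = P and n = n] by (metis exp_ge_zero)

lemma alpha_at_upper: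
  assumes "0 < s" "s < 1"
  shows "alpha_at r n \<le> exp (- real n * (- (L s + (1 - s) * r) / s))"
proof -
  obtain T where T: "is_test n T" "err_beta (markov_alt P) n T \<le> exp (- real n * r)"
    "err_alpha P n T \<le> exp (real n * ((L s + (1 - s) * r) / s))"
    using composite_test_exists_exp[OF dom assms, of n r] unfolding L_def by blast
  have "alpha_at r n \<le> exp (real n * ((L s + (1 - s) * r) / s))"
    using alpha_at_le[OF T(1,2)] T(3) by linarith
  also have "real n * ((L s + (1 - s) * r) / s) = - real n * (- (L s + (1 - s) * r) / s)"
    using assms by (simp add: field_simps)
  finally show ?thesis .
qed

lemma alpha_at_lower:
  assumes "1 < s"
  shows "1 - alpha_at r n \<le> exp (- real n * (((s - 1) * r - L s) / s))"
proof -
  obtain T where T: "is_test n T" "err_beta (markov_alt P) n T \<le> exp (- real n * r)" "alpha_at r n = err_alpha P n T"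
    by (rule alpha_at_attained)
  have s: "s > 0" using assms by simp
  have "1 - err_alpha P n T \<le> exp (real n * ((ln (power_sum P (chan_prod (marg_XY P) (opt_chan P (marg_XY P) s)) s) - (s - 1) * r) / s))"
    using assms opt_dom[OF s] T(1,2) by (rule strong_converse_exp)
  then have "1 - alpha_at r n \<le> exp (real n * ((L s - (s - 1) * r) / s))"
    unfolding T(3) power_sum_opt_chan[OF s] L_def .
  also have "real n * ((L s - (s - 1) * r) / s) = - real n * (((s - 1) * r - L s) / s)"
    using s by (simp add: field_simps)
  finally show ?thesis .
qed

text \<open>Below the slope of \<open>L\<close> at 1 there is an order \<open>s < 1\<close> at which
  the exponent in \<open>alpha_at_upper\<close> is strictly positive.\<close>

lemma alpha_at_tendsto_0:
  assumes "r < kl P (pmf (chan_prod (marg_XY P) (cond_Z_Y P)))"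
  shows "alpha_at r \<longlonglongrightarrow> 0"
proof -
  from DERIV_below_line_left[OF L_1 L'_1 assms] obtain s where s: "0 < s" "s < 1" "L s < r * (s - 1)" by blast
  then have k: "- (L s + (1 - s) * r) / s > 0" by (simp add: field_simps)
  show ?thesis
    by (rule tendsto_sandwich[OF _ _ tendsto_const tendsto_exp_neg_mult[OF k]])
      (use alpha_at_bounds alpha_at_upper[OF s(1,2)] in auto)
qed

lemma alpha_at_tendsto_1:
  assumes "kl P (pmf (chan_prod (marg_XY P) (cond_Z_Y P))) < r"
  shows "alpha_at r \<longlonglongrightarrow> 1"
proof -
  from DERIV_below_line_right[OF L_1 L'_1 assms] obtain s where s: "1 < s" "L s < r * (s - 1)" by blast
  then have k: "((s - 1) * r - L s) / s > 0" by (simp add: field_simps)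
  have "(\<lambda>n. 1 - alpha_at r n) \<longlonglongrightarrow> 0"
    by (rule tendsto_sandwich[OF _ _ tendsto_const tendsto_exp_neg_mult[OF k]])
      (use alpha_at_bounds alpha_at_lower[OF s(1)] in auto)
  from tendsto_diff[OF tendsto_const[of 1] this] show ?thesis by simp
qed

text \<open>Under \<open>tilted s\<close> every test of admissible second-kind error rejects, because the rate
  exceeds the divergence from the optimal alternative.\<close>

lemma alpha_at_ge:
  assumes s: "0 < s" "s < 1" and r: "rate s < r" and k: "(s - 1) * L' s - L s < k"
  obtains c where "c > 0" "eventually (\<lambda>n. alpha_at r n \<ge> c * exp (- real n * k)) sequentially"
proof -
  let ?V = "tilted s" and ?Q = "chan_prod (marg_XY P) (opt_chan P (marg_XY P) s)"
  have s': "s > 0" "s \<noteq> 1" using s by auto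
  note V = tilted_properties[OF s']
  have Qdom: "\<And>a. pmf ?Q a = 0 \<Longrightarrow> pmf ?V a = 0" using opt_dom[OF s(1)] V(3) by blast
  obtain c where c: "c > 0" "\<And>n T. is_test n T \<Longrightarrow> (\<Sum>ws | length ws = n. pmf (replicate_pmf n ?V) ws * T ws) \<ge> 1 / 2 \<Longrightarrow>
    (\<Sum>ws | length ws = n. pmf (replicate_pmf n P) ws * T ws) \<ge> c * exp (- real n * k)"
    using change_of_measure_exp[of P ?V k] V(2,3) k by auto
  have ps1: "ln (power_sum ?V ?Q 1) = 0" using power_sum_1[of ?Q ?V, OF Qdom] by simp
  have "kl ?V (pmf ?Q) < r" using r V(1) by simp
  \<comment> \<open>An order \<open>t > 1\<close> at which the strong converse bound for the tilted
    distribution decays with the positive exponent \<kappa>.\<close>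
  from DERIV_below_line_right[OF ps1 DERIV_ln_power_sum_1[of ?Q ?V, OF Qdom] this]
  obtain t where t: "1 < t" "ln (power_sum ?V ?Q t) < r * (t - 1)" by blast
  define \<kappa> where "\<kappa> = ((t - 1) * r - ln (power_sum ?V ?Q t)) / t"
  have \<kappa>: "\<kappa> > 0" using t by (simp add: \<kappa>_def field_simps)
  have "eventually (\<lambda>n. exp (- real n * \<kappa>) < 1 / 2) sequentially"
    using tendsto_exp_neg_mult[OF \<kappa>] by (rule order_tendstoD) simp
  then have "eventually (\<lambda>n. alpha_at r n \<ge> c * exp (- real n * k)) sequentially"
  proof eventually_elim
    case (elim n)
    obtain T where T: "is_test n T" "err_beta (markov_alt P) n T \<le> exp (- real n * r)" "alpha_at r n = err_alpha P n T"
      by (rule alpha_at_attained)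
    have "1 - err_alpha ?V n T \<le> exp (real n * ((ln (power_sum ?V ?Q t) - (t - 1) * r) / t))"
      using t(1) Qdom T(1,2) by (rule strong_converse_exp)
    also have "real n * ((ln (power_sum ?V ?Q t) - (t - 1) * r) / t) = - real n * \<kappa>"
      using t by (simp add: \<kappa>_def field_simps)
    finally have "err_alpha ?V n T \<ge> 1 / 2" using elim by simp
    \<comment> \<open>The change of measure is applied to the complementary test: rejection is
      likely under the tilted distribution, hence not too rare under \<open>P\<close>.\<close>
    then show ?case
      unfolding T(3) using c(2)[OF is_test_complement[OF T(1)]] by (simp add: err_alpha_def)
  qed
  with c(1) show ?thesis by (rule that)
qed

text \<open>Below its threshold the tilted distribution has feasible tests that accept it with
  probability tending to 1. Feasibility concerns only the alternative, so the same tests compete for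
  \<open>P\<close>, where acceptance is bounded below by the change of measure.\<close>

lemma one_minus_alpha_at_ge:
  assumes s: "1 < s" and r: "r < rate s" and k: "(s - 1) * L' s - L s < k"
  obtains c where "c > 0" "eventually (\<lambda>n. 1 - alpha_at r n \<ge> c * exp (- real n * k)) sequentially"
proof -
  let ?V = "tilted s"
  have s': "s > 0" "s \<noteq> 1" using s by auto
  note V = tilted_properties[OF s']
  obtain c where c: "c > 0" "\<And>n T. is_test n T \<Longrightarrow> (\<Sum>ws | length ws = n. pmf (replicate_pmf n ?V) ws * T ws) \<ge> 1 / 2 \<Longrightarrow>
    (\<Sum>ws | length ws = n. pmf (replicate_pmf n P) ws * T ws) \<ge> c * exp (- real n * k)"
    using change_of_measure_exp[of P ?V k] V(2,3) k by auto
  have "ln (cond_power_sum ?V (marg_XY P) 1) = 0" using cond_power_sum_1[OF V(5)] by simp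
  from DERIV_below_line_left[OF this V(4) r]
  obtain t where t: "0 < t" "t < 1" "ln (cond_power_sum ?V (marg_XY P) t) < r * (t - 1)" by blast
  define \<kappa> where "\<kappa> = - (ln (cond_power_sum ?V (marg_XY P) t) + (1 - t) * r) / t"
  have \<kappa>: "\<kappa> > 0" using t by (simp add: \<kappa>_def field_simps)
  have "eventually (\<lambda>n. exp (- real n * \<kappa>) < 1 / 2) sequentially"
    using tendsto_exp_neg_mult[OF \<kappa>] by (rule order_tendstoD) simp
  then have "eventually (\<lambda>n. 1 - alpha_at r n \<ge> c * exp (- real n * k)) sequentially"
  proof eventually_elim
    case (elim n)
    obtain T where T: "is_test n T" "err_beta (markov_alt P) n T \<le> exp (- real n * r)"
      "err_alpha ?V n T \<le> exp (real n * ((ln (cond_power_sum ?V (marg_XY P) t) + (1 - t) * r) / t))"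
      using composite_test_exists_exp[OF V(5) t(1,2), of n r] by blast
    have "real n * ((ln (cond_power_sum ?V (marg_XY P) t) + (1 - t) * r) / t) = - real n * \<kappa>"
      using t by (simp add: \<kappa>_def field_simps)
    then have "1 - err_alpha ?V n T \<ge> 1 / 2" using elim T(3) by simp
    then have "c * exp (- real n * k) \<le> 1 - err_alpha P n T"
      using c(2)[OF T(1)] by (simp add: err_alpha_altdef)
    then show ?case using alpha_at_le[OF T(1,2)] by linarith
  qed
  with c(1) show ?thesis by (rule that)
qed

text \<open>The gap between \<open>kl (tilted s) (pmf P)\<close> and the value at \<open>s\<close> of the claimed formula is
  \<open>(1 - s) / s * (r - rate s)\<close>. It vanishes at \<open>s = 1\<close>, so it takes arbitrarily small positive
  values, and positivity already enforces the side condition on \<open>rate s\<close>.\<close>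

lemma small_gap_left:
  assumes s0: "0 < s0" "s0 < 1" "rate s0 < r" and e: "e > 0"
  obtains s where "0 < s" "s < 1" "rate s < r" "(1 - s) / s * (r - rate s) \<le> e"
proof -
  define h where "h s = (1 - s) / s * (r - rate s)" for s
  show ?thesis
  proof (cases "h s0 \<le> e")
    case True
    then show ?thesis using s0 by (intro that[of s0]) (auto simp: h_def)
  next
    case False
    have "continuous_on {s0..1} h"
      unfolding h_def[abs_def] using s0
      by (intro continuous_intros continuous_on_subset[OF rate_continuous]) auto
    then obtain s where s: "s0 \<le> s" "s \<le> 1" "h s = e"
      using IVT2'[of h 1 e s0] False e s0 by (auto simp: h_def)
    have "s < 1" using s e by (cases "s = 1") (auto simp: h_def)
    moreover have "s > 0" using s s0 by simp
    ultimately have "r - rate s > 0" using s(3) e by (auto simp: h_def zero_less_mult_iff zero_less_divide_iff)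
    then show ?thesis using \<open>s < 1\<close> \<open>s > 0\<close> s(3) by (intro that[of s]) (auto simp: h_def)
  qed
qed

lemma small_gap_right:
  assumes s0: "1 < s0" "r < rate s0" and e: "e > 0"
  obtains s where "1 < s" "r < rate s" "(s - 1) / s * (rate s - r) \<le> e"
proof -
  define h where "h s = (s - 1) / s * (rate s - r)" for s
  show ?thesis
  proof (cases "h s0 \<le> e")
    case True
    then show ?thesis using s0 by (intro that[of s0]) (auto simp: h_def)
  next
    case False
    have "continuous_on {1..s0} h"
      unfolding h_def[abs_def] using s0
      by (intro continuous_intros continuous_on_subset[OF rate_continuous]) auto
    then obtain s where s: "1 \<le> s" "s \<le> s0" "h s = e"
      using IVT'[of h 1 e s0] False e s0 by (auto simp: h_def)
    have "s > 1" using s e by (cases "s = 1") (auto simp: h_def)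
    then have "rate s - r > 0" using s(3) e by (auto simp: h_def zero_less_mult_iff zero_less_divide_iff)
    then show ?thesis using \<open>s > 1\<close> s(3) by (intro that[of s]) (auto simp: h_def)
  qed
qed

subsection \<open>The exponents\<close>

context
  fixes b :: real
  assumes b: "b > 1"
begin

lemma ln_b: "ln b > 0"
  using b by simp

lemma powr_rate: "b powr (- real n * R) = exp (- real n * (R * ln b))"
  using b by (simp add: powr_def mult_ac)

lemma renyi_cmi_L: "s > 0 \<Longrightarrow> s \<noteq> 1 \<Longrightarrow> renyi_cmi b s P = ereal (L s / ((s - 1) * ln b))"
  using renyi_cmi_power_sum[OF b, of s P] by (simp add: L_def log_def)

text \<open>Up to the factor \<open>ln b\<close>, the objective in the supremum is the exponent in
  \<open>alpha_at_upper\<close>.\<close>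

lemma error_term:
  assumes "0 < s" "s < 1"
  shows "ereal ((1 - s) / s) * (renyi_cmi b s P - ereal R) = ereal (- (L s + (1 - s) * (R * ln b)) / s / ln b)"
proof -
  have "(1 - s) / s * (L s / ((s - 1) * ln b) - R) = - (L s + (1 - s) * (R * ln b)) / s / ln b"
    using assms ln_b by (simp add: divide_simps) (simp add: algebra_simps)
  then show ?thesis using renyi_cmi_L[of s] assms by simp
qed

lemma strong_converse_term:
  assumes "1 < s"
  shows "ereal ((s - 1) / s) * (ereal R - renyi_cmi b s P) = ereal (((s - 1) * (R * ln b) - L s) / s / ln b)"
proof -
  have "(s - 1) / s * (R - L s / ((s - 1) * ln b)) = ((s - 1) * (R * ln b) - L s) / s / ln b"
    using assms ln_b by (simp add: divide_simps)
  then show ?thesis using renyi_cmi_L[of s] assms by simp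
qed

text \<open>\<open>alpha_at_upper\<close> makes every order a lower bound. Conversely, an order with
  small gap makes \<open>alpha_at_ge\<close> nearly match its own objective; this half bounds even
  the limsup.\<close>

lemma error_exponent_eq:
  assumes s0: "0 < s0" "s0 < 1" "rate s0 < R * ln b"
  shows "error_exponent b P (markov_alt P) R =
    (SUP s\<in>{0<..<1}. ereal ((1 - s) / s) * (renyi_cmi b s P - ereal R))" (is "?e = ?S")
proof (rule antisym)
  define r where "r = R * ln b"
  have e: "?e = liminf (\<lambda>n. ereal (- 1 / real n) * elog b (alpha_at r n))"
    unfolding error_exponent_def powr_rate r_def ..
  show "?S \<le> ?e"
  proof (rule SUP_least)
    fix s :: real assume "s \<in> {0<..<1}"
    then have s: "0 < s" "s < 1" by auto
    show "ereal ((1 - s) / s) * (renyi_cmi b s P - ereal R) \<le> ?e"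
      unfolding error_term[OF s] e r_def
      by (rule Liminf_exponent_ge[OF b alpha_at_bounds(1) alpha_at_upper[OF s]])
  qed
  show "?e \<le> ?S"
  proof (rule ereal_le_epsilon2)
    fix d :: real assume d: "d > 0"
    define e where "e = d * ln b / 2"
    have epos: "e > 0" using d ln_b by (simp add: e_def)
    have ee: "e + e = d * ln b" by (simp add: e_def)
    obtain s where s: "0 < s" "s < 1" "rate s < r" "(1 - s) / s * (r - rate s) \<le> e"
      using small_gap_left[OF s0 epos] unfolding r_def by blast
    define k where "k = (s - 1) * L' s - L s + e"
    obtain c where c: "c > 0" "eventually (\<lambda>n. alpha_at r n \<ge> c * exp (- real n * k)) sequentially"
      using alpha_at_ge[OF s(1-3), of k] epos by (auto simp: k_def)
    \<comment> \<open>The cost of imitating the tilted distribution is the objective at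
      \<open>s\<close> plus the gap plus the slack \<open>e\<close>; gap and slack each take at most
      half of \<open>d * ln b\<close>.\<close>
    have "k = - (L s + (1 - s) * r) / s + (1 - s) / s * (r - rate s) + e"
      using s(1) by (simp add: k_def rate_def divide_simps) (simp add: algebra_simps)
    then have "k \<le> - (L s + (1 - s) * r) / s + d * ln b" using s(4) ee by linarith
    then have "k / ln b \<le> (- (L s + (1 - s) * r) / s + d * ln b) / ln b"
      using ln_b by (intro divide_right_mono) auto
    also have "\<dots> = - (L s + (1 - s) * r) / s / ln b + d"
      using ln_b by (simp add: add_divide_distrib)
    finally have k: "k / ln b \<le> - (L s + (1 - s) * r) / s / ln b + d" .
    have "?e \<le> limsup (\<lambda>n. ereal (- 1 / real n) * elog b (alpha_at r n))"
      unfolding e by (rule Liminf_le_Limsup) simp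
    also have "\<dots> \<le> ereal (k / ln b)" by (rule Limsup_exponent_le[OF b c])
    also have "\<dots> \<le> ereal (- (L s + (1 - s) * r) / s / ln b) + ereal d" using k by simp
    also have "\<dots> \<le> ?S + ereal d"
      unfolding r_def error_term[OF s(1,2), symmetric] using s
      by (intro add_right_mono SUP_upper) auto
    finally show "?e \<le> ?S + ereal d" .
  qed
qed

text \<open>The same scheme for the success probability with orders above 1; here the lower bound
  holds even for the liminf.\<close>

lemma strong_converse_exponent_eq:
  assumes s0: "1 < s0" "R * ln b < rate s0"
  shows "strong_converse_exponent b P (markov_alt P) R =
    (SUP s\<in>{1<..}. ereal ((s - 1) / s) * (ereal R - renyi_cmi b s P))" (is "?e = ?S")
proof (rule antisym)
  define r where "r = R * ln b"
  have e: "?e = limsup (\<lambda>n. ereal (- 1 / real n) * elog b (1 - alpha_at r n))"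
    unfolding strong_converse_exponent_def powr_rate r_def ..
  have nn: "0 \<le> 1 - alpha_at r n" for n using alpha_at_bounds(2)[of n r] by simp
  show "?S \<le> ?e"
  proof (rule SUP_least)
    fix s :: real assume "s \<in> {1<..}"
    then have s: "1 < s" by auto
    have "ereal ((s - 1) / s) * (ereal R - renyi_cmi b s P) \<le> liminf (\<lambda>n. ereal (- 1 / real n) * elog b (1 - alpha_at r n))"
      unfolding strong_converse_term[OF s] r_def[symmetric]
      by (rule Liminf_exponent_ge[OF b nn alpha_at_lower[OF s]])
    also have "\<dots> \<le> ?e" unfolding e by (rule Liminf_le_Limsup) simp
    finally show "ereal ((s - 1) / s) * (ereal R - renyi_cmi b s P) \<le> ?e" .
  qed
  show "?e \<le> ?S"
  proof (rule ereal_le_epsilon2)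
    fix d :: real assume d: "d > 0"
    define e where "e = d * ln b / 2"
    have epos: "e > 0" using d ln_b by (simp add: e_def)
    have ee: "e + e = d * ln b" by (simp add: e_def)
    obtain s where s: "1 < s" "r < rate s" "(s - 1) / s * (rate s - r) \<le> e"
      using small_gap_right[OF s0 epos] unfolding r_def by blast
    define k where "k = (s - 1) * L' s - L s + e"
    obtain c where c: "c > 0" "eventually (\<lambda>n. 1 - alpha_at r n \<ge> c * exp (- real n * k)) sequentially"
      using one_minus_alpha_at_ge[OF s(1,2), of k] epos by (auto simp: k_def)
    have "k = ((s - 1) * r - L s) / s + (s - 1) / s * (rate s - r) + e"
      using s(1) by (simp add: k_def rate_def divide_simps) (simp add: algebra_simps)
    then have "k \<le> ((s - 1) * r - L s) / s + d * ln b" using s(3) ee by linarith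
    then have "k / ln b \<le> (((s - 1) * r - L s) / s + d * ln b) / ln b"
      using ln_b by (intro divide_right_mono) auto
    also have "\<dots> = ((s - 1) * r - L s) / s / ln b + d"
      using ln_b by (simp add: add_divide_distrib)
    finally have k: "k / ln b \<le> ((s - 1) * r - L s) / s / ln b + d" .
    have "?e \<le> ereal (k / ln b)" unfolding e by (rule Limsup_exponent_le[OF b c])
    also have "\<dots> \<le> ereal (((s - 1) * r - L s) / s / ln b) + ereal d" using k by simp
    also have "\<dots> \<le> ?S + ereal d"
      unfolding r_def strong_converse_term[OF s(1), symmetric] using s
      by (intro add_right_mono SUP_upper) auto
    finally show "?e \<le> ?S + ereal d" .
  qed
qed

text \<open>The minimal error tends to 0 strictly below the conditional mutual information and to 1
  strictly above it; the boundary point does not affect the supremum.\<close>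

lemma threshold_rate_eq: "threshold_rate b P (markov_alt P) = cmi b P"
  unfolding threshold_rate_def cmi_kl
proof (rule Sup_ereal_threshold)
  let ?d = "kl P (pmf (chan_prod (marg_XY P) (cond_Z_Y P)))"
  show "R \<in> {R. limsup (\<lambda>n. ereal (alpha_hat P (markov_alt P) n (b powr (- real n * R)))) = 0}"
    if "R < ?d / ln b" for R
  proof -
    have "alpha_at (R * ln b) \<longlonglongrightarrow> 0" using that ln_b by (intro alpha_at_tendsto_0) (simp add: field_simps)
    then have "limsup (\<lambda>n. ereal (alpha_at (R * ln b) n)) = ereal 0" by (intro lim_imp_Limsup) auto
    then show ?thesis by (simp only: powr_rate mem_Collect_eq zero_ereal_def)
  qed
  show "R \<notin> {R. limsup (\<lambda>n. ereal (alpha_hat P (markov_alt P) n (b powr (- real n * R)))) = 0}"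
    if "?d / ln b < R" for R
  proof -
    have "alpha_at (R * ln b) \<longlonglongrightarrow> 1" using that ln_b by (intro alpha_at_tendsto_1) (simp add: field_simps)
    then have "limsup (\<lambda>n. ereal (alpha_at (R * ln b) n)) = ereal 1" by (intro lim_imp_Limsup) auto
    then show ?thesis by (simp only: powr_rate mem_Collect_eq) simp
  qed
qed

lemma strong_converse_threshold_rate_eq: "strong_converse_threshold_rate b P (markov_alt P) = cmi b P"
  unfolding strong_converse_threshold_rate_def cmi_kl
proof (rule Inf_ereal_threshold)
  let ?d = "kl P (pmf (chan_prod (marg_XY P) (cond_Z_Y P)))"
  show "R \<notin> {R. liminf (\<lambda>n. ereal (alpha_hat P (markov_alt P) n (b powr (- real n * R)))) = 1}"
    if "R < ?d / ln b" for R
  proof -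
    have "alpha_at (R * ln b) \<longlonglongrightarrow> 0" using that ln_b by (intro alpha_at_tendsto_0) (simp add: field_simps)
    then have "liminf (\<lambda>n. ereal (alpha_at (R * ln b) n)) = ereal 0" by (intro lim_imp_Liminf) auto
    then show ?thesis by (simp only: powr_rate mem_Collect_eq) simp
  qed
  show "R \<in> {R. liminf (\<lambda>n. ereal (alpha_hat P (markov_alt P) n (b powr (- real n * R)))) = 1}"
    if "?d / ln b < R" for R
  proof -
    have "alpha_at (R * ln b) \<longlonglongrightarrow> 1" using that ln_b by (intro alpha_at_tendsto_1) (simp add: field_simps)
    then have "liminf (\<lambda>n. ereal (alpha_at (R * ln b) n)) = ereal 1" by (intro lim_imp_Liminf) auto
    then show ?thesis by (simp only: powr_rate mem_Collect_eq one_ereal_def)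
  qed
qed

section \<open>The limits \<open>R_zero\<close> and \<open>R_infty\<close>\<close>

lemma renyi_phi_L:
  assumes "s > 0"
  shows "renyi_phi b P s = L s / ln b"
proof (cases "s = 1")
  \<comment> \<open>At order 1 the factor \<open>s - 1\<close> removes the divergence, matching
    \<open>L 1 = 0\<close>; so the formula is valid across 1 and can be differentiated
    there.\<close>
  case True
  then show ?thesis by (simp add: renyi_phi_def L_1)
next
  case False
  then show ?thesis using assms renyi_cmi_L[of s] by (simp add: renyi_phi_def)
qed

lemma rate_renyi_phi:
  assumes s: "s > 0"
  shows "s * deriv (renyi_phi b P) s - renyi_phi b P s = rate s / ln b"
proof -
  have "((\<lambda>s. L s / ln b) has_real_derivative L' s / ln b) (at s)"
    using L'[OF s] by (rule DERIV_cdivide)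
  then have "(renyi_phi b P has_real_derivative L' s / ln b) (at s)"
    by (rule has_field_derivative_transform_within_open[of _ _ _ "{0<..}"]) (use s renyi_phi_L in auto)
  then show ?thesis using s by (simp add: DERIV_imp_deriv renyi_phi_L rate_def diff_divide_distrib)
qed

lemma rate_ln_b_mono: "0 < s \<Longrightarrow> s \<le> t \<Longrightarrow> rate s / ln b \<le> rate t / ln b"
  using rate_mono ln_b by (intro divide_right_mono) auto

lemma R_zero_less:
  assumes "R_zero b P < ereal R"
  obtains s where "0 < s" "s < 1" "rate s < R * ln b"
proof -
  have "((\<lambda>s. ereal (s * deriv (renyi_phi b P) s - renyi_phi b P s)) \<longlongrightarrow>
      (INF s\<in>{0<..}. ereal (rate s / ln b))) (at_right 0)"
  proof (rule Lim_transform_eventually[OF tendsto_at_right_0_mono[OF rate_ln_b_mono]])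
    show "\<forall>\<^sub>F s in at_right 0. ereal (rate s / ln b) = ereal (s * deriv (renyi_phi b P) s - renyi_phi b P s)"
      using eventually_at_right_less[of "0::real"] by eventually_elim (simp add: rate_renyi_phi)
  qed
  then have "R_zero b P = (INF s\<in>{0<..}. ereal (rate s / ln b))"
    unfolding R_zero_def by (intro tendsto_Lim) auto
  then obtain s where s: "s > 0" "rate s / ln b < R" using assms by (auto simp: INF_less_iff)
  show ?thesis
  \<comment> \<open>Decreasing the order does not increase the rate, so the witness can be moved
    below 1.\<close>
  proof (rule that[of "min s (1 / 2)"])
    have "rate (min s (1 / 2)) \<le> rate s" using s by (intro rate_mono) auto
    also have "\<dots> < R * ln b" using s ln_b by (simp add: field_simps)
    finally show "rate (min s (1 / 2)) < R * ln b" .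
  qed (use s in auto)
qed

lemma less_R_infty:
  assumes "ereal R < R_infty b P"
  obtains s where "1 < s" "R * ln b < rate s"
proof -
  have "((\<lambda>s. ereal (s * deriv (renyi_phi b P) s - renyi_phi b P s)) \<longlongrightarrow>
      (SUP s\<in>{0<..}. ereal (rate s / ln b))) at_top"
  proof (rule Lim_transform_eventually[OF tendsto_at_top_mono[OF rate_ln_b_mono]])
    show "\<forall>\<^sub>F s in at_top. ereal (rate s / ln b) = ereal (s * deriv (renyi_phi b P) s - renyi_phi b P s)"
      using eventually_gt_at_top[of "0::real"] by eventually_elim (simp add: rate_renyi_phi)
  qed
  then have "R_infty b P = (SUP s\<in>{0<..}. ereal (rate s / ln b))"
    unfolding R_infty_def by (intro tendsto_Lim) auto
  then obtain s where s: "s > 0" "R < rate s / ln b" using assms by (auto simp: less_SUP_iff)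
  show ?thesis
  \<comment> \<open>Increasing the order does not decrease the rate, so the witness can be moved
    above 1.\<close>
  proof (rule that[of "max s 2"])
    have "R * ln b < rate s" using s ln_b by (simp add: field_simps)
    also have "\<dots> \<le> rate (max s 2)" using s by (intro rate_mono) auto
    finally show "R * ln b < rate (max s 2)" .
  qed auto
qed

end

end

theorem mainTheorem9:
  fixes P :: "('x::finite \<times> 'y::finite \<times> 'z::finite) pmf" and b :: real
  assumes "b > 1"
  shows
    "(\<forall>s. s \<in> {0<..<1} \<union> {1<..} \<longrightarrow>
        renyi_cmi b s P =
          ereal (1 / (s - 1) * log b
            (\<Sum>y\<in>set_pmf (marg_Y P). pmf (marg_Y P) y *
              (\<Sum>z\<in>set_pmf (cond_Z_Y P y). pmf (cond_Z_Y P y) z *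
                (\<Sum>x\<in>set_pmf (cond_X_YZ P y z).
                   pmf (cond_X_YZ P y z) x powr s * pmf (cond_X_Y P y) x powr (1 - s))
                powr (1 / s))
              powr s)))
     \<and> threshold_rate b P (markov_alt P) = cmi b P
     \<and> strong_converse_threshold_rate b P (markov_alt P) = cmi b P
     \<and> (\<forall>R::real. ereal R > R_zero b P \<longrightarrow>
          error_exponent b P (markov_alt P) R =
            (SUP s\<in>{0<..<1}. ereal ((1 - s) / s) * (renyi_cmi b s P - ereal R)))
     \<and> (\<forall>R::real. 0 < R \<and> ereal R < R_infty b P \<longrightarrow>
          strong_converse_exponent b P (markov_alt P) R =
            (SUP s\<in>{1<..}. ereal ((s - 1) / s) * (ereal R - renyi_cmi b s P)))"
proof -
  define L where "L = (\<lambda>s. ln (cond_power_sum P (marg_XY P) s))"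
  have "C1_pos L" unfolding L_def by (rule C1_pos_ln_cond_power_sum[OF marg_XY_dominated_self])
  then obtain L' where "\<And>s. s > 0 \<Longrightarrow> (L has_real_derivative L' s) (at s)" "continuous_on {0<..} L'"
    by (rule C1_posE) (rule that)
  then interpret markov_testing P L L' by unfold_locales (simp_all add: L_def)
  show ?thesis
  proof (intro conjI allI impI)
    fix s :: real assume "s \<in> {0<..<1} \<union> {1<..}"
    then have s: "s > 0" "s \<noteq> 1" by auto
    show "renyi_cmi b s P =
          ereal (1 / (s - 1) * log b
            (\<Sum>y\<in>set_pmf (marg_Y P). pmf (marg_Y P) y *
              (\<Sum>z\<in>set_pmf (cond_Z_Y P y). pmf (cond_Z_Y P y) z *
                (\<Sum>x\<in>set_pmf (cond_X_YZ P y z).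
                   pmf (cond_X_YZ P y z) x powr s * pmf (cond_X_Y P y) x powr (1 - s))
                powr (1 / s))
              powr s))"
      unfolding cond_power_sum_conditionals[OF s(1)] by (rule renyi_cmi_power_sum[OF assms s])
  next
    fix R :: real assume "R_zero b P < ereal R"
    then obtain s where s: "0 < s" "s < 1" "rate s < R * ln b" by (rule R_zero_less[OF assms])
    show "error_exponent b P (markov_alt P) R =
            (SUP s\<in>{0<..<1}. ereal ((1 - s) / s) * (renyi_cmi b s P - ereal R))"
      by (rule error_exponent_eq[OF assms s])
  next
    fix R :: real assume "0 < R \<and> ereal R < R_infty b P"
    then obtain s where s: "1 < s" "R * ln b < rate s" using less_R_infty[OF assms, of R] by blast
    show "strong_converse_exponent b P (markov_alt P) R =
            (SUP s\<in>{1<..}. ereal ((s - 1) / s) * (ereal R - renyi_cmi b s P))"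
      by (rule strong_converse_exponent_eq[OF assms s])
  qed (rule threshold_rate_eq[OF assms], rule strong_converse_threshold_rate_eq[OF assms])
qed

end
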